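(* The set $\mathcal{G}$ of all $(F,x,y)\in C(\mathbb{R}^2)\times\mathbb{R}^2$ such that the Cauchy problem $\varphi'(t)=F(t,\varphi(t))$, $\varphi(x)=y$ has a global solution (a $C^1$ solution defined on all of $\mathbb{R}$) is $\boldsymbol{\Sigma}^0_4$-complete.
   Context: $C(\mathbb{R}^2)$ is the space of continuous real-valued functions on $\mathbb{R}^2$ with the topology of uniform convergence on compact sets; $C(\mathbb{R}^2)\times\mathbb{R}^2$ has the product topology and is Polish. A subset $A$ of a Polish space $X$ is $\boldsymbol{\Sigma}^0_4$-complete if $A$ is $\boldsymbol{\Sigma}^0_4$ (in the Borel hierarchy) and for every zero-dimensional Polish space $Y$ and every $\boldsymbol{\Sigma}^0_4$ set $B\subseteq Y$ there is a continuous $f:Y\to X$ with $B=f^{-1}(A)$. *)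

theory Defs
  imports "HOL-Analysis.Analysis"
begin

definition Polish_space :: "'a topology \<Rightarrow> bool" where
  "Polish_space X \<longleftrightarrow> completely_metrizable_space X \<and> separable_space X"

text \<open>
  The finite levels of the Borel hierarchy: \<open>Sigma0 X n A\<close> says that \<open>A\<close> is a
  \<open>\<Sigma>\<^sup>0\<^sub>n\<close> subset of \<open>X\<close>. A set is \<open>\<Pi>\<^sup>0\<^sub>m\<close> if its complement is \<open>\<Sigma>\<^sup>0\<^sub>m\<close>;
  for \<open>n \<ge> 2\<close> the \<open>\<Sigma>\<^sup>0\<^sub>n\<close> sets are the countable unions of sets each of which
  is \<open>\<Pi>\<^sup>0\<^sub>m\<close> for some \<open>1 \<le> m < n\<close>. There is no level \<open>0\<close>.
\<close>

inductive Sigma0 :: "'a topology \<Rightarrow> nat \<Rightarrow> 'a set \<Rightarrow> bool" for X :: "'a topology" where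
  Sigma0_open: "openin X U \<Longrightarrow> Sigma0 X 1 U"
| Sigma0_Union:
    "n \<ge> 2 \<Longrightarrow>
     (\<And>k. 1 \<le> m k \<and> m k < n \<and> A k \<subseteq> topspace X \<and> Sigma0 X (m k) (topspace X - A k)) \<Longrightarrow>
     Sigma0 X n (\<Union>k::nat. A k)"

text \<open>
  A definition cannot quantify over types, so the type \<open>'b\<close> carrying the
  zero-dimensional Polish spaces \<open>Y\<close> is a parameter. A theorem about
  \<open>Sigma0_complete TYPE('b)\<close> with \<open>'b\<close> a type variable covers all of them.
  \<open>Y dim_le 0\<close> means that \<open>Y\<close> has a base of clopen sets.
\<close>

definition Sigma0_complete :: "'b itself \<Rightarrow> 'a topology \<Rightarrow> nat \<Rightarrow> 'a set \<Rightarrow> bool" where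
  "Sigma0_complete (_ :: 'b itself) X n A \<longleftrightarrow>
     Polish_space X \<and> Sigma0 X n A \<and>
     (\<forall>(Y :: 'b topology) B. Polish_space Y \<and> Y dim_le 0 \<and> Sigma0 Y n B \<longrightarrow>
        (\<exists>f. continuous_map Y X f \<and> B = {y \<in> topspace Y. f y \<in> A}))"

text \<open>
  The space \<open>C(\<real>\<^sup>2)\<close> with the topology of uniform convergence on compact sets.
\<close>

definition C_plane :: "(real \<times> real \<Rightarrow> real) topology" where
  "C_plane = topology (\<lambda>U. U \<subseteq> {F. continuous_on UNIV F} \<and>
     (\<forall>F\<in>U. \<exists>K e. compact K \<and> e > 0 \<and>
        {G. continuous_on UNIV G \<and> (\<forall>p\<in>K. \<bar>G p - F p\<bar> < e)} \<subseteq> U))"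

lemma openin_C_plane:
  "openin C_plane U \<longleftrightarrow> U \<subseteq> {F. continuous_on UNIV F} \<and>
     (\<forall>F\<in>U. \<exists>K e. compact K \<and> e > 0 \<and>
        {G. continuous_on UNIV G \<and> (\<forall>p\<in>K. \<bar>G p - F p\<bar> < e)} \<subseteq> U)"
proof -
  define N where "N = (\<lambda>F K e. {G :: real \<times> real \<Rightarrow> real.
    continuous_on UNIV G \<and> (\<forall>p\<in>K. \<bar>G p - F p\<bar> < e)})"
  define P where "P = (\<lambda>U. U \<subseteq> {F :: real \<times> real \<Rightarrow> real. continuous_on UNIV F} \<and>
    (\<forall>F\<in>U. \<exists>K e. compact K \<and> e > 0 \<and> N F K e \<subseteq> U))"
  have "P (S \<inter> T)" if S: "P S" and T: "P T" for S T
    unfolding P_def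
  proof (intro conjI ballI)
    show "S \<inter> T \<subseteq> {F. continuous_on UNIV F}" using S unfolding P_def by blast
  next
    fix F assume F: "F \<in> S \<inter> T"
    from F S obtain K d where K: "compact K" "d > 0" "N F K d \<subseteq> S" unfolding P_def by blast
    from F T obtain L e where L: "compact L" "e > 0" "N F L e \<subseteq> T" unfolding P_def by blast
    have "N F (K \<union> L) (min d e) \<subseteq> N F K d \<inter> N F L e" unfolding N_def by auto
    then have "N F (K \<union> L) (min d e) \<subseteq> S \<inter> T" using K(3) L(3) by blast
    moreover have "compact (K \<union> L)" "min d e > 0" using K L by (simp_all add: compact_Un)
    ultimately show "\<exists>K e. compact K \<and> e > 0 \<and> N F K e \<subseteq> S \<inter> T" by blast
  qed
  moreover have "P (\<Union>\<K>)" if H: "\<forall>S\<in>\<K>. P S" for \<K>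
    unfolding P_def
  proof (intro conjI ballI)
    show "\<Union>\<K> \<subseteq> {F. continuous_on UNIV F}" using H unfolding P_def by blast
  next
    fix F assume "F \<in> \<Union>\<K>"
    then obtain S where S: "S \<in> \<K>" "F \<in> S" by blast
    with H have "P S" by blast
    with S obtain K e where "compact K" "e > 0" "N F K e \<subseteq> S" unfolding P_def by blast
    with S show "\<exists>K e. compact K \<and> e > 0 \<and> N F K e \<subseteq> \<Union>\<K>" by (meson Union_upper order_trans)
  qed
  ultimately have "istopology P" unfolding istopology_def by simp
  then have "openin (topology P) = P" by (rule topology_inverse')
  then have "openin C_plane = P" unfolding C_plane_def P_def N_def .
  then show ?thesis by (simp only: P_def N_def)
qed

lemma topspace_C_plane: "topspace C_plane = {F. continuous_on UNIV F}"
proof -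
  have "openin C_plane {F. continuous_on UNIV F}"
    unfolding openin_C_plane by (auto intro!: exI[of _ "{}"] exI[of _ 1])
  moreover have "topspace C_plane \<subseteq> {F. continuous_on UNIV F}"
    using openin_topspace[of C_plane] unfolding openin_C_plane by blast
  ultimately show ?thesis using openin_subset by blast
qed

definition global_solution ::
  "(real \<times> real \<Rightarrow> real) \<Rightarrow> real \<Rightarrow> real \<Rightarrow> (real \<Rightarrow> real) \<Rightarrow> bool" where
  "global_solution F x y \<phi> \<longleftrightarrow>
     \<phi> C1_differentiable_on UNIV \<and>
     (\<forall>t. (\<phi> has_real_derivative F (t, \<phi> t)) (at t)) \<and> \<phi> x = y"

definition globally_solvable :: "((real \<times> real \<Rightarrow> real) \<times> real \<times> real) set" where
  "globally_solvable =
     {(F, x, y). continuous_on UNIV F \<and> (\<exists>\<phi>. global_solution F x y \<phi>)}"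

end

(*
  Upper bound. By translation and reflection it suffices to consider solutions on [0, oo) that start at 0.
  If for every q there are solutions that live up to time q and explode upwards later, and others that
  explode downwards later, then there is a global solution; this condition is Pi^0_3. If, say, no solution
  that lives up to time q explodes upwards later, then there is a global solution iff for some bound L,
  for each n there is a solution on [0, q + n] that is bounded by L on [0, q]. By compactness of sets of
  bounded solutions this is Sigma^0_4.

  Hardness. Every Sigma^0_4 set is the set of all y that belong to almost all sets of a sequence T_s of
  Sigma^0_2 sets. Write T_s as the union over m of the zero sets of continuous functions c_{s,m}. In stage s
  of time all solutions of a certain equation are driven to infinity unless they get stuck at a height
  m >= 1 with c_{s,m}(y) = 0; but a solution may decide at the beginning, by going down to height -k, to take
  part only from stage k on.
*)
theory Submission
  imports Defs "HOL-Complex_Analysis.Great_Picard"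
begin

section \<open>The space of continuous functions on the plane\<close>

text \<open>Non-uniqueness is the obstacle: the solutions through a point form an unbounded family,
  so solutions that live ever longer need not have a convergent subsequence, and the existence of a
  global one is at first sight only an analytic condition. Order replaces compactness. In dimension
  one the maximum of two solutions is a solution, and between two solutions there is one through
  every value. So without upward explosions a living solution can be raised to longer-living ones
  again and again, and the increasing sequence is bounded. If explosions occur in both directions
  arbitrarily late, a solution that explodes towards one that outlives it must cross it and may
  continue along it.

  In the reduction, the height of a solution is its only memory, and a stage that traps the
  survivors at a height and then lets them fall erases it. Hence the demand of stage s cannot depend
  on a choice k made at the start. This is why the quantifiers "exists k, for all n, exists m" are
  first turned into "almost all s" over a single sequence of sets, where a choice only fixes the
  stage from which the demands count.\<close>

definition cdist :: "(real \<times> real \<Rightarrow> real) \<Rightarrow> (real \<times> real \<Rightarrow> real) \<Rightarrow> real" where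
  "cdist F G = (SUP p. min \<bar>F p - G p\<bar> (1 / (1 + norm p)))"

lemma cdist_upper: "min \<bar>F p - G p\<bar> (1 / (1 + norm p)) \<le> cdist F G"
  unfolding cdist_def
proof (rule cSUP_upper)
  show "bdd_above (range (\<lambda>p. min \<bar>F p - G p\<bar> (1 / (1 + norm p))))"
    by (rule bdd_aboveI[of _ 1]) (auto simp: min_le_iff_disj field_simps add_pos_nonneg)
qed simp

lemma cdist_least:
  assumes "\<And>p. min \<bar>F p - G p\<bar> (1 / (1 + norm p)) \<le> e"
  shows "cdist F G \<le> e"
  unfolding cdist_def using assms by (intro cSUP_least) auto

lemma cdist_local:
  assumes "cdist F G < e" "e \<le> 1 / (1 + norm p)"
  shows "\<bar>F p - G p\<bar> < e"
  using cdist_upper[of F p G] assms by linarith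

text \<open>Outside the ball of radius \<open>1 / e\<close> the cap \<open>1 / (1 + norm p)\<close>
  is below \<open>e\<close>, so up to the error \<open>e\<close> only a compact set matters.\<close>

lemma cdist_le_box:
  assumes "0 < e" "\<And>p. norm p \<le> 1 / e \<Longrightarrow> \<bar>F p - G p\<bar> \<le> e"
  shows "cdist F G \<le> e"
proof (rule cdist_least)
  fix p :: "real \<times> real"
  show "min \<bar>F p - G p\<bar> (1 / (1 + norm p)) \<le> e"
  proof (cases "norm p \<le> 1 / e")
    case False
    then have "1 / e < 1 + norm p" by simp
    then have "1 < e * (1 + norm p)" using assms(1) by (simp add: field_simps)
    then have "1 / (1 + norm p) < e"
      by (subst divide_less_eq) (auto simp: add_pos_nonneg)
    then show ?thesis by simp
  qed (use assms in \<open>simp add: min.coboundedI1\<close>)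
qed

interpretation C_plane_metric: Metric_space "{F :: real \<times> real \<Rightarrow> real. continuous_on UNIV F}" cdist
proof
  fix F G H :: "real \<times> real \<Rightarrow> real"
  have "0 \<le> min \<bar>F 0 - G 0\<bar> (1 / (1 + norm (0::real \<times> real)))" by simp
  also have "\<dots> \<le> cdist F G" by (rule cdist_upper)
  finally show "0 \<le> cdist F G" .
  show "cdist F G = cdist G F"
    unfolding cdist_def by (simp add: abs_minus_commute)
  show "cdist F G = 0 \<longleftrightarrow> F = G"
  proof
    assume 0: "cdist F G = 0"
    show "F = G"
    proof
      fix p :: "real \<times> real"
      have "min \<bar>F p - G p\<bar> (1 / (1 + norm p)) \<le> 0" using cdist_upper[of F p G] 0 by simp
      moreover have "1 / (1 + norm p) > 0" by (simp add: add_pos_nonneg)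
      ultimately show "F p = G p" by linarith
    qed
  next
    assume "F = G"
    then show "cdist F G = 0" unfolding cdist_def by simp
  qed
  show "cdist F H \<le> cdist F G + cdist G H"
  proof (rule cdist_least)
    fix p :: "real \<times> real"
    have "min \<bar>F p - H p\<bar> (1 / (1 + norm p))
      \<le> min \<bar>F p - G p\<bar> (1 / (1 + norm p)) + min \<bar>G p - H p\<bar> (1 / (1 + norm p))"
    proof -
      have "1 / (1 + norm p) > 0" by (simp add: add_pos_nonneg)
      then show ?thesis by linarith
    qed
    then show "min \<bar>F p - H p\<bar> (1 / (1 + norm p)) \<le> cdist F G + cdist G H"
      using cdist_upper[of F p G] cdist_upper[of G p H] by linarith
  qed
qed

lemma mtopology_cdist: "C_plane_metric.mtopology = C_plane"
proof -
  have "openin C_plane_metric.mtopology U \<longleftrightarrow> openin C_plane U" for U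
  proof
    assume U: "openin C_plane_metric.mtopology U"
    show "openin C_plane U"
      unfolding openin_C_plane
    proof (intro conjI ballI)
      show "U \<subseteq> {F. continuous_on UNIV F}" using U unfolding C_plane_metric.openin_mtopology by blast
      fix F assume F: "F \<in> U"
      then obtain r where r: "r > 0" "C_plane_metric.mball F r \<subseteq> U" using U unfolding C_plane_metric.openin_mtopology by blast
      \<comment> \<open>\<open>cdist_le_box\<close> gives only a weak inequality, hence a radius
        strictly below \<open>r\<close>.\<close>
      define e where "e = r / 2"
      have e: "e > 0" "e < r" using r by (auto simp: e_def)
      have "{G. continuous_on UNIV G \<and> (\<forall>p\<in>cball 0 (1 / e). \<bar>G p - F p\<bar> < e)} \<subseteq> C_plane_metric.mball F r"
      proof (clarsimp simp: C_plane_metric.in_mball, intro conjI)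
        show "continuous_on UNIV F" using F U unfolding C_plane_metric.openin_mtopology by blast
        fix G :: "real \<times> real \<Rightarrow> real" assume G: "\<forall>p\<in>cball 0 (1 / e). \<bar>G p - F p\<bar> < e"
        have "cdist F G \<le> e"
        proof (rule cdist_le_box[OF e(1)])
          fix p :: "real \<times> real" assume "norm p \<le> 1 / e"
          then have "\<bar>G p - F p\<bar> < e" using G by simp
          then show "\<bar>F p - G p\<bar> \<le> e" by simp
        qed
        then show "cdist F G < r" using e by simp
      qed
      then show "\<exists>K e. compact K \<and> e > 0 \<and> {G. continuous_on UNIV G \<and> (\<forall>p\<in>K. \<bar>G p - F p\<bar> < e)} \<subseteq> U"
        using r(2) e(1) compact_cball by blast
    qed
  next
    assume U: "openin C_plane U"
    show "openin C_plane_metric.mtopology U"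
      unfolding C_plane_metric.openin_mtopology
    proof (intro conjI allI impI)
      show "U \<subseteq> {F. continuous_on UNIV F}" using U unfolding openin_C_plane by blast
      fix F assume "F \<in> U"
      then obtain K e where K: "compact K" "e > 0"
          "{G. continuous_on UNIV G \<and> (\<forall>p\<in>K. \<bar>G p - F p\<bar> < e)} \<subseteq> U"
        using U unfolding openin_C_plane by blast
      obtain R where R: "R > 0" "\<And>p. p \<in> K \<Longrightarrow> norm p \<le> R"
        using compact_imp_bounded[OF K(1)] bounded_pos by metis
      \<comment> \<open>On \<open>K\<close> the cap of \<open>cdist\<close> is at least
        \<open>1 / (1 + R)\<close>, so a distance below \<open>d\<close> is not due to the cap and
        bounds the difference of the values itself.\<close>
      define d where "d = min e (1 / (1 + R))"
      have d: "d > 0" "d \<le> e" "d \<le> 1 / (1 + R)" using K(2) R(1) by (auto simp: d_def)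
      have "C_plane_metric.mball F d \<subseteq> {G. continuous_on UNIV G \<and> (\<forall>p\<in>K. \<bar>G p - F p\<bar> < e)}"
      proof (clarsimp simp: C_plane_metric.in_mball)
        fix G p assume G: "cdist F G < d" and p: "p \<in> K"
        have "1 / (1 + R) \<le> 1 / (1 + norm p)"
          using R p by (intro divide_left_mono mult_pos_pos) (auto simp: add_pos_nonneg)
        then have "\<bar>F p - G p\<bar> < d" using cdist_local[OF G, of p] d by linarith
        then show "\<bar>G p - F p\<bar> < e" using d by linarith
      qed
      then show "\<exists>r>0. C_plane_metric.mball F r \<subseteq> U" using K(3) d(1) by blast
    qed
  qed
  then show ?thesis by (simp add: topology_eq)
qed

lemma metrizable_C_plane: "metrizable_space C_plane"
  using C_plane_metric.metrizable_space_mtopology mtopology_cdist by simp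

lemma C_plane_nbhd:
  assumes F: "continuous_on UNIV F" and "compact K" "e > 0"
  obtains U where "openin C_plane U" "F \<in> U" "\<And>G. G \<in> U \<Longrightarrow> continuous_on UNIV G"
    "\<And>G p. G \<in> U \<Longrightarrow> p \<in> K \<Longrightarrow> \<bar>G p - F p\<bar> < e"
proof -
  obtain R where R: "R > 0" "\<And>p. p \<in> K \<Longrightarrow> norm p \<le> R"
    using compact_imp_bounded[OF assms(2)] bounded_pos by metis
  define d where "d = min e (1 / (1 + R))"
  have d: "d > 0" "d \<le> e" "d \<le> 1 / (1 + R)" using assms(3) R(1) by (auto simp: d_def)
  have *: "\<bar>G p - F p\<bar> < e" if "cdist G F < d" "p \<in> K" for G p
  proof -
    have "1 / (1 + R) \<le> 1 / (1 + norm p)"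
      using R that by (intro divide_left_mono mult_pos_pos) (auto simp: add_pos_nonneg)
    then have "\<bar>G p - F p\<bar> < d" using cdist_local[OF that(1), of p] d by linarith
    then show ?thesis using d by linarith
  qed
  have "openin C_plane (C_plane_metric.mball F d)" using C_plane_metric.openin_mball[of F d] by (simp add: mtopology_cdist)
  moreover have "F \<in> C_plane_metric.mball F d" using F d(1) by simp
  moreover have "continuous_on UNIV G" "p \<in> K \<Longrightarrow> \<bar>G p - F p\<bar> < e" if "G \<in> C_plane_metric.mball F d" for G p
    using that *[of G p] by (auto simp: C_plane_metric.in_mball C_plane_metric.commute)
  ultimately show ?thesis using that by blast
qed

lemma limitin_C_plane:
  assumes "limitin C_plane F G sequentially" "compact K" "e > 0"
  shows "\<forall>\<^sub>F n in sequentially. \<forall>p\<in>K. \<bar>F n p - G p\<bar> < e"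
proof -
  have G: "continuous_on UNIV G" using limitin_topspace[OF assms(1)] topspace_C_plane by blast
  obtain U where U: "openin C_plane U" "G \<in> U" "\<And>H p. H \<in> U \<Longrightarrow> p \<in> K \<Longrightarrow> \<bar>H p - G p\<bar> < e"
    using C_plane_nbhd[OF G assms(2,3)] by metis
  then have "\<forall>\<^sub>F n in sequentially. F n \<in> U" using assms(1) unfolding limitin_def by blast
  then show ?thesis by eventually_elim (use U(3) in blast)
qed

lemma continuous_map_into_C_plane:
  assumes c: "\<And>x. x \<in> topspace X \<Longrightarrow> continuous_on UNIV (f x)"
    and loc: "\<And>x K e. x \<in> topspace X \<Longrightarrow> compact K \<Longrightarrow> e > 0 \<Longrightarrow>
      \<exists>U. openin X U \<and> x \<in> U \<and> (\<forall>x'\<in>U. \<forall>p\<in>K. \<bar>f x' p - f x p\<bar> < e)"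
  shows "continuous_map X C_plane f"
  unfolding continuous_map_def
proof (intro conjI allI impI)
  show "f \<in> topspace X \<rightarrow> topspace C_plane" using c by (auto simp: topspace_C_plane)
  fix V assume V: "openin C_plane V"
  show "openin X {x \<in> topspace X. f x \<in> V}"
  proof (subst openin_subopen, intro ballI)
    fix x assume x: "x \<in> {x \<in> topspace X. f x \<in> V}"
    then obtain K e where K: "compact K" "e > 0"
        "{G. continuous_on UNIV G \<and> (\<forall>p\<in>K. \<bar>G p - f x p\<bar> < e)} \<subseteq> V"
      using V unfolding openin_C_plane by blast
    obtain U where U: "openin X U" "x \<in> U" "\<forall>x'\<in>U. \<forall>p\<in>K. \<bar>f x' p - f x p\<bar> < e"
      using loc[OF _ K(1,2)] x by blast
    have "U \<subseteq> {x \<in> topspace X. f x \<in> V}"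
      using U(3) K(3) c openin_subset[OF U(1)] by blast
    then show "\<exists>T. openin X T \<and> x \<in> T \<and> T \<subseteq> {x \<in> topspace X. f x \<in> V}" using U by blast
  qed
qed

lemma mcomplete_cdist: "C_plane_metric.mcomplete"
  unfolding C_plane_metric.mcomplete_def
proof (intro allI impI)
  fix F assume F: "C_plane_metric.MCauchy F"
  then have Fc: "continuous_on UNIV (F n)" for n unfolding C_plane_metric.MCauchy_def by blast
  have unif: "\<exists>N. \<forall>m\<ge>N. \<forall>n\<ge>N. \<forall>p. norm p \<le> R \<longrightarrow> \<bar>F m p - F n p\<bar> < e" if "R > 0" "e > 0" for R e
  proof -
    define d where "d = min e (1 / (1 + R))"
    have d: "d > 0" "d \<le> e" "d \<le> 1 / (1 + R)" using that by (auto simp: d_def)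
    obtain N where N: "\<And>m n. N \<le> m \<Longrightarrow> N \<le> n \<Longrightarrow> cdist (F m) (F n) < d"
      using F d(1) unfolding C_plane_metric.MCauchy_def by meson
    have "\<bar>F m p - F n p\<bar> < e" if "m \<ge> N" "n \<ge> N" "norm p \<le> R" for m n p
    proof -
      have "1 / (1 + R) \<le> 1 / (1 + norm p)"
        using that \<open>R > 0\<close> by (intro divide_left_mono mult_pos_pos) (auto simp: add_pos_nonneg)
      then have "\<bar>F m p - F n p\<bar> < d" using cdist_local[OF N[OF that(1,2)], of p] d by linarith
      then show ?thesis using d by linarith
    qed
    then show ?thesis by blast
  qed
  have "Cauchy (\<lambda>n. F n p)" for p
  proof (rule CauchyI)
    fix e :: real assume "0 < e"
    moreover have "norm p + 1 > 0" by (simp add: add_nonneg_pos)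
    ultimately obtain N where N: "\<forall>m\<ge>N. \<forall>n\<ge>N. \<forall>q. norm q \<le> norm p + 1 \<longrightarrow> \<bar>F m q - F n q\<bar> < e"
      using unif[of "norm p + 1" e] by blast
    have "norm (F m p - F n p) < e" if "m \<ge> N" "n \<ge> N" for m n
      using N[rule_format, OF that, of p] by simp
    then have "\<forall>m\<ge>N. \<forall>n\<ge>N. norm (F m p - F n p) < e" by blast
    then show "\<exists>M. \<forall>m\<ge>M. \<forall>n\<ge>M. norm (F m p - F n p) < e" by blast
  qed
  then obtain G where G: "\<And>p. (\<lambda>n. F n p) \<longlonglongrightarrow> G p"
    unfolding Cauchy_convergent_iff convergent_def by metis
  have unifG: "\<exists>N. \<forall>m\<ge>N. \<forall>p. norm p \<le> R \<longrightarrow> \<bar>F m p - G p\<bar> \<le> e" if "R > 0" "e > 0" for R e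
  proof -
    from unif[OF that] obtain N
      where N0: "\<forall>m\<ge>N. \<forall>n\<ge>N. \<forall>p. norm p \<le> R \<longrightarrow> \<bar>F m p - F n p\<bar> < e"
      by blast
    note N = N0[rule_format]
    have "\<bar>F m p - G p\<bar> \<le> e" if "m \<ge> N" "norm p \<le> R" for m p
    proof (rule tendsto_upperbound)
      show "(\<lambda>n. \<bar>F m p - F n p\<bar>) \<longlonglongrightarrow> \<bar>F m p - G p\<bar>" by (intro tendsto_intros G)
      show "\<forall>\<^sub>F n in sequentially. \<bar>F m p - F n p\<bar> \<le> e"
        unfolding eventually_sequentially
        using N[OF that(1) _ that(2)] less_imp_le by blast
    qed simp
    then show ?thesis by blast
  qed
  have Gc: "continuous_on UNIV G"
  proof -
    have "continuous_on (ball 0 R) G" if R: "R > 0" for R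
    proof (rule uniform_limit_theorem)
      show "\<forall>\<^sub>F n in sequentially. continuous_on (ball 0 R) (F n)"
        using Fc continuous_on_subset by (intro always_eventually allI) blast
      show "uniform_limit (ball 0 R) F G sequentially"
      proof (rule uniform_limitI)
        fix e :: real assume "e > 0"
        then obtain N where N: "\<forall>m\<ge>N. \<forall>p. norm p \<le> R \<longrightarrow> \<bar>F m p - G p\<bar> \<le> e / 2"
          using unifG[OF R half_gt_zero] by blast
        have "dist (F m p) (G p) < e" if "m \<ge> N" "p \<in> ball 0 R" for m p
        proof -
          have "\<bar>F m p - G p\<bar> \<le> e / 2" using N[rule_format, OF that(1), of p] that(2) by simp
          then show ?thesis using \<open>e > 0\<close> unfolding dist_real_def by linarith
        qed
        then show "\<forall>\<^sub>F n in sequentially. \<forall>x\<in>ball 0 R. dist (F n x) (G x) < e"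
          unfolding eventually_sequentially by blast
      qed
    qed simp
    then have "continuous (at p) G" for p
      by (rule continuous_on_interior[of "ball 0 (norm p + 1)"]) (auto simp: add_nonneg_pos)
    then show ?thesis by (simp add: continuous_at_imp_continuous_on)
  qed
  have "limitin C_plane_metric.mtopology F G sequentially"
    unfolding C_plane_metric.limitin_metric
  proof (intro conjI allI impI)
    show "G \<in> {F. continuous_on UNIV F}" using Gc by simp
    fix e :: real assume e: "e > 0"
    then have e2: "e / 2 > 0" "1 / (e / 2) > 0" by auto
    obtain N where N: "\<forall>m\<ge>N. \<forall>p. norm p \<le> 1 / (e / 2) \<longrightarrow> \<bar>F m p - G p\<bar> \<le> e / 2"
      using unifG[OF e2(2,1)] by blast
    have "cdist (F m) G < e" if "m \<ge> N" for m
    proof -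
      have "cdist (F m) G \<le> e / 2"
        by (rule cdist_le_box[OF e2(1)]) (rule N[rule_format, OF that])
      then show ?thesis using e2 by linarith
    qed
    then show "\<forall>\<^sub>F x in sequentially. F x \<in> {F. continuous_on UNIV F} \<and> cdist (F x) G < e"
      using Fc unfolding eventually_sequentially by auto
  qed
  then show "\<exists>G. limitin C_plane_metric.mtopology F G sequentially" by blast
qed

section \<open>Density of the polynomials with rational coefficients\<close>

fun rat_poly_stage :: "nat \<Rightarrow> (real \<times> real \<Rightarrow> real) set" where
  "rat_poly_stage 0 = {fst, snd} \<union> range (\<lambda>r p. of_rat r)"
| "rat_poly_stage (Suc n) = rat_poly_stage n
     \<union> (\<lambda>(f, g) p. f p + g p) ` (rat_poly_stage n \<times> rat_poly_stage n)
     \<union> (\<lambda>(f, g) p. f p * g p) ` (rat_poly_stage n \<times> rat_poly_stage n)"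

definition "rat_polys = (\<Union>n. rat_poly_stage n)"

lemma countable_rat_polys: "countable rat_polys"
proof -
  have "countable (rat_poly_stage n)" for n by (induction n) auto
  then show ?thesis unfolding rat_polys_def by auto
qed

lemma rat_poly_stage_mono: "m \<le> n \<Longrightarrow> rat_poly_stage m \<subseteq> rat_poly_stage n"
  by (rule lift_Suc_mono_le) auto

lemma rat_polys_closed:
  assumes "f \<in> rat_polys" "g \<in> rat_polys"
  shows "(\<lambda>p. f p + g p) \<in> rat_polys" "(\<lambda>p. f p * g p) \<in> rat_polys"
proof -
  obtain m n where "f \<in> rat_poly_stage m" "g \<in> rat_poly_stage n"
    using assms unfolding rat_polys_def by blast
  then have fg: "(f, g) \<in> rat_poly_stage (max m n) \<times> rat_poly_stage (max m n)"
    using rat_poly_stage_mono[of m "max m n"] rat_poly_stage_mono[of n "max m n"] by auto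
  have "(\<lambda>p. f p + g p) \<in> rat_poly_stage (Suc (max m n))"
       "(\<lambda>p. f p * g p) \<in> rat_poly_stage (Suc (max m n))"
    using imageI[OF fg, of "\<lambda>(f, g) p. f p + g p"] imageI[OF fg, of "\<lambda>(f, g) p. f p * g p"]
    unfolding rat_poly_stage.simps by (auto simp del: rat_poly_stage.simps)
  then show "(\<lambda>p. f p + g p) \<in> rat_polys" "(\<lambda>p. f p * g p) \<in> rat_polys"
    unfolding rat_polys_def by blast+
qed

lemma continuous_on_rat_polys: "f \<in> rat_polys \<Longrightarrow> continuous_on S f"
proof -
  have "\<forall>f\<in>rat_poly_stage n. continuous_on S f" for n
    by (induction n) (auto intro!: continuous_intros)
  then show "f \<in> rat_polys \<Longrightarrow> continuous_on S f" unfolding rat_polys_def by blast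
qed

lemma rat_polys_const_approx:
  assumes "e > 0" shows "\<exists>h\<in>rat_polys. \<forall>p. \<bar>h p - c\<bar> < e"
proof -
  obtain r where "r \<in> \<rat>" "c - e < r" "r < c + e" using Rats_dense_in_real[of "c - e" "c + e"] assms by auto
  then obtain q where q: "c - e < of_rat q" "of_rat q < c + e" using Rats_cases by metis
  have "(\<lambda>p. of_rat q) \<in> rat_polys"
    unfolding rat_polys_def by (rule UN_I[of 0]) auto
  then show ?thesis by (rule bexI[rotated]) (use q in auto)
qed

lemma rat_polys_approx_add:
    assumes "\<And>e. e > 0 \<Longrightarrow> \<exists>h\<in>rat_polys. \<forall>p\<in>K. \<bar>h p - f p\<bar> < e"
    and "\<And>e. e > 0 \<Longrightarrow> \<exists>h\<in>rat_polys. \<forall>p\<in>K. \<bar>h p - g p\<bar> < e"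
    and "e > 0"
  shows "\<exists>h\<in>rat_polys. \<forall>p\<in>K. \<bar>h p - (f p + g p)\<bar> < e"
proof -
  obtain h1 h2 where h: "h1 \<in> rat_polys" "h2 \<in> rat_polys"
      "\<forall>p\<in>K. \<bar>h1 p - f p\<bar> < e / 2" "\<forall>p\<in>K. \<bar>h2 p - g p\<bar> < e / 2"
    using assms(1)[of "e / 2"] assms(2)[of "e / 2"] assms(3) by (meson half_gt_zero)
  show ?thesis
  proof (rule bexI[OF _ rat_polys_closed(1)[OF h(1,2)]], rule ballI)
    fix p assume "p \<in> K"
    then have "\<bar>h1 p - f p\<bar> < e / 2" "\<bar>h2 p - g p\<bar> < e / 2" using h(3,4) by auto
    then show "\<bar>h1 p + h2 p - (f p + g p)\<bar> < e" by linarith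
  qed
qed

lemma rat_polys_approx_mult:
  assumes K: "compact K" and fc: "continuous_on K f" and gc: "continuous_on K g"
    and f: "\<And>e. e > 0 \<Longrightarrow> \<exists>h\<in>rat_polys. \<forall>p\<in>K. \<bar>h p - f p\<bar> < e"
    and g: "\<And>e. e > 0 \<Longrightarrow> \<exists>h\<in>rat_polys. \<forall>p\<in>K. \<bar>h p - g p\<bar> < e"
    and e: "e > 0"
  shows "\<exists>h\<in>rat_polys. \<forall>p\<in>K. \<bar>h p - (f p * g p)\<bar> < e"
proof -
  obtain B1 where B1: "\<And>p. p \<in> K \<Longrightarrow> \<bar>f p\<bar> \<le> B1"
    using compact_continuous_image[OF fc K] compact_imp_bounded bounded_iff
    by (metis imageI real_norm_def)
  obtain B2 where B2: "\<And>p. p \<in> K \<Longrightarrow> \<bar>g p\<bar> \<le> B2"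
    using compact_continuous_image[OF gc K] compact_imp_bounded bounded_iff
    by (metis imageI real_norm_def)
  define B where "B = max 1 (max B1 B2)"
  have B: "B \<ge> 1" "\<And>p. p \<in> K \<Longrightarrow> \<bar>f p\<bar> \<le> B" "\<And>p. p \<in> K \<Longrightarrow> \<bar>g p\<bar> \<le> B"
    using B1 B2 unfolding B_def by (auto simp: le_max_iff_disj)
  \<comment> \<open>The error of the product is at most \<open>d * d + d * B + B * d\<close>; since
    \<open>d \<le> 1 \<le> B\<close>, each term is at most \<open>d * B \<le> e / 4\<close>.\<close>
  define d where "d = min 1 (e / (4 * B))"
  have d: "d > 0" "d \<le> 1" "d * B \<le> e / 4"
    using e B(1) unfolding d_def by (auto simp: min_def field_simps)
  obtain h1 h2 where h: "h1 \<in> rat_polys" "h2 \<in> rat_polys"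
      "\<forall>p\<in>K. \<bar>h1 p - f p\<bar> < d" "\<forall>p\<in>K. \<bar>h2 p - g p\<bar> < d"
    using f[OF d(1)] g[OF d(1)] by blast
  have "\<bar>h1 p * h2 p - f p * g p\<bar> < e" if p: "p \<in> K" for p
  proof -
    have eq: "h1 p * h2 p - f p * g p = (h1 p - f p) * (h2 p - g p) + (h1 p - f p) * g p + f p * (h2 p - g p)"
      by (simp add: algebra_simps)
    have "\<bar>h1 p * h2 p - f p * g p\<bar> \<le>
        \<bar>(h1 p - f p) * (h2 p - g p)\<bar> + \<bar>(h1 p - f p) * g p\<bar> + \<bar>f p * (h2 p - g p)\<bar>"
      unfolding eq by linarith
    also have "\<dots> = \<bar>h1 p - f p\<bar> * \<bar>h2 p - g p\<bar> + \<bar>h1 p - f p\<bar> * \<bar>g p\<bar> + \<bar>f p\<bar> * \<bar>h2 p - g p\<bar>"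
      by (simp only: abs_mult)
    also have "\<dots> \<le> d * 1 + d * B + B * d"
    proof (intro add_mono mult_mono)
      show "\<bar>h1 p - f p\<bar> \<le> d" "\<bar>h1 p - f p\<bar> \<le> d" "\<bar>h2 p - g p\<bar> \<le> d" "\<bar>h2 p - g p\<bar> \<le> 1"
        using bspec[OF h(3) p] bspec[OF h(4) p] d by linarith+
    qed (use B(2,3)[OF p] B(1) d in auto)
    also have "\<dots> \<le> d * B + d * B + B * d" using d B by simp
    also have "\<dots> < e" using d e by (simp add: mult.commute)
    finally show ?thesis .
  qed
  then show ?thesis using rat_polys_closed(2)[OF h(1,2)] by (intro bexI[of _ "\<lambda>p. h1 p * h2 p"]) auto
qed

lemma rat_polys_approx_poly:
  fixes f :: "real \<times> real \<Rightarrow> real"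
  assumes "real_polynomial_function f" "compact K" "e > 0"
  shows "\<exists>h\<in>rat_polys. \<forall>p\<in>K. \<bar>h p - f p\<bar> < e"
  using assms
proof (induction arbitrary: e rule: real_polynomial_function.induct)
  case (linear f)
  then interpret bounded_linear f by simp
  have fst: "fst \<in> rat_polys" "snd \<in> rat_polys" unfolding rat_polys_def by (rule UN_I[of 0]; simp)+
  \<comment> \<open>A linear functional is determined by its values at the two unit vectors; these
    are real coefficients and have to be approximated by rational ones.\<close>
  have feq: "f = (\<lambda>p. fst p * f (1, 0) + snd p * f (0, 1))"
  proof
    fix p :: "real \<times> real"
    have "f p = f (fst p *\<^sub>R (1, 0) + snd p *\<^sub>R (0, 1))" by (simp add: scaleR_prod_def)
    also have "\<dots> = fst p * f (1, 0) + snd p * f (0, 1)" unfolding add scaleR by simp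
    finally show "f p = fst p * f (1, 0) + snd p * f (0, 1)" .
  qed
  have *: "\<exists>h\<in>rat_polys. \<forall>p\<in>K. \<bar>h p - q p * c\<bar> < e" if "q \<in> rat_polys" "e > 0" for q c e
  proof (rule rat_polys_approx_mult[of K q "\<lambda>_. c"])
    show "\<exists>h\<in>rat_polys. \<forall>p\<in>K. \<bar>h p - c\<bar> < e" if "e > 0" for e
      using rat_polys_const_approx[OF that, of c] by blast
    show "\<exists>h\<in>rat_polys. \<forall>p\<in>K. \<bar>h p - q p\<bar> < e" if "e > 0" for e
      using \<open>q \<in> rat_polys\<close> \<open>e > 0\<close> by (intro bexI[of _ q]) auto
  qed (simp_all add: that linear.prems(1) continuous_on_rat_polys)
  have "\<exists>h\<in>rat_polys. \<forall>p\<in>K. \<bar>h p - (fst p * f (1, 0) + snd p * f (0, 1))\<bar> < e"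
    by (rule rat_polys_approx_add[OF *[OF fst(1)] *[OF fst(2)] linear.prems(2)])
  then show ?case by (subst feq)
next
  case (const c)
  then show ?case using rat_polys_const_approx[of e c] by blast
next
  case (add f g)
  then show ?case by (intro rat_polys_approx_add) auto
next
  case (mult f g)
  then have "continuous_on K f" "continuous_on K g"
    using continuous_on_polymonial_function real_polynomial_function_eq by blast+
  with mult show ?case by (intro rat_polys_approx_mult) auto
qed

lemma separable_C_plane: "separable_space C_plane"
  unfolding separable_space_def
proof (intro exI conjI)
  show "countable rat_polys" by (rule countable_rat_polys)
  show sub: "rat_polys \<subseteq> topspace C_plane"
    unfolding topspace_C_plane using continuous_on_rat_polys by blast
  show "C_plane closure_of rat_polys = topspace C_plane"
  proof (intro equalityI closure_of_subset_topspace subsetI)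
    fix F assume F: "F \<in> topspace C_plane"
    then have Fc: "continuous_on UNIV F" by (simp add: topspace_C_plane)
    show "F \<in> C_plane closure_of rat_polys"
      unfolding in_closure_of
    proof (intro conjI allI impI F)
      fix U assume "F \<in> U \<and> openin C_plane U"
      then obtain K e where K: "compact K" "e > 0"
          "{G. continuous_on UNIV G \<and> (\<forall>p\<in>K. \<bar>G p - F p\<bar> < e)} \<subseteq> U"
        unfolding openin_C_plane by blast
      obtain g where g: "real_polynomial_function g" "\<And>p. p \<in> K \<Longrightarrow> \<bar>F p - g p\<bar> < e / 2"
        using Stone_Weierstrass_real_polynomial_function[OF K(1) continuous_on_subset[OF Fc], of "e / 2"] K(2) by auto
      obtain h where h: "h \<in> rat_polys" "\<forall>p\<in>K. \<bar>h p - g p\<bar> < e / 2"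
        using rat_polys_approx_poly[OF g(1) K(1), of "e / 2"] K(2) by auto
      have "\<forall>p\<in>K. \<bar>h p - F p\<bar> < e"
      proof
        fix p assume "p \<in> K"
        then show "\<bar>h p - F p\<bar> < e" using g(2)[of p] bspec[OF h(2), of p] by linarith
      qed
      then have "h \<in> U" using K(3) continuous_on_rat_polys[OF h(1)] by blast
      then show "\<exists>y. y \<in> rat_polys \<and> y \<in> U" using h(1) by blast
    qed
  qed
qed

lemma separable_space_prod_topology:
  assumes "separable_space X" "separable_space Y"
  shows "separable_space (prod_topology X Y)"
proof -
  obtain C D where "countable C" "C \<subseteq> topspace X" "X closure_of C = topspace X"
      "countable D" "D \<subseteq> topspace Y" "Y closure_of D = topspace Y"
    using assms unfolding separable_space_def by metis
  then show ?thesis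
    unfolding separable_space_def
    by (intro exI[of _ "C \<times> D"]) (auto simp: closure_of_Times)
qed

lemma separable_space_euclidean: "separable_space (euclidean :: 'a::second_countable_topology topology)"
proof -
  obtain D :: "'a set" where "countable D" "\<And>X. open X \<Longrightarrow> X \<noteq> {} \<Longrightarrow> \<exists>d\<in>D. d \<in> X"
    using countable_dense_exists by (metis)
  then show ?thesis
    unfolding separable_space_def in_closure_of set_eq_iff by (intro exI[of _ D]) (auto simp: in_closure_of)
qed

lemma Polish_problems: "Polish_space (prod_topology C_plane (euclidean :: (real \<times> real) topology))"
  unfolding Polish_space_def
proof
  have "completely_metrizable_space C_plane"
    using C_plane_metric.completely_metrizable_space_mtopology[OF mcomplete_cdist] by (simp add: mtopology_cdist)
  then show "completely_metrizable_space (prod_topology C_plane (euclidean :: (real \<times> real) topology))"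
    by (simp add: completely_metrizable_space_prod_topology completely_metrizable_space_euclidean)
qed (simp add: separable_space_prod_topology separable_C_plane separable_space_euclidean)

text \<open>With closedness reduced to sequences, it can be checked by passing to limits of
  solutions of the converging fields.\<close>

lemma closedin_C_plane_sequentially:
  assumes "S \<subseteq> {F. continuous_on UNIV F}"
    and "\<And>F G. (\<And>n. F n \<in> S) \<Longrightarrow> continuous_on UNIV G \<Longrightarrow>
      (\<And>K e. compact K \<Longrightarrow> e > 0 \<Longrightarrow> \<forall>\<^sub>F n in sequentially. \<forall>p\<in>K. \<bar>F n p - G p\<bar> < e) \<Longrightarrow> G \<in> S"
  shows "closedin C_plane S"
  unfolding mtopology_cdist[symmetric] C_plane_metric.metric_closedin_iff_sequentially_closed
proof (intro conjI allI impI assms(1))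
  fix F G assume *: "range F \<subseteq> S \<and> limitin C_plane_metric.mtopology F G sequentially"
  then have lim: "limitin C_plane F G sequentially" by (simp add: mtopology_cdist)
  show "G \<in> S"
  proof (rule assms(2)[of F])
    show "F n \<in> S" for n using * by blast
    show "continuous_on UNIV G" using limitin_topspace[OF lim] topspace_C_plane by blast
    show "\<forall>\<^sub>F n in sequentially. \<forall>p\<in>K. \<bar>F n p - G p\<bar> < e" if "compact K" "e > 0" for K e
      by (rule limitin_C_plane[OF lim that])
  qed
qed

section \<open>The finite Borel classes\<close>

definition Pi0 :: "'a topology \<Rightarrow> nat \<Rightarrow> 'a set \<Rightarrow> bool" where
  "Pi0 X n A \<longleftrightarrow> A \<subseteq> topspace X \<and> Sigma0 X n (topspace X - A)"

lemma Sigma0_subset_topspace: "Sigma0 X n A \<Longrightarrow> A \<subseteq> topspace X"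
  by (induction rule: Sigma0.induct) (auto dest: openin_subset)

lemma Sigma0_openin: "openin X U \<Longrightarrow> Sigma0 X (Suc 0) U"
  using Sigma0_open by simp

lemma Sigma0_1_iff: "Sigma0 X (Suc 0) U \<longleftrightarrow> openin X U"
  by (auto elim: Sigma0.cases intro: Sigma0_openin)

lemma Pi0_1_iff: "Pi0 X (Suc 0) A \<longleftrightarrow> closedin X A"
  unfolding Pi0_def Sigma0_1_iff closedin_def by auto

lemma Sigma0_pos: "Sigma0 X n A \<Longrightarrow> 1 \<le> n"
  by (induction rule: Sigma0.induct) auto

lemma Pi0_Diff: "Sigma0 X n A \<Longrightarrow> Pi0 X n (topspace X - A)"
  unfolding Pi0_def using Sigma0_subset_topspace[of X n A] by (simp add: double_diff)

lemma Sigma0_Diff: "Pi0 X n A \<Longrightarrow> Sigma0 X n (topspace X - A)"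
  unfolding Pi0_def by simp

lemma Sigma0_UN_Pi0:
  assumes "1 \<le> n" "\<And>k::nat. Pi0 X n (A k)"
  shows "Sigma0 X (Suc n) (\<Union>k. A k)"
  by (rule Sigma0_Union[where m = "\<lambda>_. n"]) (use assms in \<open>auto simp: Pi0_def\<close>)

text \<open>The level of an open set can be raised because open sets of a metrizable space are
  countable unions of closed sets. Above level 1 the definition already admits parts of any smaller
  level.\<close>

lemma Sigma0_Suc_mono:
  assumes X: "metrizable_space X" and A: "Sigma0 X m A" and "m < n"
  shows "Sigma0 X n A"
  using A
proof cases
  case Sigma0_open
  obtain C where C: "\<And>k::nat. closedin X (C k)" "\<Union> (range C) = A"
    using open_imp_fsigma_in[OF X Sigma0_open(2)] unfolding fsigma_in_ascending by blast
  have "Sigma0 X n (\<Union>k. C k)"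
    by (rule Sigma0_Union[where m = "\<lambda>_. 1"])
      (use C(1) assms(3) Sigma0_open(1) in \<open>auto simp: Sigma0_1_iff closedin_def\<close>)
  then show ?thesis using C(2) by simp
next
  case (Sigma0_Union l B)
  have "Sigma0 X n (\<Union>k. B k)"
  proof (rule Sigma0.Sigma0_Union[where m = l])
    show "2 \<le> n" using Sigma0_Union(2) assms(3) by linarith
    show "1 \<le> l k \<and> l k < n \<and> B k \<subseteq> topspace X \<and> Sigma0 X (l k) (topspace X - B k)" for k
      using Sigma0_Union(3)[of k] assms(3) by auto
  qed
  then show ?thesis using Sigma0_Union by simp
qed

lemma Sigma0_mono: "metrizable_space X \<Longrightarrow> Sigma0 X m A \<Longrightarrow> m \<le> n \<Longrightarrow> Sigma0 X n A"
  using Sigma0_Suc_mono[of X m A n] by (cases "m = n") auto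

lemma Pi0_mono: "metrizable_space X \<Longrightarrow> Pi0 X m A \<Longrightarrow> m \<le> n \<Longrightarrow> Pi0 X n A"
  unfolding Pi0_def using Sigma0_mono by blast

lemma Pi0_imp_Sigma0_Suc: "Pi0 X n A \<Longrightarrow> Sigma0 X (Suc n) A"
  using Sigma0_UN_Pi0[of n X "\<lambda>_. A"] Sigma0_pos unfolding Pi0_def by auto

lemma Sigma0_imp_Pi0_Suc: "Sigma0 X n A \<Longrightarrow> Pi0 X (Suc n) A"
  unfolding Pi0_def using Pi0_imp_Sigma0_Suc[OF Pi0_Diff] Sigma0_subset_topspace by blast

lemma Sigma0_SucE:
  assumes X: "metrizable_space X" and A: "Sigma0 X (Suc n) A" and n: "1 \<le> n"
  obtains C where "\<And>k::nat. Pi0 X n (C k)" "A = (\<Union>k. C k)"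
  using A
proof cases
  case (Sigma0_Union l B)
  have "Pi0 X n (B k)" for k
    using Pi0_mono[OF X, of "l k" "B k" n] Sigma0_Union(3)[of k] unfolding Pi0_def by auto
  then show ?thesis using that Sigma0_Union by blast
qed (use n in auto)

lemma Sigma0_UN:
  assumes X: "metrizable_space X" and n: "1 \<le> n" and A: "\<And>k::nat. Sigma0 X n (A k)"
  shows "Sigma0 X n (\<Union>k. A k)"
proof (cases n)
  case (Suc m)
  show ?thesis
  proof (cases "m = 0")
    case True
    then show ?thesis using A Suc by (auto simp: Sigma0_1_iff)
  next
    case False
    have "\<exists>C. (\<forall>j::nat. Pi0 X m (C j)) \<and> A k = (\<Union>j. C j)" for k
      using Sigma0_SucE[OF X A[of k, unfolded Suc]] False by (metis One_nat_def Suc_leI neq0_conv)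
    then have "\<forall>k. \<exists>C. (\<forall>j::nat. Pi0 X m (C j)) \<and> A k = (\<Union>j. C j)" by blast
    from choice[OF this] obtain C where "\<forall>k. (\<forall>j::nat. Pi0 X m (C k j)) \<and> A k = (\<Union>j. C k j)" ..
    then have C: "\<And>k j. Pi0 X m (C k j)" "\<And>k. A k = (\<Union>j. C k j)" by simp_all
    have "Sigma0 X (Suc m) (\<Union>i. (\<lambda>(k, j). C k j) (prod_decode i))"
      by (rule Sigma0_UN_Pi0) (use False C(1) in \<open>auto split: prod.split\<close>)
    moreover have "(\<Union>i. (\<lambda>(k, j). C k j) (prod_decode i)) = (\<Union>k. A k)"
    proof
      have "C k j \<subseteq> (\<Union>i. (\<lambda>(k, j). C k j) (prod_decode i))" for k j
        using UN_upper[of "prod_encode (k, j)" UNIV "\<lambda>i. (\<lambda>(k, j). C k j) (prod_decode i)"] by simp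
      then show "(\<Union>k. A k) \<subseteq> (\<Union>i. (\<lambda>(k, j). C k j) (prod_decode i))" unfolding C(2) by blast
    qed (auto simp: C(2) split: prod.splits)
    ultimately show ?thesis using Suc by simp
  qed
qed (use n in simp)

lemma Sigma0_Un:
  assumes "metrizable_space X" "Sigma0 X n A" "Sigma0 X n B" shows "Sigma0 X n (A \<union> B)"
proof -
  have "Sigma0 X n (\<Union>k::nat. if k = 0 then A else B)"
    by (rule Sigma0_UN) (use assms Sigma0_pos in auto)
  moreover have "(\<Union>k::nat. if k = 0 then A else B) = A \<union> B"
    by (auto split: if_splits intro: exI[of _ "Suc 0"])
  ultimately show ?thesis by simp
qed

lemma Pi0_Int:
  assumes "metrizable_space X" "Pi0 X n A" "Pi0 X n B" shows "Pi0 X n (A \<inter> B)"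
proof -
  have "topspace X - A \<inter> B = (topspace X - A) \<union> (topspace X - B)" by blast
  then show ?thesis using assms Sigma0_Un unfolding Pi0_def by (metis le_infI1)
qed

lemma Pi0_INT:
  assumes "metrizable_space X" "1 \<le> n" "\<And>k::nat. Pi0 X n (A k)" shows "Pi0 X n (\<Inter>k. A k)"
proof -
  have "topspace X - (\<Inter>k. A k) = (\<Union>k. topspace X - A k)" by blast
  then show ?thesis using assms Sigma0_UN[of X n "\<lambda>k. topspace X - A k"] unfolding Pi0_def by auto
qed

lemma Sigma0_Int:
  assumes X: "metrizable_space X" and A: "Sigma0 X n A" and B: "Sigma0 X n B"
  shows "Sigma0 X n (A \<inter> B)"
proof (cases n)
  case 0
  then show ?thesis using Sigma0_pos[OF A] by simp
next
  case (Suc m)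
  show ?thesis
  proof (cases "m = 0")
    case True
    then show ?thesis using A B Suc by (auto simp: Sigma0_1_iff)
  next
    case False
    then have m: "1 \<le> m" by simp
    obtain C D where CD: "\<And>k::nat. Pi0 X m (C k)" "A = (\<Union>k. C k)" "\<And>k::nat. Pi0 X m (D k)" "B = (\<Union>k. D k)"
      using Sigma0_SucE[OF X A[unfolded Suc] m] Sigma0_SucE[OF X B[unfolded Suc] m] by metis
    have "Sigma0 X (Suc m) (\<Union>k. \<Union>j. C k \<inter> D j)"
      by (intro Sigma0_UN[OF X] Sigma0_UN_Pi0 m Pi0_Int[OF X] CD) simp
    moreover have "(\<Union>k. \<Union>j. C k \<inter> D j) = A \<inter> B" unfolding CD by blast
    ultimately show ?thesis using Suc by simp
  qed
qed

lemma Sigma0_vimage: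
  assumes "Sigma0 Y n A" and f: "continuous_map X Y f"
  shows "Sigma0 X n {x \<in> topspace X. f x \<in> A}"
  using assms(1)
proof induction
  case (Sigma0_open U)
  then show ?case using f by (simp add: Sigma0_1_iff openin_continuous_map_preimage)
next
  case (Sigma0_Union n m A)
  have fX: "f x \<in> topspace Y" if "x \<in> topspace X" for x using f that unfolding continuous_map_def by blast
  have "Sigma0 X n (\<Union>k. {x \<in> topspace X. f x \<in> A k})"
  proof (rule Sigma0.Sigma0_Union[where m = m])
    fix k
    have "topspace X - {x \<in> topspace X. f x \<in> A k} = {x \<in> topspace X. f x \<in> topspace Y - A k}"
      using fX by blast
    then show "1 \<le> m k \<and> m k < n \<and> {x \<in> topspace X. f x \<in> A k} \<subseteq> topspace X \<and>
        Sigma0 X (m k) (topspace X - {x \<in> topspace X. f x \<in> A k})"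
      using Sigma0_Union.IH[of k] by auto
  qed (use Sigma0_Union in auto)
  moreover have "(\<Union>k. {x \<in> topspace X. f x \<in> A k}) = {x \<in> topspace X. f x \<in> (\<Union>k. A k)}" by blast
  ultimately show ?case by simp
qed

text \<open>The function is the distance to \<open>D\<close>. For empty \<open>D\<close> this would
  be an infimum over the empty set, so a positive constant serves.\<close>

lemma closedin_zero_set:
  assumes Y: "metrizable_space Y" and D: "closedin Y D"
  obtains c where "continuous_map Y euclideanreal c" "\<And>y. 0 \<le> c y" "\<And>y. y \<in> topspace Y \<Longrightarrow> c y = 0 \<longleftrightarrow> y \<in> D"
proof (cases "D = {}")
  case True
  then show ?thesis using that[of "\<lambda>_. 1"] by simp
next
  case False
  obtain M d where Md: "Metric_space M d" "Y = Metric_space.mtopology M d"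
    using Y unfolding metrizable_space_def by blast
  interpret Metric_space M d by (rule Md(1))
  define c where "c y = (INF z\<in>D. d y z)" for y
  have DM: "D \<subseteq> M" using D closedin_subset unfolding Md(2) by fastforce
  have bdd: "bdd_below (d y ` D)" for y by (rule bdd_belowI[of _ 0]) auto
  have c0: "0 \<le> c y" for y unfolding c_def by (rule cINF_greatest[OF False]) simp
  have c_le: "c y \<le> d y z" if "z \<in> D" for y z unfolding c_def by (rule cINF_lower[OF bdd that])
  have lip: "c x \<le> c y + d x y" if "x \<in> M" "y \<in> M" for x y
  proof -
    have "c x - d x y \<le> (INF z\<in>D. d y z)"
    proof (rule cINF_greatest[OF False])
      fix z assume z: "z \<in> D"
      have "c x \<le> d x z" by (rule c_le[OF z])
      also have "\<dots> \<le> d x y + d y z" using that z DM by (intro triangle) auto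
      finally show "c x - d x y \<le> d y z" by simp
    qed
    then show ?thesis unfolding c_def by simp
  qed
  have cont: "continuous_map Y euclideanreal c"
    unfolding mtopology_is_euclidean[symmetric] Md(2) Met_TC.continuous_map_to_metric
  proof (intro ballI allI impI)
    fix x e :: real and x' assume x': "x' \<in> topspace mtopology" and e: "0 < e"
    have "c y \<in> Met_TC.mball (c x') e" if "y \<in> mball x' e" for y
      using lip[of x' y] lip[of y x'] that commute[of x' y] by (auto simp: dist_real_def)
    then show "\<exists>U. openin mtopology U \<and> x' \<in> U \<and> (\<forall>y\<in>U. c y \<in> Met_TC.mball (c x') e)"
      using x' e by (intro exI[of _ "mball x' e"]) auto
  qed
  have "c y = 0 \<longleftrightarrow> y \<in> D" if y: "y \<in> topspace Y" for y
  proof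
    assume 0: "c y = 0"
    show "y \<in> D"
    proof (rule ccontr)
      assume "y \<notin> D"
      then obtain r where r: "r > 0" "disjnt D (mball y r)"
        using D y unfolding Md(2) closedin_metric by auto
      have "r \<le> d y z" if "z \<in> D" for z
        using r(2) that y DM unfolding Md(2) disjnt_iff by (auto simp: not_le[symmetric])
      then have "r \<le> c y" unfolding c_def by (intro cINF_greatest[OF False])
      then show False using 0 r(1) by simp
    qed
  next
    assume "y \<in> D"
    then show "c y = 0" using c_le[of y y] c0[of y] DM by auto
  qed
  then show ?thesis using that cont c0 by blast
qed

text \<open>Write \<open>B\<close> as the set of all \<open>y\<close> such that \<open>\<exists>k. \<forall>n. \<exists>m. y \<in> D k n m\<close> with closed sets
  \<open>D k n m\<close>. An event at \<open>t = (k, n, M)\<close> says that \<open>M\<close> is the first stage at which all \<open>n' \<le> n\<close> have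
  found a witness for \<open>k\<close>; it labels \<open>t\<close> with \<open>k\<close>, and other \<open>t\<close> are labelled with \<open>t\<close>. So
  \<open>y \<in> B\<close> iff the labels do not tend to infinity, which means that almost every \<open>s\<close> is followed by an
  event whose label is not larger than that of \<open>s\<close>. This is the argument which shows that the index set
  of the cofinite sets is complete at the third level.\<close>

lemma eventually_Sigma0_2:
  assumes Y: "metrizable_space Y" and B: "Sigma0 Y 4 B"
  shows "\<exists>T. (\<forall>s. Sigma0 Y 2 (T s)) \<and> (\<forall>y\<in>topspace Y. y \<in> B \<longleftrightarrow> (\<exists>g::nat. \<forall>s\<ge>g. y \<in> T s))"
proof -
  \<comment> \<open>Peeling off one union at a time, with complements in between, turns membership
    into three number quantifiers over closed sets.\<close>
  have "\<exists>D. (\<forall>k n m. closedin Y (D k n m)) \<and> (\<forall>y\<in>topspace Y. y \<in> B \<longleftrightarrow> (\<exists>k::nat. \<forall>n::nat. \<exists>m::nat. y \<in> D k n m))"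
  proof -
    obtain P where P: "\<And>k::nat. Pi0 Y 3 (P k)" "B = (\<Union>k. P k)"
      using Sigma0_SucE[OF Y, of 3 B] B by auto
    have "\<exists>A. \<forall>n::nat. Pi0 Y 2 (A n) \<and> topspace Y - P k = (\<Union>n. A n)" for k
      using Sigma0_SucE[OF Y, of 2 "topspace Y - P k"] Sigma0_Diff[OF P(1)[of k]] by (metis eval_nat_numeral(3) one_le_numeral)
    then have "\<forall>k. \<exists>A. \<forall>n::nat. Pi0 Y 2 (A n) \<and> topspace Y - P k = (\<Union>n. A n)" by blast
    from choice[OF this] obtain A where A: "\<forall>k. \<forall>n::nat. Pi0 Y 2 (A k n) \<and> topspace Y - P k = (\<Union>n. A k n)" ..
    have "\<exists>D. \<forall>m::nat. Pi0 Y 1 (D m) \<and> topspace Y - A k n = (\<Union>m. D m)" for k n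
      using Sigma0_SucE[OF Y, of 1 "topspace Y - A k n"] Sigma0_Diff[of Y 2 "A k n"] A
      by (metis Suc_1 order_refl)
    then have "\<forall>k. \<exists>D. \<forall>n. \<forall>m::nat. Pi0 Y 1 (D n m) \<and> topspace Y - A k n = (\<Union>m. D n m)" by metis
    from choice[OF this] obtain D where
      D: "\<forall>k. \<forall>n. \<forall>m::nat. Pi0 Y 1 (D k n m) \<and> topspace Y - A k n = (\<Union>m. D k n m)" ..
    have "y \<in> B \<longleftrightarrow> (\<exists>k. \<forall>n. \<exists>m. y \<in> D k n m)" if y: "y \<in> topspace Y" for y
    proof -
      have "y \<in> P k \<longleftrightarrow> (\<forall>n. \<exists>m. y \<in> D k n m)" for k
      proof -
        have "y \<in> P k \<longleftrightarrow> y \<notin> topspace Y - P k" using y by blast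
        also have "\<dots> \<longleftrightarrow> (\<forall>n. y \<notin> A k n)" using A by blast
        also have "\<dots> \<longleftrightarrow> (\<forall>n. y \<in> topspace Y - A k n)" using y by blast
        also have "\<dots> \<longleftrightarrow> (\<forall>n. \<exists>m. y \<in> D k n m)" using D by blast
        finally show ?thesis .
      qed
      then show ?thesis using P(2) by blast
    qed
    moreover have "closedin Y (D k n m)" for k n m using D unfolding One_nat_def Pi0_1_iff by blast
    ultimately show ?thesis by blast
  qed
  then obtain D where D: "\<And>k n m. closedin Y (D k n m)"
    "\<And>y. y \<in> topspace Y \<Longrightarrow> y \<in> B \<longleftrightarrow> (\<exists>k::nat. \<forall>n::nat. \<exists>m::nat. y \<in> D k n m)" by metis
  define E where "E k n M = (\<Inter>n'\<in>{..n}. \<Union>m\<in>{..<M}. D k n' m)" for k n M :: nat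
  have E: "closedin Y (E k n M)" for k n M
    unfolding E_def by (intro closedin_INT closedin_Union) (auto simp: D(1))
  have E_mono: "E k n M \<subseteq> E k n M'" if "M \<le> M'" for k n M M' unfolding E_def using that by fastforce
  \<comment> \<open>Differences of closed sets belong to the second level together with their
    complements. Counting only the first \<open>M\<close> leaves each pair \<open>(k, n)\<close> at
    most one event.\<close>
  define ev where "ev k n M = E k n (Suc M) - E k n M" for k n M
  define kk where "kk t = fst (prod_decode t)" for t
  define nn where "nn t = fst (prod_decode (snd (prod_decode t)))" for t
  define mm where "mm t = snd (prod_decode (snd (prod_decode t)))" for t
  define V where "V t = ev (kk t) (nn t) (mm t)" for t
  have idx: "t = prod_encode (kk t, prod_encode (nn t, mm t))" for t
    unfolding kk_def nn_def mm_def by simp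
  have E_S: "Sigma0 Y 2 (E k n M)" "Sigma0 Y 2 (topspace Y - E k n M)" for k n M
  proof -
    show "Sigma0 Y 2 (E k n M)"
      using Pi0_imp_Sigma0_Suc[of Y "Suc 0"] E unfolding Pi0_1_iff numeral_2_eq_2 by blast
    have "openin Y (topspace Y - E k n M)" using E by blast
    then show "Sigma0 Y 2 (topspace Y - E k n M)" using Sigma0_mono[OF Y Sigma0_openin, of _ 2] by simp
  qed
  have V_S: "Sigma0 Y 2 (V t)" for t
  proof -
    have "V t = E (kk t) (nn t) (Suc (mm t)) \<inter> (topspace Y - E (kk t) (nn t) (mm t))"
      unfolding V_def ev_def using closedin_subset[OF E] by blast
    then show ?thesis using Sigma0_Int[OF Y E_S] by simp
  qed
  have V_P: "Sigma0 Y 2 (topspace Y - V t)" for t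
  proof -
    have "topspace Y - V t = E (kk t) (nn t) (mm t) \<union> (topspace Y - E (kk t) (nn t) (Suc (mm t)))"
      unfolding V_def ev_def using closedin_subset[OF E] by blast
    then show ?thesis using Sigma0_Un[OF Y E_S] by simp
  qed
  define val where "val y t = (if y \<in> V t then kk t else t)" for y t
  \<comment> \<open>The label of \<open>s\<close> is \<open>kk s\<close> or \<open>s\<close>,
    depending on whether \<open>s\<close> is itself an event. Splitting by this case keeps the
    comparison of labels at the second level.\<close>
  define T where "T s = (\<Union>t. if s < t then V t \<inter> ((if kk t \<le> kk s then V s else {}) \<union>
      (if kk t \<le> s then topspace Y - V s else {})) else {})" for s
  have T_iff: "y \<in> T s \<longleftrightarrow> (\<exists>t>s. y \<in> V t \<and> kk t \<le> val y s)" if "y \<in> topspace Y" for y s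
    unfolding T_def val_def using that by (auto split: if_splits)
  have T_S: "Sigma0 Y 2 (T s)" for s
  proof -
    have e: "Sigma0 Y 2 {}" using Sigma0_mono[OF Y Sigma0_openin, of "{}" 2] by simp
    have "Sigma0 Y 2 (topspace Y)" using Sigma0_mono[OF Y Sigma0_openin, of "topspace Y" 2] by simp
    then show ?thesis
      unfolding T_def by (intro Sigma0_UN Y) (auto intro!: Sigma0_Int Sigma0_Un Y V_S V_P e)
  qed
  have "y \<in> B \<longleftrightarrow> (\<exists>g. \<forall>s\<ge>g. y \<in> T s)" if y: "y \<in> topspace Y" for y
  proof -
    define Ev where "Ev k = {t. y \<in> V t \<and> kk t = k}" for k
    \<comment> \<open>If no witness exists for \<open>n0\<close>, events require
      \<open>n < n0\<close>, and each \<open>n\<close> has at most one.\<close>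
    have fin: "finite (Ev k)" if "\<not> (\<forall>n. \<exists>m. y \<in> D k n m)" for k
    proof -
      obtain n0 where n0: "\<And>m. y \<notin> D k n0 m" using \<open>\<not> _\<close> by blast
      have "inj_on nn (Ev k)"
      proof (rule inj_onI)
        fix t t' assume t: "t \<in> Ev k" "t' \<in> Ev k" "nn t = nn t'"
        have "\<not> mm t < mm t'" "\<not> mm t' < mm t"
          using t E_mono[of "Suc (mm t)" "mm t'" k "nn t"] E_mono[of "Suc (mm t')" "mm t" k "nn t"]
          unfolding Ev_def V_def ev_def by auto
        then have "mm t = mm t'" by simp
        then show "t = t'" using idx[of t] idx[of t'] t unfolding Ev_def by simp
      qed
      moreover have "nn ` Ev k \<subseteq> {..<n0}"
      proof
        fix n assume "n \<in> nn ` Ev k"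
        then obtain M where "y \<in> E k n M" unfolding Ev_def V_def ev_def by blast
        then show "n \<in> {..<n0}" using n0 unfolding E_def by (force simp: not_less)
      qed
      ultimately show ?thesis using finite_imageD finite_subset by blast
    qed
    have inf: "infinite (Ev k)" if k: "\<forall>n. \<exists>m. y \<in> D k n m" for k
    proof
      assume "finite (Ev k)"
      have "\<exists>t. t \<in> Ev k \<and> nn t = n" for n
      proof -
        obtain m where m: "\<And>n. y \<in> D k n (m n)" using k by metis
        define M where "M = Suc (Max (m ` {..n}))"
        have "m n' < M" if "n' \<le> n" for n' unfolding M_def using that by (simp add: less_Suc_eq_le)
        then have "y \<in> E k n M" unfolding E_def using m by blast
        moreover have "y \<notin> E k n 0" unfolding E_def by simp
        then have "y \<notin> E k n M'" if "\<And>i. y \<notin> E k n i \<Longrightarrow> y \<notin> E k n (Suc i)" for M'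
          using that by (induction M') auto
        ultimately obtain M' where "y \<notin> E k n M'" "y \<in> E k n (Suc M')" by blast
        then have "prod_encode (k, prod_encode (n, M')) \<in> Ev k" "nn (prod_encode (k, prod_encode (n, M'))) = n"
          unfolding Ev_def V_def ev_def kk_def nn_def mm_def by auto
        then show ?thesis by blast
      qed
      then have "nn ` Ev k = UNIV" by (metis UNIV_eq_I imageI)
      then show False using \<open>finite (Ev k)\<close> finite_imageI infinite_UNIV_nat by metis
    qed
    show ?thesis
    proof
      assume "y \<in> B"
      then have ex: "\<exists>k. infinite (Ev k)" using D(2)[OF y] inf by blast
      \<comment> \<open>With \<open>k\<close> least, labels below \<open>k\<close> occur only
        finitely often, and every \<open>s\<close> with a label of at least \<open>k\<close> is
        followed by one of the infinitely many events labelled \<open>k\<close>.\<close>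
      define k where "k = (LEAST k. infinite (Ev k))"
      have k: "infinite (Ev k)" "\<And>j. j < k \<Longrightarrow> finite (Ev j)"
        unfolding k_def using LeastI_ex[OF ex] not_less_Least by blast+
      have "val y s < k" if "y \<notin> T s" for s
      proof -
        obtain t where "t > s" "t \<in> Ev k" using k(1) unfolding infinite_nat_iff_unbounded by blast
        then show ?thesis using \<open>y \<notin> T s\<close> T_iff[OF y, of s] unfolding Ev_def by force
      qed
      then have sub: "{s. y \<notin> T s} \<subseteq> {..<k} \<union> (\<Union>j\<in>{..<k}. Ev j)"
        unfolding val_def Ev_def by (force split: if_splits)
      have "finite {s. y \<notin> T s}" by (rule finite_subset[OF sub]) (use k(2) in auto)
      then obtain g where "\<forall>s\<in>{s. y \<notin> T s}. s < g" using finite_nat_bounded by blast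
      then show "\<exists>g. \<forall>s\<ge>g. y \<in> T s" by (metis mem_Collect_eq not_less)
    next
      assume "\<exists>g. \<forall>s\<ge>g. y \<in> T s"
      then obtain g where g: "\<And>s. s \<ge> g \<Longrightarrow> y \<in> T s" by blast
      show "y \<in> B"
      proof (rule ccontr)
        assume "y \<notin> B"
        then have fin': "finite (Ev k)" for k using D(2)[OF y] fin by blast
        \<comment> \<open>The least label from \<open>g\<close> on occurs finitely often and so has
          a last occurrence. The event that must follow it carries a label no larger, which makes it
          a later occurrence.\<close>
        define v0 where "v0 = (LEAST v. \<exists>t\<ge>g. val y t = v)"
        have v0: "\<exists>t\<ge>g. val y t = v0" unfolding v0_def by (rule LeastI_ex) blast
        have v0_le: "v0 \<le> val y t" if "t \<ge> g" for t unfolding v0_def using that by (intro Least_le) blast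
        define S where "S = {t. t \<ge> g \<and> val y t = v0}"
        have "S \<subseteq> insert v0 (Ev v0)" unfolding S_def val_def Ev_def by (auto split: if_splits)
        then have "finite S" using fin' finite_subset by blast
        moreover have "S \<noteq> {}" using v0 unfolding S_def by blast
        ultimately have s: "Max S \<in> S" "\<And>t. t \<in> S \<Longrightarrow> t \<le> Max S" by simp_all
        have "y \<in> T (Max S)" using g s(1) unfolding S_def by blast
        then obtain t where t: "t > Max S" "y \<in> V t" "kk t \<le> val y (Max S)" using T_iff[OF y] by blast
        have "val y t \<le> v0" using t s(1) unfolding S_def val_def by auto
        moreover have "t \<ge> g" using t(1) s(1) unfolding S_def by auto
        ultimately have "t \<in> S" using v0_le[of t] unfolding S_def by simp
        then show False using s(2) t(1) by force
      qed
    qed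
  qed
  then show ?thesis using T_S by (intro exI[of _ T]) blast
qed

section \<open>Solutions of ordinary differential equations\<close>

lemma has_real_derivative_glue:
  fixes f :: "real \<Rightarrow> real"
  assumes "a \<le> b" "b \<le> c"
    and "t \<in> {a..b} \<Longrightarrow> (f has_real_derivative D) (at t within {a..b})"
    and "t \<in> {b..c} \<Longrightarrow> (f has_real_derivative D) (at t within {b..c})"
  shows "(f has_real_derivative D) (at t within {a..c})"
proof -
  have un: "{a..c} = {a..b} \<union> {b..c}" using assms(1,2) by auto
  have "((\<lambda>y. (f y - f t) / (y - t)) \<longlongrightarrow> D) (at t within {a..b})"
  proof (cases "t \<in> {a..b}")
    case False
    then have "t \<notin> closure {a..b}" by simp
    then have "at t within {a..b} = bot" by (rule not_in_closure_trivial_limitI)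
    then show ?thesis by simp
  qed (use assms(3) in \<open>simp add: has_field_derivative_iff\<close>)
  moreover have "((\<lambda>y. (f y - f t) / (y - t)) \<longlongrightarrow> D) (at t within {b..c})"
  proof (cases "t \<in> {b..c}")
    case False
    then have "t \<notin> closure {b..c}" by simp
    then have "at t within {b..c} = bot" by (rule not_in_closure_trivial_limitI)
    then show ?thesis by simp
  qed (use assms(4) in \<open>simp add: has_field_derivative_iff\<close>)
  ultimately have "((\<lambda>y. (f y - f t) / (y - t)) \<longlongrightarrow> D) (at t within {a..c})"
    unfolding un at_within_union by (rule filterlim_sup)
  then show ?thesis by (simp add: has_field_derivative_iff)
qed

text \<open>Where \<open>f\<close> and \<open>g\<close> meet, each difference quotient of the
  maximum lies between the minimum and the maximum of the two quotients, and both of these tend to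
  \<open>D\<close>.\<close>

lemma has_real_derivative_max:
  fixes f g :: "real \<Rightarrow> real"
  assumes f: "(f has_real_derivative D1) (at t within S)" and g: "(g has_real_derivative D2) (at t within S)"
    and t: "t \<in> S"
    and gt: "f t > g t \<Longrightarrow> D = D1" and lt: "f t < g t \<Longrightarrow> D = D2"
    and eq: "f t = g t \<Longrightarrow> D1 = D \<and> D2 = D"
  shows "((\<lambda>s. max (f s) (g s)) has_real_derivative D) (at t within S)"
proof -
  have cont: "((\<lambda>s. f s - g s) \<longlongrightarrow> f t - g t) (at t within S)"
    using DERIV_continuous[OF f] DERIV_continuous[OF g]
    by (intro tendsto_diff) (auto simp: continuous_within)
  consider "f t > g t" | "f t < g t" | "f t = g t" by linarith
  then show ?thesis
  proof cases
    case 1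
    then have "\<forall>\<^sub>F s in at t within S. f s - g s > 0"
      using order_tendstoD(1)[OF cont, of 0] by simp
    then have ev: "\<forall>\<^sub>F s in at t within S. (f s - f t) / (s - t) = (max (f s) (g s) - max (f t) (g t)) / (s - t)"
      by eventually_elim (use 1 in \<open>simp add: max_def\<close>)
    show ?thesis
      using f gt[OF 1] tendsto_cong[OF ev] unfolding has_field_derivative_iff by simp
  next
    case 2
    then have "\<forall>\<^sub>F s in at t within S. f s - g s < 0"
      using order_tendstoD(2)[OF cont, of 0] by simp
    then have ev: "\<forall>\<^sub>F s in at t within S. (g s - g t) / (s - t) = (max (f s) (g s) - max (f t) (g t)) / (s - t)"
      by eventually_elim (use 2 in \<open>simp add: max_def\<close>)
    show ?thesis
      using g lt[OF 2] tendsto_cong[OF ev] unfolding has_field_derivative_iff by simp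
  next
    case 3
    let ?p = "\<lambda>s. (f s - f t) / (s - t)" and ?q = "\<lambda>s. (g s - g t) / (s - t)"
    have p: "(?p \<longlongrightarrow> D) (at t within S)" and q: "(?q \<longlongrightarrow> D) (at t within S)"
      using f g eq[OF 3] unfolding has_field_derivative_iff by auto
    have lo: "((\<lambda>s. min (?p s) (?q s)) \<longlongrightarrow> D) (at t within S)"
      using tendsto_min[OF p q] by simp
    have hi: "((\<lambda>s. max (?p s) (?q s)) \<longlongrightarrow> D) (at t within S)"
      using tendsto_max[OF p q] by simp
    have "((\<lambda>s. (max (f s) (g s) - max (f t) (g t)) / (s - t)) \<longlongrightarrow> D) (at t within S)"
      by (rule tendsto_sandwich[OF _ _ lo hi]; rule always_eventually)
        (use 3 in \<open>auto simp: max_def min_def\<close>)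
    then show ?thesis unfolding has_field_derivative_iff .
  qed
qed

lemma has_real_derivative_min:
  fixes f g :: "real \<Rightarrow> real"
  assumes f: "(f has_real_derivative D1) (at t within S)" and g: "(g has_real_derivative D2) (at t within S)"
    and t: "t \<in> S"
    and gt: "f t > g t \<Longrightarrow> D = D2" and lt: "f t < g t \<Longrightarrow> D = D1"
    and eq: "f t = g t \<Longrightarrow> D1 = D \<and> D2 = D"
  shows "((\<lambda>s. min (f s) (g s)) has_real_derivative D) (at t within S)"
proof -
  have "((\<lambda>s. max (- f s) (- g s)) has_real_derivative - D) (at t within S)"
    by (rule has_real_derivative_max[OF DERIV_minus[OF f] DERIV_minus[OF g] t])
      (metis gt lt eq neg_less_iff_less neg_equal_iff_equal)+
  then have "((\<lambda>s. - max (- f s) (- g s)) has_real_derivative - (- D)) (at t within S)"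
    by (rule DERIV_minus)
  then show ?thesis by (simp add: minus_max_eq_min)
qed

section \<open>Solutions on an interval, pasting and symmetries\<close>

definition sol :: "(real \<times> real \<Rightarrow> real) \<Rightarrow> real \<Rightarrow> real \<Rightarrow> (real \<Rightarrow> real) \<Rightarrow> bool" where
  "sol F a b \<phi> \<longleftrightarrow> (\<forall>t\<in>{a..b}. (\<phi> has_real_derivative F (t, \<phi> t)) (at t within {a..b}))"

lemma sol_continuous: "sol F a b \<phi> \<Longrightarrow> continuous_on {a..b} \<phi>"
  unfolding sol_def by (rule DERIV_continuous_on) auto

lemma sol_subset:
  assumes "sol F a b \<phi>" "a \<le> c" "d \<le> b" shows "sol F c d \<phi>"
  unfolding sol_def
proof
  fix t assume "t \<in> {c..d}"
  then have "(\<phi> has_real_derivative F (t, \<phi> t)) (at t within {a..b})"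
    using assms unfolding sol_def by auto
  then show "(\<phi> has_real_derivative F (t, \<phi> t)) (at t within {c..d})"
    by (rule DERIV_subset) (use assms in auto)
qed

lemma sol_cong:
  assumes "\<And>t. t \<in> {a..b} \<Longrightarrow> \<phi> t = \<psi> t" shows "sol F a b \<phi> \<longleftrightarrow> sol F a b \<psi>"
proof -
  have "sol F a b \<psi>" if "sol F a b \<phi>" "\<And>t. t \<in> {a..b} \<Longrightarrow> \<phi> t = \<psi> t" for \<phi> \<psi>
    unfolding sol_def
  proof
    fix t assume t: "t \<in> {a..b}"
    then have "(\<phi> has_real_derivative F (t, \<psi> t)) (at t within {a..b})"
      using that(1) that(2)[OF t, symmetric] t unfolding sol_def by auto
    then show "(\<psi> has_real_derivative F (t, \<psi> t)) (at t within {a..b})"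
      by (rule has_field_derivative_transform_within[OF _ zero_less_one t]) (use that(2) in auto)
  qed
  from this[of \<phi> \<psi>] this[of \<psi> \<phi>] show ?thesis using assms by auto
qed

text \<open>A point has no punctured neighbourhood within a one-point interval, so any function is a
  solution there; the pasting in \<open>global_from_chain\<close> starts from this.\<close>

lemma sol_trivial: "b \<le> a \<Longrightarrow> sol F a b \<phi>"
proof (cases "b < a")
  case False
  assume "b \<le> a"
  then have "b = a" using False by simp
  moreover have "at a within {a} = bot" by (simp add: at_within_def)
  ultimately show ?thesis unfolding sol_def by (simp add: has_field_derivative_iff)
qed (simp add: sol_def)

lemma sol_join:
  assumes "sol F a b \<phi>" "sol F b c \<phi>" "a \<le> b" "b \<le> c"
  shows "sol F a c \<phi>"
  unfolding sol_def using assms(1,2) 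
  by (intro ballI has_real_derivative_glue[OF assms(3,4)]) (auto simp: sol_def)

lemma sol_glue:
  assumes "sol F a b \<phi>" "sol F b c \<psi>" "a \<le> b" "b \<le> c" "\<phi> b = \<psi> b"
  shows "sol F a c (\<lambda>t. if t \<le> b then \<phi> t else \<psi> t)"
proof (rule sol_join)
  show "sol F a b (\<lambda>t. if t \<le> b then \<phi> t else \<psi> t)"
    using assms(1) by (subst sol_cong[of _ _ _ \<phi>]) auto
  show "sol F b c (\<lambda>t. if t \<le> b then \<phi> t else \<psi> t)"
    using assms(2,5) by (subst sol_cong[of _ _ _ \<psi>]) auto
qed (use assms in auto)

text \<open>Where the two solutions meet, both have the slope that \<open>F\<close> prescribes at
  the common point.\<close>

lemma sol_max:
  assumes "sol F a b \<phi>" "sol F a b \<psi>" shows "sol F a b (\<lambda>t. max (\<phi> t) (\<psi> t))"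
  unfolding sol_def
proof
  fix t assume t: "t \<in> {a..b}"
  show "((\<lambda>t. max (\<phi> t) (\<psi> t)) has_real_derivative F (t, max (\<phi> t) (\<psi> t))) (at t within {a..b})"
    by (rule has_real_derivative_max[of _ "F (t, \<phi> t)" _ _ _ "F (t, \<psi> t)"])
      (use assms t in \<open>auto simp: sol_def\<close>)
qed

lemma sol_reflect:
  assumes "sol F a b \<phi>" shows "sol (\<lambda>(t, y). - F (- t, y)) (- b) (- a) (\<lambda>t. \<phi> (- t))"
  unfolding sol_def
proof
  fix t assume t: "t \<in> {- b..- a}"
  have im: "uminus ` {- b..- a} = {a..b}" by simp
  have "(\<phi> has_real_derivative F (- t, \<phi> (- t))) (at (- t) within uminus ` {- b..- a})"
    unfolding im using assms t unfolding sol_def by auto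
  then have "((\<phi> \<circ> uminus) has_real_derivative F (- t, \<phi> (- t)) * (- 1)) (at t within {- b..- a})"
    by (rule DERIV_image_chain) (auto intro!: derivative_eq_intros)
  then show "((\<lambda>t. \<phi> (- t)) has_real_derivative (case (t, \<phi> (- t)) of (t, y) \<Rightarrow> - F (- t, y))) (at t within {- b..- a})"
    by (simp add: o_def)
qed

text \<open>Reflecting the values exchanges upward and downward explosions, so that the arguments
  need to be given for one direction only.\<close>

definition flip :: "(real \<times> real \<Rightarrow> real) \<Rightarrow> real \<times> real \<Rightarrow> real" where
  "flip F = (\<lambda>(t, y). - F (t, - y))"

lemma flip_flip [simp]: "flip (flip F) = F"
  unfolding flip_def by (simp add: fun_eq_iff)

lemma continuous_flip:
  assumes "continuous_on UNIV F" shows "continuous_on UNIV (flip F)"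
  unfolding flip_def case_prod_beta by (intro continuous_intros continuous_on_compose2[OF assms]; simp)

lemma sol_flip: "sol F a b \<phi> \<Longrightarrow> sol (flip F) a b (\<lambda>t. - \<phi> t)"
  unfolding sol_def flip_def by (auto intro!: DERIV_minus)

lemma continuous_on_graph:
  fixes F :: "real \<times> real \<Rightarrow> real"
  assumes "continuous_on UNIV F" "continuous_on S \<phi>"
  shows "continuous_on S (\<lambda>t. F (t, \<phi> t))"
  by (rule continuous_on_compose2[OF assms(1)]) (auto intro!: continuous_intros assms)

lemma sol_integral:
  assumes F: "continuous_on UNIV F" and "sol F a b \<phi>" "t \<in> {a..b}"
  shows "\<phi> t = \<phi> a + integral {a..t} (\<lambda>s. F (s, \<phi> s))"
proof -
  have "((\<lambda>s. F (s, \<phi> s)) has_integral (\<phi> t - \<phi> a)) {a..t}"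
  proof (rule fundamental_theorem_of_calculus)
    fix s assume "s \<in> {a..t}"
    moreover have "sol F a t \<phi>" using assms by (auto elim: sol_subset)
    ultimately show "(\<phi> has_vector_derivative F (s, \<phi> s)) (at s within {a..t})"
      unfolding sol_def has_real_derivative_iff_has_vector_derivative by blast
  qed (use assms in auto)
  then show ?thesis by (simp add: integral_unique)
qed

lemma sol_of_integral:
  assumes F: "continuous_on UNIV F" and c: "continuous_on {a..b} \<phi>"
    and eq: "\<And>t. t \<in> {a..b} \<Longrightarrow> \<phi> t = v + integral {a..t} (\<lambda>s. F (s, \<phi> s))"
  shows "sol F a b \<phi>"
  unfolding sol_def
proof
  fix t assume t: "t \<in> {a..b}"
  have "((\<lambda>u. v + integral {a..u} (\<lambda>s. F (s, \<phi> s))) has_real_derivative 0 + F (t, \<phi> t)) (at t within {a..b})"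
    by (intro DERIV_add DERIV_const integral_has_real_derivative t continuous_on_graph F c)
  then have "((\<lambda>u. v + integral {a..u} (\<lambda>s. F (s, \<phi> s))) has_real_derivative F (t, \<phi> t)) (at t within {a..b})"
    by simp
  then show "(\<phi> has_real_derivative F (t, \<phi> t)) (at t within {a..b})"
    by (rule has_field_derivative_transform_within[OF _ zero_less_one t]) (use eq in auto)
qed

lemma sol_lipschitz:
  assumes "sol F a b \<phi>" "\<And>t. t \<in> {a..b} \<Longrightarrow> \<bar>F (t, \<phi> t)\<bar> \<le> B" "s \<in> {a..b}" "t \<in> {a..b}"
  shows "\<bar>\<phi> s - \<phi> t\<bar> \<le> B * \<bar>s - t\<bar>"
  using field_differentiable_bound[of "{a..b}" \<phi> "\<lambda>t. F (t, \<phi> t)" B s t] assms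
  unfolding sol_def by auto

lemma integral_lipschitz:
  fixes g :: "real \<Rightarrow> real"
  assumes c: "continuous_on {a..b} g" and B: "\<And>t. t \<in> {a..b} \<Longrightarrow> \<bar>g t\<bar> \<le> B"
    and s: "s \<in> {a..b}" and t: "t \<in> {a..b}"
  shows "\<bar>integral {a..s} g - integral {a..t} g\<bar> \<le> B * \<bar>s - t\<bar>"
  using field_differentiable_bound[of "{a..b}" "\<lambda>u. integral {a..u} g" g B s t]
    integral_has_real_derivative[OF c] B s t by auto

lemma compact_box_bound:
  fixes F :: "real \<times> real \<Rightarrow> real"
  assumes "continuous_on UNIV F"
  obtains B where "B \<ge> 0" "\<And>t y. t \<in> {a..b} \<Longrightarrow> \<bar>y\<bar> \<le> K \<Longrightarrow> \<bar>F (t, y)\<bar> \<le> B"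
proof -
  have "compact (F ` ({a..b} \<times> {-K..K}))"
    by (intro compact_continuous_image continuous_on_subset[OF assms] compact_Times) auto
  then obtain B where B: "\<forall>x\<in>F ` ({a..b} \<times> {-K..K}). norm x \<le> B"
    using compact_imp_bounded bounded_iff by blast
  show ?thesis
  proof (rule that[of "max B 0"])
    fix t y assume "t \<in> {a..b}" "\<bar>y\<bar> \<le> K"
    then have "F (t, y) \<in> F ` ({a..b} \<times> {-K..K})" by (intro imageI) auto
    from bspec[OF B this] show "\<bar>F (t, y)\<bar> \<le> max B 0" by simp
  qed simp
qed

lemma interval_bound:
  fixes f :: "real \<Rightarrow> real"
  assumes "continuous_on {a..b} f"
  obtains M where "M \<ge> 0" "\<And>t. t \<in> {a..b} \<Longrightarrow> \<bar>f t\<bar> \<le> M"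
proof -
  obtain M where M: "\<forall>x\<in>f ` {a..b}. norm x \<le> M"
    using compact_imp_bounded[OF compact_continuous_image[OF assms compact_Icc]] bounded_iff by blast
  show ?thesis
  proof (rule that[of "max M 0"])
    fix t assume "t \<in> {a..b}"
    then have "norm (f t) \<le> M" using M by blast
    then show "\<bar>f t\<bar> \<le> max M 0" by simp
  qed simp
qed

text \<open>Locally uniform convergence, that is, convergence in \<^const>\<open>C_plane\<close>.\<close>

definition locally_uniform :: "(nat \<Rightarrow> real \<times> real \<Rightarrow> real) \<Rightarrow> (real \<times> real \<Rightarrow> real) \<Rightarrow> bool" where
  "locally_uniform Fs F \<longleftrightarrow> (\<forall>K e. compact K \<longrightarrow> e > 0 \<longrightarrow> (\<forall>\<^sub>F n in sequentially. \<forall>p\<in>K. \<bar>Fs n p - F p\<bar> < e))"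

lemma locally_uniform_const: "locally_uniform (\<lambda>_. F) F"
  unfolding locally_uniform_def by simp

lemma locally_uniform_subseq:
  assumes "locally_uniform Fs F" "strict_mono r" shows "locally_uniform (\<lambda>n. Fs (r n)) F"
  unfolding locally_uniform_def
proof (intro allI impI)
  fix K :: "(real \<times> real) set" and e :: real assume "compact K" "e > 0"
  then have "\<forall>\<^sub>F n in sequentially. \<forall>p\<in>K. \<bar>Fs n p - F p\<bar> < e" using assms(1) unfolding locally_uniform_def by blast
  from eventually_subseq[OF assms(2) this] show "\<forall>\<^sub>F n in sequentially. \<forall>p\<in>K. \<bar>Fs (r n) p - F p\<bar> < e" .
qed

section \<open>Compactness of bounded sets of solutions\<close>

lemma uniform_subseq:
  fixes \<phi> :: "nat \<Rightarrow> real \<Rightarrow> real"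
  assumes lip: "\<And>i s t. s \<in> {a..b} \<Longrightarrow> t \<in> {a..b} \<Longrightarrow> \<bar>\<phi> i s - \<phi> i t\<bar> \<le> B * \<bar>s - t\<bar>"
    and bd: "\<And>i t. t \<in> {a..b} \<Longrightarrow> \<bar>\<phi> i t\<bar> \<le> K"
  obtains r \<psi> where "strict_mono (r :: nat \<Rightarrow> nat)" "continuous_on {a..b} \<psi>"
    "uniform_limit {a..b} (\<lambda>i. \<phi> (r i)) \<psi> sequentially"
proof -
  obtain \<psi> r where r: "continuous_on {a..b} \<psi>" "strict_mono (r :: nat \<Rightarrow> nat)"
    "\<And>e. 0 < e \<Longrightarrow> \<exists>N. \<forall>n x. n \<ge> N \<and> x \<in> {a..b} \<longrightarrow> norm(\<phi>(r n) x - \<psi> x) < e"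
  proof (rule Arzela_Ascoli[of "{a..b}" \<phi> K])
    fix x e :: real assume x: "x \<in> {a..b}" and e: "e > 0"
    define d where "d = e / (\<bar>B\<bar> + 1)"
    have d: "d > 0" "(\<bar>B\<bar> + 1) * d = e" using e by (auto simp: d_def add_nonneg_pos)
    have "norm (\<phi> n x - \<phi> n y) < e" if "y \<in> {a..b}" "norm (x - y) < d" for n y
    proof -
      have "\<bar>\<phi> n x - \<phi> n y\<bar> \<le> B * \<bar>x - y\<bar>" using lip x that by blast
      also have "\<dots> \<le> (\<bar>B\<bar> + 1) * \<bar>x - y\<bar>" by (intro mult_right_mono) auto
      also have "\<dots> < (\<bar>B\<bar> + 1) * d" using that by (intro mult_strict_left_mono) auto
      finally show ?thesis using d by simp
    qed
    then show "\<exists>d>0. \<forall>n y. y \<in> {a..b} \<and> norm (x - y) < d \<longrightarrow> norm (\<phi> n x - \<phi> n y) < e"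
      using d(1) by blast
  qed (use bd in auto)
  have "uniform_limit {a..b} (\<lambda>i. \<phi> (r i)) \<psi> sequentially"
  proof (rule uniform_limitI)
    fix e :: real assume "e > 0"
    then obtain N where "\<forall>n x. n \<ge> N \<and> x \<in> {a..b} \<longrightarrow> norm(\<phi>(r n) x - \<psi> x) < e" using r(3) by blast
    then show "\<forall>\<^sub>F n in sequentially. \<forall>x\<in>{a..b}. dist (\<phi> (r n) x) (\<psi> x) < e"
      unfolding eventually_sequentially dist_norm by blast
  qed
  with r that show ?thesis by blast
qed

lemma integral_tendsto:
  fixes a :: real
  assumes F: "continuous_on UNIV F" and Fs: "\<And>i. continuous_on UNIV (Fs i)" "locally_uniform Fs F"
    and u: "uniform_limit {a..b} \<phi> \<psi> sequentially"
    and c: "\<And>i. continuous_on {a..b} (\<phi> i)" "continuous_on {a..b} \<psi>"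
    and t: "t \<in> {a..b}"
  shows "(\<lambda>i. integral {a..t} (\<lambda>s. Fs i (s, \<phi> i s))) \<longlonglongrightarrow> integral {a..t} (\<lambda>s. F (s, \<psi> s))"
proof -
  obtain M where M: "\<And>s. s \<in> {a..b} \<Longrightarrow> \<bar>\<psi> s\<bar> \<le> M"
    using interval_bound[OF c(2)] by metis
  \<comment> \<open>The margin 1 keeps the graphs of all late \<open>\<phi> i\<close> inside a
    compact strip, on which \<open>F\<close> is uniformly continuous.\<close>
  define K where "K = {a..b} \<times> {- (M + 1)..M + 1}"
  have K: "compact K" unfolding K_def by (intro compact_Times) auto
  have uni: "uniform_limit {a..b} (\<lambda>i s. Fs i (s, \<phi> i s)) (\<lambda>s. F (s, \<psi> s)) sequentially"
  proof (rule uniform_limitI)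
    fix e :: real assume e: "e > 0"
    have "uniformly_continuous_on K F"
      by (intro compact_uniformly_continuous continuous_on_subset[OF F] K) auto
    then obtain d where d: "d > 0" "\<And>p q. p \<in> K \<Longrightarrow> q \<in> K \<Longrightarrow> dist q p < d \<Longrightarrow> dist (F q) (F p) < e / 2"
      unfolding uniformly_continuous_on_def using e by (meson half_gt_zero)
    have "\<forall>\<^sub>F i in sequentially. \<forall>s\<in>{a..b}. dist (\<phi> i s) (\<psi> s) < min d 1"
      by (rule uniform_limitD[OF u]) (use d(1) in simp)
    moreover have "\<forall>\<^sub>F i in sequentially. \<forall>p\<in>K. \<bar>Fs i p - F p\<bar> < e / 2"
      using Fs(2) K e unfolding locally_uniform_def by (meson half_gt_zero)
    ultimately show "\<forall>\<^sub>F i in sequentially. \<forall>s\<in>{a..b}. dist (Fs i (s, \<phi> i s)) (F (s, \<psi> s)) < e"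
    proof eventually_elim
      case (elim i)
      show ?case
      proof
        fix s assume s: "s \<in> {a..b}"
        have "\<bar>\<phi> i s - \<psi> s\<bar> < min d 1" using elim(1) s by (simp add: dist_real_def)
        then have in_K: "(s, \<psi> s) \<in> K" "(s, \<phi> i s) \<in> K"
          and "dist (s, \<phi> i s) (s, \<psi> s) < d"
          using M[OF s] s unfolding K_def by (auto simp: dist_Pair_Pair dist_real_def)
        then have "\<bar>F (s, \<phi> i s) - F (s, \<psi> s)\<bar> < e / 2" using d(2) by (simp add: dist_real_def)
        moreover have "\<bar>Fs i (s, \<phi> i s) - F (s, \<phi> i s)\<bar> < e / 2" using elim(2) in_K by blast
        ultimately show "dist (Fs i (s, \<phi> i s)) (F (s, \<psi> s)) < e" unfolding dist_real_def by linarith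
      qed
    qed
  qed
  have sub: "{a..t} \<subseteq> {a..b}" using t by auto
  obtain I J where I: "\<And>i. ((\<lambda>s. Fs i (s, \<phi> i s)) has_integral I i) (cbox a t)"
    "((\<lambda>s. F (s, \<psi> s)) has_integral J) (cbox a t)" "I \<longlonglongrightarrow> J"
  proof (rule uniform_limit_integral_cbox[where a = a and b = t and f = "\<lambda>i s. Fs i (s, \<phi> i s)"
        and g = "\<lambda>s. F (s, \<psi> s)" and F = sequentially])
    show "uniform_limit (cbox a t) (\<lambda>i s. Fs i (s, \<phi> i s)) (\<lambda>s. F (s, \<psi> s)) sequentially"
      using uniform_limit_on_subset[OF uni sub] by simp
    show "continuous_on (cbox a t) (\<lambda>s. Fs i (s, \<phi> i s))" for i
      using continuous_on_subset[OF continuous_on_graph[OF Fs(1) c(1)] sub] by simp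
  qed auto
  have "integral {a..t} (\<lambda>s. Fs i (s, \<phi> i s)) = I i" for i using integral_unique[OF I(1)[of i]] by simp
  moreover have "integral {a..t} (\<lambda>s. F (s, \<psi> s)) = J" using integral_unique[OF I(2)] by simp
  ultimately show ?thesis using I(3) by simp
qed

text \<open>The end times \<open>s i\<close> differ. Continuing each solution as a constant after
  its end puts all of them on one interval, where the theorem of Arzela and Ascoli applies. The
  convergence of the end values makes the result applicable to hitting times.\<close>

lemma sol_limit:
  assumes F: "continuous_on UNIV F" and Fs: "\<And>i. continuous_on UNIV (Fs i)" "locally_uniform Fs F"
    and s: "\<And>i. a \<le> s i" "\<And>i. s i \<le> b"
    and sol: "\<And>i. sol (Fs i) a (s i) (\<phi> i)"
    and K: "\<And>i t. t \<in> {a..s i} \<Longrightarrow> \<bar>\<phi> i t\<bar> \<le> K"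
  obtains r \<sigma> \<psi> where "strict_mono (r :: nat \<Rightarrow> nat)" "a \<le> \<sigma>" "\<sigma> \<le> b" "(\<lambda>i. s (r i)) \<longlonglongrightarrow> \<sigma>"
    "sol F a \<sigma> \<psi>" "\<And>t. t \<in> {a..\<sigma>} \<Longrightarrow> (\<lambda>i. \<phi> (r i) (min t (s (r i)))) \<longlonglongrightarrow> \<psi> t"
    "(\<lambda>i. \<phi> (r i) (s (r i))) \<longlonglongrightarrow> \<psi> \<sigma>"
proof -
  have ab: "a \<le> b" using s[of 0] by simp
  obtain B0 where B0: "B0 \<ge> 0" "\<And>t y. t \<in> {a..b} \<Longrightarrow> \<bar>y\<bar> \<le> K \<Longrightarrow> \<bar>F (t, y)\<bar> \<le> B0"
    using compact_box_bound[OF F] by blast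
  \<comment> \<open>From some index \<open>N\<close> on the fields differ from \<open>F\<close> by
    less than 1 on the box, so \<open>B\<close> is a common Lipschitz constant once the first
    \<open>N\<close> members are dropped.\<close>
  define B where "B = B0 + 1"
  have "compact ({a..b} \<times> {-K..K})" by (intro compact_Times) auto
  then have "\<forall>\<^sub>F n in sequentially. \<forall>p\<in>{a..b} \<times> {-K..K}. \<bar>Fs n p - F p\<bar> < 1"
    by (rule Fs(2)[unfolded locally_uniform_def, rule_format]) simp
  then obtain N where N: "\<And>n p. n \<ge> N \<Longrightarrow> p \<in> {a..b} \<times> {-K..K} \<Longrightarrow> \<bar>Fs n p - F p\<bar> < 1"
    unfolding eventually_sequentially by blast
  have B: "\<bar>Fs n (t, y)\<bar> \<le> B" if "n \<ge> N" "t \<in> {a..b}" "\<bar>y\<bar> \<le> K" for n t y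
  proof -
    have "(t, y) \<in> {a..b} \<times> {-K..K}" using that by auto
    from N[OF that(1) this] show ?thesis using B0(2)[OF that(2,3)] unfolding B_def by linarith
  qed
  have "\<forall>i. s (i + N) \<in> {a..b}" using s by auto
  then obtain \<sigma> r1 where r1: "\<sigma> \<in> {a..b}" "strict_mono (r1 :: nat \<Rightarrow> nat)" "(\<lambda>i. s (r1 i + N)) \<longlonglongrightarrow> \<sigma>"
    using seq_compactE[OF compact_imp_seq_compact[OF compact_Icc], of "\<lambda>i. s (i + N)" a b]
    unfolding o_def by metis
  define \<Phi> where "\<Phi> i t = \<phi> (r1 i + N) (min t (s (r1 i + N)))" for i t
  have lip: "\<bar>\<Phi> i u - \<Phi> i t\<bar> \<le> B * \<bar>u - t\<bar>" if "u \<in> {a..b}" "t \<in> {a..b}" for i u t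
  proof -
    let ?n = "r1 i + N"
    have "\<bar>\<phi> ?n (min u (s ?n)) - \<phi> ?n (min t (s ?n))\<bar> \<le> B * \<bar>min u (s ?n) - min t (s ?n)\<bar>"
    proof (rule sol_lipschitz[OF sol])
      fix x assume x: "x \<in> {a..s ?n}"
      show "\<bar>Fs ?n (x, \<phi> ?n x)\<bar> \<le> B"
        by (rule B) (use x s(2)[of ?n] K[OF x] in auto)
    qed (use that s[of ?n] in auto)
    also have "\<dots> \<le> B * \<bar>u - t\<bar>" using B0(1) unfolding B_def by (intro mult_left_mono) auto
    finally show ?thesis unfolding \<Phi>_def .
  qed
  have bd: "\<bar>\<Phi> i t\<bar> \<le> K" if "t \<in> {a..b}" for i t
    unfolding \<Phi>_def using that s by (intro K) auto
  obtain r2 \<psi> where r2: "strict_mono (r2 :: nat \<Rightarrow> nat)" "continuous_on {a..b} \<psi>"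
    "uniform_limit {a..b} (\<lambda>i. \<Phi> (r2 i)) \<psi> sequentially"
    by (rule uniform_subseq[of a b \<Phi> B K, OF lip bd])
  define r where "r i = r1 (r2 i) + N" for i
  have r: "strict_mono r" using r1(2) r2(1) unfolding r_def strict_mono_def by simp
  have slim: "(\<lambda>i. s (r i)) \<longlonglongrightarrow> \<sigma>"
    using LIMSEQ_subseq_LIMSEQ[OF r1(3) r2(1)] unfolding r_def o_def .
  have lim: "(\<lambda>i. \<Phi> (r2 i) t) \<longlonglongrightarrow> \<psi> t" if "t \<in> {a..b}" for t
    using tendsto_uniform_limitI[OF r2(3) that] .
  have Phi_c: "continuous_on {a..b} (\<Phi> i)" for i
  proof (rule continuous_onI)
    fix x e :: real assume x: "x \<in> {a..b}" and "e > 0"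
    have "dist (\<Phi> i y) (\<Phi> i x) \<le> e" if "y \<in> {a..b}" "dist y x < e / B" for y
    proof -
      have "dist (\<Phi> i y) (\<Phi> i x) \<le> B * dist y x" using lip[OF that(1) x] by (simp add: dist_real_def)
      also have "\<dots> \<le> B * (e / B)" using that B0(1) unfolding B_def by (intro mult_left_mono) auto
      also have "\<dots> = e" using B0(1) unfolding B_def by simp
      finally show ?thesis .
    qed
    moreover have "e / B > 0" using \<open>e > 0\<close> B0(1) unfolding B_def by simp
    ultimately show "\<exists>d>0. \<forall>x'\<in>{a..b}. dist x' x < d \<longrightarrow> dist (\<Phi> i x') (\<Phi> i x) \<le> e" by blast
  qed
  have eq1: "\<psi> t = \<psi> a + integral {a..t} (\<lambda>x. F (x, \<psi> x))" if t: "t \<in> {a..<\<sigma>}" for t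
  proof -
    have tb: "t \<in> {a..b}" using t r1(1) by auto
    have "\<forall>\<^sub>F i in sequentially. t < s (r i)" using order_tendstoD(1)[OF slim] t by simp
    then have "\<forall>\<^sub>F i in sequentially. \<Phi> (r2 i) a + integral {a..t} (\<lambda>x. Fs (r i) (x, \<Phi> (r2 i) x)) = \<Phi> (r2 i) t"
    proof eventually_elim
      case (elim i)
      have ph: "\<Phi> (r2 i) x = \<phi> (r i) x" if "x \<in> {a..t}" for x
        using that elim unfolding \<Phi>_def r_def by auto
      have "\<phi> (r i) t = \<phi> (r i) a + integral {a..t} (\<lambda>x. Fs (r i) (x, \<phi> (r i) x))"
        by (rule sol_integral[OF Fs(1) sol]) (use t elim in auto)
      moreover have "integral {a..t} (\<lambda>x. Fs (r i) (x, \<Phi> (r2 i) x)) = integral {a..t} (\<lambda>x. Fs (r i) (x, \<phi> (r i) x))"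
        by (rule integral_cong) (simp add: ph)
      ultimately show ?case using ph[of t] ph[of a] t by simp
    qed
    moreover have "(\<lambda>i. \<Phi> (r2 i) a + integral {a..t} (\<lambda>x. Fs (r i) (x, \<Phi> (r2 i) x)))
        \<longlonglongrightarrow> \<psi> a + integral {a..t} (\<lambda>x. F (x, \<psi> x))"
      using integral_tendsto[OF F Fs(1) locally_uniform_subseq[OF Fs(2) r] r2(3) Phi_c r2(2) tb] lim[of a] ab
      by (intro tendsto_add) auto
    ultimately have "(\<lambda>i. \<Phi> (r2 i) t) \<longlonglongrightarrow> \<psi> a + integral {a..t} (\<lambda>x. F (x, \<psi> x))"
      using Lim_transform_eventually by fast
    then show ?thesis using lim[OF tb] LIMSEQ_unique by blast
  qed
  have psic: "continuous_on {a..\<sigma>} \<psi>" using r2(2) r1(1) by (auto elim: continuous_on_subset)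
  have eq2: "\<psi> t - integral {a..t} (\<lambda>x. F (x, \<psi> x)) = \<psi> a" if t: "t \<in> {a..\<sigma>}" for t
  proof (cases "a < \<sigma>")
    case True
    have cl: "closure {a..<\<sigma>} = {a..\<sigma>}" using True by simp
    show ?thesis
    proof (rule continuous_constant_on_closure[where S = "{a..<\<sigma>}"
          and f = "\<lambda>t. \<psi> t - integral {a..t} (\<lambda>x. F (x, \<psi> x))" and x = t])
      show "continuous_on (closure {a..<\<sigma>}) (\<lambda>t. \<psi> t - integral {a..t} (\<lambda>x. F (x, \<psi> x)))"
        unfolding cl using psic
        by (intro continuous_on_diff indefinite_integral_continuous_1 integrable_continuous_real continuous_on_graph F)
      show "\<psi> x - integral {a..x} (\<lambda>x. F (x, \<psi> x)) = \<psi> a" if "x \<in> {a..<\<sigma>}" for x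
        using eq1[OF that] by linarith
      show "t \<in> closure {a..<\<sigma>}" using cl t by simp
    qed
  next
    case False
    then have "t = a" using t by auto
    then show ?thesis by simp
  qed
  have solF: "sol F a \<sigma> \<psi>"
  proof (rule sol_of_integral[OF F psic])
    show "\<psi> t = \<psi> a + integral {a..t} (\<lambda>x. F (x, \<psi> x))" if "t \<in> {a..\<sigma>}" for t
      using eq2[OF that] by linarith
  qed
  \<comment> \<open>The end times move, so the common Lipschitz constant has to compare the value at
    \<open>s (r i)\<close> with the value at \<open>\<sigma>\<close>.\<close>
  have last: "(\<lambda>i. \<phi> (r i) (s (r i))) \<longlonglongrightarrow> \<psi> \<sigma>"
  proof -
    have "(\<lambda>i. \<Phi> (r2 i) (s (r i)) - \<Phi> (r2 i) \<sigma>) \<longlonglongrightarrow> 0"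
    proof (rule Lim_null_comparison)
      show "\<forall>\<^sub>F i in sequentially. norm (\<Phi> (r2 i) (s (r i)) - \<Phi> (r2 i) \<sigma>) \<le> B * \<bar>s (r i) - \<sigma>\<bar>"
        using lip s r1(1) by (intro always_eventually) auto
      show "(\<lambda>i. B * \<bar>s (r i) - \<sigma>\<bar>) \<longlonglongrightarrow> 0"
        using slim by (intro tendsto_mult_right_zero tendsto_rabs_zero) (simp add: LIM_zero)
    qed
    then have "(\<lambda>i. \<Phi> (r2 i) (s (r i)) - \<Phi> (r2 i) \<sigma> + \<Phi> (r2 i) \<sigma>) \<longlonglongrightarrow> 0 + \<psi> \<sigma>"
      using lim r1(1) by (intro tendsto_add) auto
    then show ?thesis unfolding \<Phi>_def r_def by simp
  qed
  have lim': "(\<lambda>i. \<phi> (r i) (min t (s (r i)))) \<longlonglongrightarrow> \<psi> t" if "t \<in> {a..\<sigma>}" for t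
    using lim[of t] that r1(1) unfolding \<Phi>_def r_def by auto
  have "a \<le> \<sigma>" "\<sigma> \<le> b" using r1(1) by auto
  from that[OF r this slim solF lim' last] show ?thesis .
qed

text \<open>Peano's theorem by Tonelli's method: the equation in which the integral up to \<open>t\<close> is cut off at
  \<open>t - h\<close> is solved exactly by finitely many iterations, and a limit for \<open>h\<close> tending to \<open>0\<close> exists
  by the Arzela-Ascoli theorem.\<close>

lemma peano_bounded:
  assumes F: "continuous_on UNIV F" and B: "\<And>p. \<bar>F p\<bar> \<le> B" and ab: "a \<le> b"
  obtains \<phi> where "sol F a b \<phi>" "\<phi> a = v"
proof -
  have B0: "B \<ge> 0" using B[of 0] by linarith
  define T where "T h \<phi> t = v + integral {a..max a (t - h)} (\<lambda>s. F (s, \<phi> s))" for h \<phi> t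
  have T_lip: "\<bar>T h \<phi> s - T h \<phi> t\<bar> \<le> B * \<bar>s - t\<bar>" if "continuous_on UNIV \<phi>" for h \<phi> s t
  proof -
    let ?m = "max a (max (s - h) (t - h))"
    have "\<bar>integral {a..max a (s - h)} (\<lambda>s. F (s, \<phi> s)) - integral {a..max a (t - h)} (\<lambda>s. F (s, \<phi> s))\<bar>
      \<le> B * \<bar>max a (s - h) - max a (t - h)\<bar>"
      by (rule integral_lipschitz[of a ?m])
        (auto intro!: continuous_on_graph F continuous_on_subset[OF that] B)
    also have "\<dots> \<le> B * \<bar>s - t\<bar>" using B0 by (intro mult_left_mono) auto
    finally show ?thesis unfolding T_def by simp
  qed
  have lip_cont: "continuous_on UNIV \<phi>" if "\<And>s t. \<bar>\<phi> s - \<phi> t\<bar> \<le> B * \<bar>s - t\<bar>" for \<phi> :: "real \<Rightarrow> real"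
  proof (rule lipschitz_on_continuous_on)
    show "B-lipschitz_on UNIV \<phi>" using that B0 by (intro lipschitz_onI) (auto simp: dist_real_def)
  qed
  define it where "it h k = (T h ^^ k) (\<lambda>_. v)" for h k
  have it_lip: "\<bar>it h k s - it h k t\<bar> \<le> B * \<bar>s - t\<bar>" for h k s t
  proof (induction k arbitrary: s t)
    case (Suc k)
    show ?case using T_lip[OF lip_cont[OF Suc], of h s t] unfolding it_def by simp
  qed (use B0 in \<open>simp add: it_def\<close>)
  have it_c: "continuous_on S (it h k)" for h k S
    using continuous_on_subset[OF lip_cont[OF it_lip]] by blast
  \<comment> \<open>\<open>T h \<phi> t\<close> looks at \<open>\<phi>\<close> only up to
    \<open>t - h\<close>, so every iteration settles the values on a further piece of length
    \<open>h\<close>.\<close>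
  have stable: "it h (Suc k) t = it h k t" if "h > 0" "t \<le> a + real (Suc k) * h" for h t :: real and k
    using that(2)
  proof (induction k arbitrary: t)
    case 0
    then have "max a (t - h) = a" by simp
    then show ?case unfolding it_def by (simp add: T_def)
  next
    case (Suc k)
    have "integral {a..max a (t - h)} (\<lambda>s. F (s, it h (Suc k) s)) = integral {a..max a (t - h)} (\<lambda>s. F (s, it h k s))"
    proof (rule integral_cong)
      fix s assume "s \<in> {a..max a (t - h)}"
      then have "s \<le> a + Suc k * h" using Suc.prems \<open>h > 0\<close> by (auto simp: algebra_simps max_def split: if_splits)
      then show "F (s, it h (Suc k) s) = F (s, it h k s)" using Suc.IH by simp
    qed
    then have "T h (it h (Suc k)) t = T h (it h k) t" unfolding T_def by simp
    then show ?case unfolding it_def by simp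
  qed
  \<comment> \<open>Then \<open>n + 1\<close> pieces reach beyond \<open>b\<close>, so the
    \<open>n\<close>-th iterate is a fixed point on the whole interval. The added 1 keeps
    \<open>h n\<close> positive when \<open>a = b\<close>.\<close>
  define h where "h n = (b - a + 1) / Suc n" for n :: nat
  have h: "h n > 0" "a + Suc n * h n = b + 1" for n using ab unfolding h_def by auto
  define \<phi> where "\<phi> n = it (h n) n" for n
  have \<phi>_eq: "\<phi> n t = v + integral {a..max a (t - h n)} (\<lambda>s. F (s, \<phi> n s))" if "t \<le> b" for n t
  proof -
    have "t \<le> a + real (Suc n) * h n" using h(2)[of n] that by linarith
    then have "it (h n) (Suc n) t = it (h n) n t" using stable[of "h n" t n] h(1)[of n] by blast
    then show ?thesis unfolding \<phi>_def it_def by (simp add: T_def)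
  qed
  have \<phi>_lip: "\<bar>\<phi> n s - \<phi> n t\<bar> \<le> B * \<bar>s - t\<bar>" for n s t unfolding \<phi>_def by (rule it_lip)
  have \<phi>_a: "\<phi> n a = v" for n using \<phi>_eq[of a n] ab h(1)[of n] by (simp add: max_def)
  have \<phi>_c: "continuous_on S (\<phi> n)" for n S unfolding \<phi>_def by (rule it_c)
  have bd: "\<bar>\<phi> n t\<bar> \<le> \<bar>v\<bar> + B * (b - a)" if "t \<in> {a..b}" for n t
  proof -
    have "\<bar>\<phi> n t - v\<bar> \<le> B * \<bar>t - a\<bar>" using \<phi>_lip[of n t a] \<phi>_a by simp
    also have "\<dots> \<le> B * (b - a)" using that B0 by (intro mult_left_mono) auto
    finally show ?thesis by linarith
  qed
  obtain r \<psi> where r: "strict_mono (r :: nat \<Rightarrow> nat)" "continuous_on {a..b} \<psi>"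
    "uniform_limit {a..b} (\<lambda>i. \<phi> (r i)) \<psi> sequentially"
    by (rule uniform_subseq[of a b \<phi> B, OF \<phi>_lip bd])
  have lim: "(\<lambda>i. \<phi> (r i) t) \<longlonglongrightarrow> \<psi> t" if "t \<in> {a..b}" for t
    using tendsto_uniform_limitI[OF r(3) that] .
  have eq: "\<psi> t = v + integral {a..t} (\<lambda>s. F (s, \<psi> s))" if t: "t \<in> {a..b}" for t
  proof -
    have i1: "(\<lambda>i. integral {a..t} (\<lambda>s. F (s, \<phi> (r i) s))) \<longlonglongrightarrow> integral {a..t} (\<lambda>s. F (s, \<psi> s))"
      by (rule integral_tendsto[OF F F locally_uniform_const r(3) \<phi>_c r(2) t])
    have "(\<lambda>n. (b - a + 1) * inverse (real (Suc n))) \<longlonglongrightarrow> (b - a + 1) * 0"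
      by (intro tendsto_mult tendsto_const LIMSEQ_inverse_real_of_nat)
    then have "h \<longlonglongrightarrow> 0" unfolding h_def[abs_def] by (simp add: divide_inverse)
    then have h0: "(\<lambda>i. h (r i)) \<longlonglongrightarrow> 0" using LIMSEQ_subseq_LIMSEQ[OF _ r(1)] unfolding o_def by blast
    have "(\<lambda>i. \<phi> (r i) t - (v + integral {a..t} (\<lambda>s. F (s, \<phi> (r i) s)))) \<longlonglongrightarrow> 0"
    proof (rule Lim_null_comparison)
      show "(\<lambda>i. B * h (r i)) \<longlonglongrightarrow> 0" using h0 by (rule tendsto_mult_right_zero)
      show "\<forall>\<^sub>F i in sequentially. norm (\<phi> (r i) t - (v + integral {a..t} (\<lambda>s. F (s, \<phi> (r i) s)))) \<le> B * h (r i)"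
      proof (intro always_eventually allI)
        fix i
        have "\<bar>integral {a..max a (t - h (r i))} (\<lambda>s. F (s, \<phi> (r i) s)) - integral {a..t} (\<lambda>s. F (s, \<phi> (r i) s))\<bar>
          \<le> B * \<bar>max a (t - h (r i)) - t\<bar>"
          by (rule integral_lipschitz[of a b]) (use t h(1)[of "r i"] in \<open>auto intro!: continuous_on_graph F \<phi>_c B\<close>)
        also have "\<dots> \<le> B * h (r i)" using B0 t h(1)[of "r i"] by (intro mult_left_mono) auto
        finally show "norm (\<phi> (r i) t - (v + integral {a..t} (\<lambda>s. F (s, \<phi> (r i) s)))) \<le> B * h (r i)"
          using \<phi>_eq[of t "r i"] t by simp
      qed
    qed
    then have "(\<lambda>i. \<phi> (r i) t - (v + integral {a..t} (\<lambda>s. F (s, \<phi> (r i) s))) + (v + integral {a..t} (\<lambda>s. F (s, \<phi> (r i) s))))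
        \<longlonglongrightarrow> 0 + (v + integral {a..t} (\<lambda>s. F (s, \<psi> s)))"
      by (intro tendsto_add tendsto_const i1)
    then have "(\<lambda>i. \<phi> (r i) t) \<longlonglongrightarrow> v + integral {a..t} (\<lambda>s. F (s, \<psi> s))" by simp
    then show ?thesis using lim[OF t] LIMSEQ_unique by blast
  qed
  show ?thesis
    by (rule that[OF sol_of_integral[OF F r(2) eq]]) (use eq[of a] ab in auto)
qed

text \<open>Where the clamped solution leaves the strip between two barriers that are solutions, the barrier has
  the same slope. So clamping a solution of the clamped equation yields a solution of the original one.\<close>

lemma clamped_peano:
  assumes F: "continuous_on UNIV F" and ab: "a \<le> b"
    and l: "continuous_on {a..b} l" and u: "continuous_on {a..b} u"
  obtains \<xi> where "\<xi> a = v"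
    "\<And>t. t \<in> {a..b} \<Longrightarrow> (\<xi> has_real_derivative F (t, max (l t) (min (u t) (\<xi> t)))) (at t within {a..b})"
proof -
  \<comment> \<open>Clamping the time as well makes the field continuous and bounded on the whole
    plane, as \<open>peano_bounded\<close> demands.\<close>
  define c where "c t = max a (min b t)" for t
  have c: "c t \<in> {a..b}" for t using ab unfolding c_def by auto
  have cc: "continuous_on UNIV c" unfolding c_def by (intro continuous_intros)
  define G where "G = (\<lambda>(t, y). F (c t, max (l (c t)) (min (u (c t)) y)))"
  have Gc: "continuous_on UNIV G"
    unfolding G_def case_prod_beta
    by (intro continuous_on_compose2[OF F] continuous_intros continuous_on_compose2[OF l]
        continuous_on_compose2[OF u] continuous_on_compose2[OF cc]) (use c in auto)
  obtain M1 where M1: "M1 \<ge> 0" "\<And>t. t \<in> {a..b} \<Longrightarrow> \<bar>l t\<bar> \<le> M1"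
    using interval_bound[OF l] by metis
  obtain M2 where M2: "M2 \<ge> 0" "\<And>t. t \<in> {a..b} \<Longrightarrow> \<bar>u t\<bar> \<le> M2"
    using interval_bound[OF u] by metis
  obtain B where B: "\<And>t y. t \<in> {a..b} \<Longrightarrow> \<bar>y\<bar> \<le> M1 + M2 \<Longrightarrow> \<bar>F (t, y)\<bar> \<le> B"
    using compact_box_bound[OF F, of a b "M1 + M2"] by metis
  have B': "\<bar>F (t, max (l t) (min (u t) y))\<bar> \<le> B" if "t \<in> {a..b}" for t y
    by (rule B[OF that]) (use M1(1) M2(1) M1(2)[OF that] M2(2)[OF that] in linarith)
  have "\<bar>G p\<bar> \<le> B" for p unfolding G_def case_prod_beta by (rule B'[OF c])
  then obtain \<xi> where \<xi>: "sol G a b \<xi>" "\<xi> a = v"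
    using peano_bounded[OF Gc _ ab] by blast
  show ?thesis
  proof (rule that[of \<xi>, OF \<xi>(2)])
    fix t assume t: "t \<in> {a..b}"
    then have "c t = t" unfolding c_def by auto
    then have "G (t, \<xi> t) = F (t, max (l t) (min (u t) (\<xi> t)))" unfolding G_def by simp
    then show "(\<xi> has_real_derivative F (t, max (l t) (min (u t) (\<xi> t)))) (at t within {a..b})"
      using \<xi>(1) t unfolding sol_def by metis
  qed
qed

section \<open>Extension of solutions and solutions between barriers\<close>

lemma first_hit:
  fixes f :: "real \<Rightarrow> real"
  assumes c: "continuous_on {a..b} f" and ab: "a \<le> b" and fa: "f a \<le> K"
  obtains s where "a \<le> s" "s \<le> b" "\<And>t. t \<in> {a..s} \<Longrightarrow> f t \<le> K" "s = b \<or> f s = K"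
proof (cases "\<forall>t\<in>{a..b}. f t \<le> K")
  case True
  then show ?thesis using that[of b] ab by auto
next
  case False
  then obtain t1 where t1: "t1 \<in> {a..b}" "f t1 > K" by force
  define S where "S = {a..t1} \<inter> f -` {K..}"
  have ct1: "continuous_on {a..t1} f" using c t1 by (auto elim: continuous_on_subset)
  have "closed S" unfolding S_def
    by (rule continuous_closed_preimage[OF ct1 closed_real_atLeastAtMost closed_atLeast])
  moreover have "bounded S" unfolding S_def
    by (rule bounded_subset[OF bounded_closed_interval[of a t1]]) auto
  ultimately have "compact S" by (simp add: compact_eq_bounded_closed)
  moreover have "S \<noteq> {}" using t1 unfolding S_def by auto
  ultimately obtain s where s: "s \<in> S" "\<And>t. t \<in> S \<Longrightarrow> s \<le> t"
    using compact_attains_inf[of S] by metis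
  have below: "f t < K" if "a \<le> t" "t < s" for t
  proof (rule ccontr)
    assume "\<not> f t < K"
    then have "t \<in> S" using s(1) that unfolding S_def by auto
    then show False using s(2) that by force
  qed
  have "f s = K"
  proof (rule antisym)
    show "f s \<le> K"
    proof (rule ccontr)
      assume "\<not> f s \<le> K"
      moreover have "a \<le> s" "continuous_on {a..s} f"
        using s(1) continuous_on_subset[OF ct1, of "{a..s}"] unfolding S_def by auto
      ultimately obtain x where "a \<le> x" "x \<le> s" "f x = K"
        using IVT'[of f a K s] fa by auto
      then show False using below[of x] \<open>\<not> f s \<le> K\<close> by (cases "x = s") auto
    qed
  qed (use s(1) in \<open>auto simp: S_def\<close>)
  moreover have "f t \<le> K" if "t \<in> {a..s}" for t
    using below[of t] \<open>f s = K\<close> that by (cases "t = s") auto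
  ultimately show ?thesis using that[of s] s(1) t1(1) unfolding S_def by auto
qed

text \<open>The clamped equation has a solution up to time \<open>b\<close>, and its maximum with
  \<open>\<psi>\<close> is genuine until the ceiling \<open>K\<close> is met. So above a living
  solution the only way to stop early is to reach the ceiling.\<close>

lemma sol_extend_above:
  assumes F: "continuous_on UNIV F" and ab: "a \<le> b" and \<psi>: "sol F a b \<psi>"
    and K: "\<And>t. t \<in> {a..b} \<Longrightarrow> \<psi> t \<le> K" and v: "\<psi> a \<le> v" "v \<le> K"
  obtains s \<phi> where "a \<le> s" "s \<le> b" "sol F a s \<phi>" "\<phi> a = v"
    "\<And>t. t \<in> {a..s} \<Longrightarrow> \<psi> t \<le> \<phi> t \<and> \<phi> t \<le> K" "s = b \<or> \<phi> s = K"
proof -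
  obtain \<xi> where \<xi>: "\<xi> a = v"
    "\<And>t. t \<in> {a..b} \<Longrightarrow> (\<xi> has_real_derivative F (t, max (\<psi> t) (min K (\<xi> t)))) (at t within {a..b})"
    using clamped_peano[OF F ab sol_continuous[OF \<psi>] continuous_on_const] by blast
  have "continuous_on {a..b} \<xi>" using DERIV_continuous_on[OF \<xi>(2)] by blast
  then obtain s where s: "a \<le> s" "s \<le> b" "\<And>t. t \<in> {a..s} \<Longrightarrow> \<xi> t \<le> K" "s = b \<or> \<xi> s = K"
    using first_hit[of a b \<xi> K] ab v \<xi>(1) by metis
  define \<phi> where "\<phi> t = max (\<xi> t) (\<psi> t)" for t
  have "sol F a s \<phi>"
    unfolding sol_def
  proof
    fix t assume t: "t \<in> {a..s}"
    then have tb: "t \<in> {a..b}" using s by auto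
    have e: "max (\<psi> t) (min K (\<xi> t)) = max (\<xi> t) (\<psi> t)" using s(3)[OF t] by auto
    have "((\<lambda>t. max (\<xi> t) (\<psi> t)) has_real_derivative F (t, max (\<xi> t) (\<psi> t))) (at t within {a..b})"
      by (rule has_real_derivative_max[OF \<xi>(2)[OF tb, unfolded e] \<psi>[unfolded sol_def, rule_format, OF tb] tb]) auto
    then show "(\<phi> has_real_derivative F (t, \<phi> t)) (at t within {a..s})"
      unfolding \<phi>_def by (rule DERIV_subset) (use s in auto)
  qed
  moreover have "\<phi> a = v" using v \<xi>(1) unfolding \<phi>_def by simp
  moreover have "\<psi> t \<le> \<phi> t \<and> \<phi> t \<le> K" if "t \<in> {a..s}" for t
    using s(2) s(3)[OF that] K[of t] that unfolding \<phi>_def by auto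
  moreover have "s = b \<or> \<phi> s = K" using s(1,2,4) K[of s] unfolding \<phi>_def by auto
  ultimately show ?thesis using that s by blast
qed

lemma sol_extend_box:
  assumes F: "continuous_on UNIV F" and ab: "a \<le> b" and v: "\<bar>v\<bar> \<le> J"
  obtains s \<phi> where "a \<le> s" "s \<le> b" "sol F a s \<phi>" "\<phi> a = v"
    "\<And>t. t \<in> {a..s} \<Longrightarrow> \<bar>\<phi> t\<bar> \<le> J" "s = b \<or> \<bar>\<phi> s\<bar> = J"
proof -
  obtain \<xi> where \<xi>: "\<xi> a = v"
    "\<And>t. t \<in> {a..b} \<Longrightarrow> (\<xi> has_real_derivative F (t, max (- J) (min J (\<xi> t)))) (at t within {a..b})"
    using clamped_peano[OF F ab continuous_on_const[of _ "- J"] continuous_on_const[of _ J]] by blast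
  have "continuous_on {a..b} (\<lambda>t. \<bar>\<xi> t\<bar>)"
    using DERIV_continuous_on[OF \<xi>(2)] by (intro continuous_intros) blast
  then obtain s where s: "a \<le> s" "s \<le> b" "\<And>t. t \<in> {a..s} \<Longrightarrow> \<bar>\<xi> t\<bar> \<le> J" "s = b \<or> \<bar>\<xi> s\<bar> = J"
    using first_hit[of a b "\<lambda>t. \<bar>\<xi> t\<bar>" J] ab v \<xi>(1) by metis
  have "sol F a s \<xi>"
    unfolding sol_def
  proof
    fix t assume t: "t \<in> {a..s}"
    then have tb: "t \<in> {a..b}" using s by auto
    have e: "max (- J) (min J (\<xi> t)) = \<xi> t" using s(3)[OF t] by auto
    show "(\<xi> has_real_derivative F (t, \<xi> t)) (at t within {a..s})"
      using \<xi>(2)[OF tb, unfolded e] by (rule DERIV_subset) (use s in auto)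
  qed
  then show ?thesis using that s \<xi>(1) by blast
qed

lemma sol_between:
  assumes F: "continuous_on UNIV F" and ab: "a \<le> b" and \<psi>: "sol F a b \<psi>1" "sol F a b \<psi>2"
    and le: "\<And>t. t \<in> {a..b} \<Longrightarrow> \<psi>1 t \<le> \<psi>2 t" and v: "\<psi>1 a \<le> v" "v \<le> \<psi>2 a"
  obtains \<phi> where "sol F a b \<phi>" "\<phi> a = v" "\<And>t. t \<in> {a..b} \<Longrightarrow> \<psi>1 t \<le> \<phi> t \<and> \<phi> t \<le> \<psi>2 t"
proof -
  obtain \<xi> where \<xi>: "\<xi> a = v"
    "\<And>t. t \<in> {a..b} \<Longrightarrow> (\<xi> has_real_derivative F (t, max (\<psi>1 t) (min (\<psi>2 t) (\<xi> t)))) (at t within {a..b})"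
    using clamped_peano[OF F ab sol_continuous[OF \<psi>(1)] sol_continuous[OF \<psi>(2)]] by blast
  define \<phi> where "\<phi> t = max (\<psi>1 t) (min (\<psi>2 t) (\<xi> t))" for t
  have "sol F a b \<phi>"
    unfolding sol_def
  proof
    fix t assume t: "t \<in> {a..b}"
    have d1: "(\<psi>1 has_real_derivative F (t, \<psi>1 t)) (at t within {a..b})"
      and d2: "(\<psi>2 has_real_derivative F (t, \<psi>2 t)) (at t within {a..b})"
      using \<psi> t unfolding sol_def by auto
    \<comment> \<open>The derivative of the inner minimum. Where \<open>\<xi>\<close> is at or above
      \<open>\<psi>2\<close>, its clamped slope is that of \<open>\<psi>2\<close>, so the two agree
      where the functions meet.\<close>
    define D where "D = (if \<psi>2 t \<le> \<xi> t then F (t, \<psi>2 t) else F (t, max (\<psi>1 t) (\<xi> t)))"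
    have m: "((\<lambda>t. min (\<psi>2 t) (\<xi> t)) has_real_derivative D) (at t within {a..b})"
      by (rule has_real_derivative_min[OF d2 \<xi>(2)[OF t] t])
        (use le[OF t] in \<open>auto simp: D_def min_def max_def\<close>)
    show "(\<phi> has_real_derivative F (t, \<phi> t)) (at t within {a..b})"
      unfolding \<phi>_def
      by (rule has_real_derivative_max[OF d1 m t])
        (use le[OF t] in \<open>auto simp: D_def min_def max_def split: if_splits\<close>)
  qed
  moreover have "\<phi> a = v" unfolding \<phi>_def using v \<xi>(1) by auto
  moreover have "\<psi>1 t \<le> \<phi> t \<and> \<phi> t \<le> \<psi>2 t" if "t \<in> {a..b}" for t
    unfolding \<phi>_def using le[OF that] by auto
  ultimately show ?thesis using that by blast
qed

lemma continuous_reflect: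
  assumes "continuous_on UNIV (F :: real \<times> real \<Rightarrow> real)"
  shows "continuous_on UNIV (\<lambda>(t, y). - F (- t, y))"
  unfolding case_prod_beta by (intro continuous_intros continuous_on_compose2[OF assms]; simp)

text \<open>Reversing time turns the prescribed end value into an initial value.\<close>

lemma sol_between_end:
  assumes F: "continuous_on UNIV F" and ab: "a \<le> b" and \<psi>: "sol F a b \<psi>1" "sol F a b \<psi>2"
    and le: "\<And>t. t \<in> {a..b} \<Longrightarrow> \<psi>1 t \<le> \<psi>2 t" and v: "\<psi>1 b \<le> v" "v \<le> \<psi>2 b"
  obtains \<phi> where "sol F a b \<phi>" "\<phi> b = v" "\<And>t. t \<in> {a..b} \<Longrightarrow> \<psi>1 t \<le> \<phi> t \<and> \<phi> t \<le> \<psi>2 t"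
proof -
  obtain \<phi> where \<phi>: "sol (\<lambda>(t, y). - F (- t, y)) (- b) (- a) \<phi>" "\<phi> (- b) = v"
    "\<And>t. t \<in> {- b..- a} \<Longrightarrow> \<psi>1 (- t) \<le> \<phi> t \<and> \<phi> t \<le> \<psi>2 (- t)"
    by (rule sol_between[OF continuous_reflect[OF F] _ sol_reflect[OF \<psi>(1)] sol_reflect[OF \<psi>(2)], of v])
      (use ab le v in auto)
  have "sol F a b (\<lambda>t. \<phi> (- t))" using sol_reflect[OF \<phi>(1)] by (simp add: case_prod_beta)
  then show ?thesis
    by (rule that) (use \<phi>(2) \<phi>(3)[of "- t" for t] in auto)
qed

section \<open>Global solutions and explosions\<close>

lemma sol_limit_fixed:
  assumes F: "continuous_on UNIV F" and Fs: "\<And>i. continuous_on UNIV (Fs i)" "locally_uniform Fs F" and ab: "a \<le> b"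
    and sol: "\<And>i. sol (Fs i) a b (f i)" and K: "\<And>i t. t \<in> {a..b} \<Longrightarrow> \<bar>f i t\<bar> \<le> K"
  obtains r \<psi> where "strict_mono (r :: nat \<Rightarrow> nat)" "sol F a b \<psi>"
    "\<And>t. t \<in> {a..b} \<Longrightarrow> (\<lambda>i. f (r i) t) \<longlonglongrightarrow> \<psi> t"
proof -
  obtain r \<sigma> \<psi> where r: "strict_mono (r :: nat \<Rightarrow> nat)" "(\<lambda>i. b) \<longlonglongrightarrow> \<sigma>"
      "sol F a \<sigma> \<psi>" "\<And>t. t \<in> {a..\<sigma>} \<Longrightarrow> (\<lambda>i. f (r i) (min t b)) \<longlonglongrightarrow> \<psi> t"
    by (rule sol_limit[OF F Fs, of a "\<lambda>_. b" b f K]) (use ab sol K in auto)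
  have "\<sigma> = b" using r(2) by (simp add: LIMSEQ_const_iff)
  then show ?thesis using that[OF r(1)] r(3,4) by (metis atLeastAtMost_iff min.absorb1)
qed

definition global_from :: "(real \<times> real \<Rightarrow> real) \<Rightarrow> real \<Rightarrow> real \<Rightarrow> bool" where
  "global_from F a v \<longleftrightarrow> (\<exists>\<phi>. \<phi> a = v \<and> (\<forall>n::nat. sol F a (a + n) \<phi>))"

text \<open>Each step advances time by at least 1, so the pasted pieces exhaust the half-line. The
  invariant records what the next step has to know about the point reached.\<close>

lemma global_from_chain:
  assumes init: "Inv a v"
    and step: "\<And>t v. Inv t v \<Longrightarrow> \<exists>t' \<phi>. t' \<ge> t + 1 \<and> sol F t t' \<phi> \<and> \<phi> t = v \<and> Inv t' (\<phi> t')"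
  shows "global_from F a v"
proof -
  define P where "P n x \<longleftrightarrow> sol F a (fst x) (snd x) \<and> snd x a = v \<and> Inv (fst x) (snd x (fst x)) \<and> a + real n \<le> fst x"
    for n and x :: "real \<times> (real \<Rightarrow> real)"
  define Q where "Q n x y \<longleftrightarrow> (\<forall>s\<le>fst x. snd y s = snd x s)"
    for n :: nat and x y :: "real \<times> (real \<Rightarrow> real)"
  have "\<exists>f. \<forall>n. P n (f n) \<and> Q n (f n) (f (Suc n))"
  proof (rule dependent_nat_choice)
    show "\<exists>x. P 0 x"
      by (rule exI[of _ "(a, \<lambda>_. v)"]) (use init in \<open>simp add: P_def sol_trivial\<close>)
    fix x n assume "P n x"
    then obtain t \<phi> where x: "x = (t, \<phi>)" "sol F a t \<phi>" "\<phi> a = v" "Inv t (\<phi> t)" "a + real n \<le> t"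
      unfolding P_def by (metis prod.collapse)
    from step[OF x(4)] obtain t' \<psi> where t': "t' \<ge> t + 1" "sol F t t' \<psi>" "\<psi> t = \<phi> t" "Inv t' (\<psi> t')" by blast
    have at: "a \<le> t" using x(5) by linarith
    let ?g = "\<lambda>s. if s \<le> t then \<phi> s else \<psi> s"
    have "sol F a t' ?g" by (rule sol_glue[OF x(2) t'(2) at]) (use t' in auto)
    then have "P (Suc n) (t', ?g)" using x t' at unfolding P_def by auto
    moreover have "Q n x (t', ?g)" unfolding Q_def x(1) by simp
    ultimately show "\<exists>y. P (Suc n) y \<and> Q n x y" by blast
  qed
  then obtain f where f: "\<And>n. P n (f n)" "\<And>n. Q n (f n) (f (Suc n))" by blast
  have tn: "a + real n \<le> fst (f n)" for n using f(1) unfolding P_def by blast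
  have agree: "snd (f (m + k)) s = snd (f m) s" if "s \<le> a + real m" for m k s
  proof (induction k)
    case (Suc k)
    have "s \<le> fst (f (m + k))" using tn[of "m + k"] that by simp
    then show ?case using f(2)[of "m + k"] Suc unfolding Q_def by simp
  qed simp
  \<comment> \<open>Later stages do not change earlier values, so the value at \<open>s\<close> can
    be read off at any stage that has reached \<open>s\<close>.\<close>
  define \<Phi> where "\<Phi> s = snd (f (nat \<lceil>s - a\<rceil>)) s" for s
  have eq: "\<Phi> s = snd (f n) s" if "s \<le> a + real n" for s n
  proof -
    have "nat \<lceil>s - a\<rceil> \<le> n" using that by linarith
    moreover have "s \<le> a + real (nat \<lceil>s - a\<rceil>)" by linarith
    ultimately show ?thesis unfolding \<Phi>_def using agree[of s "nat \<lceil>s - a\<rceil>" "n - nat \<lceil>s - a\<rceil>"] by simp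
  qed
  have "sol F a (a + n) \<Phi>" for n :: nat
  proof (subst sol_cong[of _ _ _ "snd (f n)"])
    show "sol F a (a + n) (snd (f n))"
      using f(1)[of n] tn[of n] unfolding P_def by (auto intro: sol_subset)
  qed (use eq in auto)
  moreover have "\<Phi> a = v" using eq[of a 0] f(1)[of 0] unfolding P_def by simp
  ultimately show ?thesis unfolding global_from_def by blast
qed

text \<open>The bounds act up to time \<open>q\<close> only. Where \<open>lo t = hi t\<close> they
  fix the value at \<open>t\<close>, so an initial condition is a special case, and they survive
  taking the maximum of two members.\<close>

definition constrained :: "(real \<times> real \<Rightarrow> real) \<Rightarrow> real \<Rightarrow> real \<Rightarrow> (real \<Rightarrow> real) \<Rightarrow> (real \<Rightarrow> real) \<Rightarrow> real \<Rightarrow> (real \<Rightarrow> real) \<Rightarrow> bool" where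
  "constrained F a q lo hi s \<phi> \<longleftrightarrow> sol F a s \<phi> \<and> (\<forall>t\<in>{a..q}. lo t \<le> \<phi> t \<and> \<phi> t \<le> hi t)"

text \<open>The members of the family reach every height before time \<open>q + T\<close>. The lower bound \<open>- J\<close> makes
  the set of all fields with this property closed.\<close>

definition family_explodes :: "(real \<times> real \<Rightarrow> real) \<Rightarrow> real \<Rightarrow> real \<Rightarrow> (real \<Rightarrow> real) \<Rightarrow> (real \<Rightarrow> real) \<Rightarrow> nat \<Rightarrow> nat \<Rightarrow> bool" where
  "family_explodes F a q lo hi J T \<longleftrightarrow> (\<forall>K::nat. \<exists>s \<phi>. q \<le> s \<and> s \<le> q + T \<and> constrained F a q lo hi s \<phi> \<and>
     (\<forall>t\<in>{a..s}. - real J \<le> \<phi> t) \<and> real K \<le> \<phi> s)"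

lemma constrained_subset: "constrained F a q lo hi s \<phi> \<Longrightarrow> t \<le> s \<Longrightarrow> constrained F a q lo hi t \<phi>"
  unfolding constrained_def by (auto intro: sol_subset)

lemma constrained_max:
  assumes "constrained F a q lo hi s \<phi>" "constrained F a q lo hi s \<psi>"
  shows "constrained F a q lo hi s (\<lambda>t. max (\<phi> t) (\<psi> t))"
  using assms unfolding constrained_def by (auto intro: sol_max simp: le_max_iff_disj)

text \<open>\<open>family_explodes\<close> counts only members that are at least \<open>- J\<close>.
  Taking the maximum with one fixed member that lives up to time \<open>q + n\<close> puts any
  member into this position without lowering its end value, so the absence of explosions bounds all
  members from above.\<close>

lemma constrained_bound:
  assumes aq: "a \<le> q" and ex: "\<exists>\<psi>. constrained F a q lo hi (q + n) \<psi>" and no: "\<And>J T. \<not> family_explodes F a q lo hi J T"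
  obtains K :: real where "\<And>s \<phi>. q \<le> s \<Longrightarrow> s \<le> q + real n \<Longrightarrow> constrained F a q lo hi s \<phi> \<Longrightarrow> \<phi> s < K"
proof -
  obtain \<psi> where \<psi>: "constrained F a q lo hi (q + n) \<psi>" using ex by blast
  then obtain M where M: "M \<ge> 0" "\<And>t. t \<in> {a..q + n} \<Longrightarrow> \<bar>\<psi> t\<bar> \<le> M"
    using interval_bound[OF sol_continuous] unfolding constrained_def by metis
  obtain J :: nat where J: "M \<le> real J" using real_arch_simple by blast
  obtain K :: nat where K: "\<And>s \<phi>. \<lbrakk>q \<le> s; s \<le> q + n; constrained F a q lo hi s \<phi>; \<forall>t\<in>{a..s}. - real J \<le> \<phi> t\<rbrakk> \<Longrightarrow> \<not> real K \<le> \<phi> s"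
    using no[of J n] unfolding family_explodes_def by blast
  show ?thesis
  proof (rule that[of "real K"])
    fix s \<phi> assume s: "q \<le> s" "s \<le> q + real n" and \<phi>: "constrained F a q lo hi s \<phi>"
    have "\<not> real K \<le> max (\<phi> s) (\<psi> s)"
    proof (rule K[OF s constrained_max[OF \<phi> constrained_subset[OF \<psi> s(2)]]], rule ballI)
      fix t assume "t \<in> {a..s}"
      then have "\<bar>\<psi> t\<bar> \<le> M" using M(2) s by simp
      then show "- real J \<le> max (\<phi> t) (\<psi> t)" using J by linarith
    qed
    then show "\<phi> s < real K" by simp
  qed
qed

text \<open>The longer-living member is the lower barrier along which the shorter one is raised and
  continued. The continuation could stop early only at the ceiling \<open>K\<close>, which no member
  reaches.\<close>

lemma constrained_extend:
  assumes F: "continuous_on UNIV F" and aq: "a \<le> q" and mn: "m \<le> n"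
    and \<phi>: "constrained F a q lo hi (q + real m) \<phi>" and ex: "\<exists>\<psi>. constrained F a q lo hi (q + real n) \<psi>"
    and no: "\<And>J T. \<not> family_explodes F a q lo hi J T"
  shows "\<exists>\<psi>. constrained F a q lo hi (q + real n) \<psi> \<and> (\<forall>t\<in>{a..q + real m}. \<phi> t \<le> \<psi> t)"
proof -
  obtain \<psi> where \<psi>: "constrained F a q lo hi (q + n) \<psi>" using ex by blast
  obtain K where K: "\<And>s \<phi>. q \<le> s \<Longrightarrow> s \<le> q + real n \<Longrightarrow> constrained F a q lo hi s \<phi> \<Longrightarrow> \<phi> s < K"
    using constrained_bound[OF aq ex no] by blast
  have qmn: "q + real m \<le> q + real n" using mn by simp
  define \<xi> where "\<xi> t = max (\<phi> t) (\<psi> t)" for t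
  have \<xi>: "constrained F a q lo hi (q + real m) \<xi>"
    unfolding \<xi>_def by (rule constrained_max[OF \<phi> constrained_subset[OF \<psi> qmn]])
  have "sol F (q + m) (q + n) \<psi>" using \<psi> aq unfolding constrained_def by (auto intro: sol_subset)
  moreover have "\<psi> t \<le> K" if "t \<in> {q + real m..q + real n}" for t
    using K[OF _ _ constrained_subset[OF \<psi>, of t]] that by (simp add: less_imp_le)
  moreover have "\<psi> (q + m) \<le> \<xi> (q + m)" unfolding \<xi>_def by simp
  moreover have "\<xi> (q + m) \<le> K" using K[OF _ qmn \<xi>] by simp
  ultimately obtain s \<eta> where s: "q + m \<le> s" "s \<le> q + n" "sol F (q + m) s \<eta>" "\<eta> (q + m) = \<xi> (q + m)"
    "\<And>t. t \<in> {q + m..s} \<Longrightarrow> \<psi> t \<le> \<eta> t \<and> \<eta> t \<le> K" "s = q + n \<or> \<eta> s = K"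
    using sol_extend_above[OF F qmn] by blast
  define \<zeta> where "\<zeta> t = (if t \<le> q + m then \<xi> t else \<eta> t)" for t
  have \<zeta>: "constrained F a q lo hi s \<zeta>"
    unfolding constrained_def
  proof
    show "sol F a s \<zeta>" unfolding \<zeta>_def
      by (rule sol_glue[OF _ s(3)]) (use \<xi> s aq in \<open>auto simp: constrained_def\<close>)
    show "\<forall>t\<in>{a..q}. lo t \<le> \<zeta> t \<and> \<zeta> t \<le> hi t" using \<xi> unfolding constrained_def \<zeta>_def by auto
  qed
  have "\<zeta> s = \<eta> s" unfolding \<zeta>_def using s(1,4) by auto
  moreover have "\<zeta> s < K" using K[OF _ s(2) \<zeta>] s(1) by simp
  ultimately have "s = q + n" using s(6) by auto
  then show ?thesis using \<zeta> by (intro exI[of _ \<zeta>]) (auto simp: \<zeta>_def \<xi>_def)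
qed

text \<open>A member that lives up to time \<open>q + m\<close> can be raised to one that lives longer, so that there is an
  increasing sequence of members. It is bounded since the family does not explode upwards.\<close>

lemma family_global:
  assumes F: "continuous_on UNIV F" and aq: "a \<le> q"
    and ex: "\<And>n::nat. \<exists>\<psi>. constrained F a q lo hi (q + n) \<psi>" and no: "\<And>J T. \<not> family_explodes F a q lo hi J T"
    and H: "\<And>t. t \<in> {a..q} \<Longrightarrow> hi t \<le> H"
  shows "\<exists>\<phi>. \<forall>n::nat. constrained F a q lo hi (q + n) \<phi>"
proof -
  have "\<exists>f. \<forall>n. constrained F a q lo hi (q + real n) (f n) \<and> (\<forall>t\<in>{a..q + real n}. f n t \<le> f (Suc n) t)"
  proof (rule dependent_nat_choice)
    show "\<exists>x. constrained F a q lo hi (q + real 0) x" using ex[of 0] .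
    show "\<exists>y. constrained F a q lo hi (q + real (Suc n)) y \<and> (\<forall>t\<in>{a..q + real n}. x t \<le> y t)"
      if "constrained F a q lo hi (q + real n) x" for x n
      by (rule constrained_extend[OF F aq _ that ex no]) simp
  qed
  then obtain f where f: "\<And>n. constrained F a q lo hi (q + real n) (f n)"
    "\<And>n t. t \<in> {a..q + real n} \<Longrightarrow> f n t \<le> f (Suc n) t" by blast
  have mono: "f (n + i) t \<le> f (n + Suc i) t" if "t \<in> {a..q + real n}" for n i t
    using f(2)[of t "n + i"] that by simp
  have lb: "f n t \<le> f (n + i) t" if "t \<in> {a..q + real n}" for n i t
    by (induction i) (use mono[OF that] order_trans in \<open>auto intro: order_trans\<close>)
  \<comment> \<open>Monotonicity bounds the sequence from below by its \<open>n\<close>-th member.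
    From above it is bounded by \<open>H\<close> up to time \<open>q\<close> and by the absence of
    explosions afterwards.\<close>
  have bd: "\<exists>B. \<forall>i. \<forall>t\<in>{a..q + real n}. \<bar>f (n + i) t\<bar> \<le> B" for n
  proof -
    obtain K where K: "\<And>s \<phi>. q \<le> s \<Longrightarrow> s \<le> q + real n \<Longrightarrow> constrained F a q lo hi s \<phi> \<Longrightarrow> \<phi> s < K"
      using constrained_bound[OF aq ex no] by blast
    obtain M where M: "M \<ge> 0" "\<And>t. t \<in> {a..q + real n} \<Longrightarrow> \<bar>f n t\<bar> \<le> M"
      using interval_bound[OF sol_continuous] f(1)[of n] unfolding constrained_def by metis
    have "\<bar>f (n + i) t\<bar> \<le> max M (max K H)" if t: "t \<in> {a..q + real n}" for i t
    proof -
      have "f (n + i) t \<le> max K H"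
      proof (cases "t \<le> q")
        case True
        then have "f (n + i) t \<le> hi t" using f(1)[of "n + i"] t unfolding constrained_def by auto
        then show ?thesis using H[of t] t True by auto
      next
        case False
        then have "f (n + i) t < K" using t by (intro K constrained_subset[OF f(1)[of "n + i"]]) auto
        then show ?thesis by simp
      qed
      moreover have "- M \<le> f (n + i) t" using lb[OF t, of i] M(2)[OF t] by linarith
      ultimately show ?thesis by (auto simp: abs_le_iff)
    qed
    then show ?thesis by blast
  qed
  have ex_lim: "\<exists>\<psi>. sol F a (q + real n) \<psi> \<and> (\<forall>t\<in>{a..q + real n}. (\<lambda>i. f i t) \<longlonglongrightarrow> \<psi> t)" for n
  proof -
    obtain B where B: "\<And>i t. t \<in> {a..q + real n} \<Longrightarrow> \<bar>f (n + i) t\<bar> \<le> B" using bd by blast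
    have "sol F a (q + real n) (f (n + i))" for i
      using f(1)[of "n + i"] unfolding constrained_def by (auto intro: sol_subset)
    moreover have "a \<le> q + real n" using aq by simp
    ultimately obtain r \<psi> where r: "strict_mono (r :: nat \<Rightarrow> nat)" "sol F a (q + real n) \<psi>"
        "\<And>t. t \<in> {a..q + real n} \<Longrightarrow> (\<lambda>i. f (n + r i) t) \<longlonglongrightarrow> \<psi> t"
      using sol_limit_fixed[OF F F locally_uniform_const, of a "q + real n" "\<lambda>i. f (n + i)" B] B by blast
    have "(\<lambda>i. f i t) \<longlonglongrightarrow> \<psi> t" if t: "t \<in> {a..q + real n}" for t
    proof -
      \<comment> \<open>By monotonicity the whole sequence converges and not just the subsequence,
        so the limits for different \<open>n\<close> are restrictions of one function.\<close>
      have "incseq (\<lambda>i. f (n + i) t)" using mono[OF t] by (intro incseq_SucI)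
      then obtain l where l: "(\<lambda>i. f (n + i) t) \<longlonglongrightarrow> l"
        using incseq_convergent[of "\<lambda>i. f (n + i) t" B] B[OF t] by (metis abs_le_D1)
      have "(\<lambda>i. f (n + r i) t) \<longlonglongrightarrow> l" using LIMSEQ_subseq_LIMSEQ[OF l r(1)] by (simp add: o_def)
      then have "l = \<psi> t" using LIMSEQ_unique r(3)[OF t] by blast
      then have "(\<lambda>i. f (i + n) t) \<longlonglongrightarrow> \<psi> t" using l by (simp add: add.commute)
      then show ?thesis by (rule LIMSEQ_offset)
    qed
    then show ?thesis using r(2) by blast
  qed
  define g where "g t = lim (\<lambda>i. f i t)" for t
  have g: "sol F a (q + real n) g \<and> (\<forall>t\<in>{a..q + real n}. (\<lambda>i. f i t) \<longlonglongrightarrow> g t)" for n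
  proof -
    obtain \<psi> where \<psi>: "sol F a (q + real n) \<psi>" "\<forall>t\<in>{a..q + real n}. (\<lambda>i. f i t) \<longlonglongrightarrow> \<psi> t"
      using ex_lim by blast
    have "g t = \<psi> t" if "t \<in> {a..q + real n}" for t unfolding g_def using \<psi>(2) that limI by blast
    then show ?thesis using \<psi> sol_cong[of a "q + real n" g \<psi>] by auto
  qed
  have "lo t \<le> g t \<and> g t \<le> hi t" if t: "t \<in> {a..q}" for t
  proof -
    have "(\<lambda>i. f i t) \<longlonglongrightarrow> g t" using g[of 0] t by auto
    moreover have "\<And>i. lo t \<le> f i t \<and> f i t \<le> hi t" using f(1) t unfolding constrained_def by blast
    ultimately show ?thesis using LIMSEQ_le_const LIMSEQ_le_const2 by metis
  qed
  then show ?thesis using g unfolding constrained_def by blast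
qed

lemma global_from_flip: "global_from F a v \<Longrightarrow> global_from (flip F) a (- v)"
  unfolding global_from_def using sol_flip by metis

lemma sol_min:
  assumes "sol F a b \<phi>" "sol F a b \<psi>" shows "sol F a b (\<lambda>t. min (\<phi> t) (\<psi> t))"
  using sol_flip[OF sol_max[OF sol_flip[OF assms(1)] sol_flip[OF assms(2)]]] by (simp add: minus_max_eq_min)

text \<open>The solution may vary with \<open>K\<close>. The common time bound still forces
  crossings: a solution that lives up to \<open>T\<close> is bounded there, so some exploding one
  gets past it.\<close>

definition explodes_by :: "(real \<times> real \<Rightarrow> real) \<Rightarrow> real \<Rightarrow> real \<Rightarrow> real \<Rightarrow> bool" where
  "explodes_by F a v T \<longleftrightarrow> (\<forall>K::nat. \<exists>s \<phi>. a \<le> s \<and> s \<le> T \<and> sol F a s \<phi> \<and> \<phi> a = v \<and> real K \<le> \<phi> s)"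

definition explodes :: "(real \<times> real \<Rightarrow> real) \<Rightarrow> real \<Rightarrow> real \<Rightarrow> bool" where
  "explodes F a v \<longleftrightarrow> (\<exists>T. explodes_by F a v T)"

definition reachable :: "(real \<times> real \<Rightarrow> real) \<Rightarrow> real \<Rightarrow> real \<Rightarrow> bool" where
  "reachable F q v \<longleftrightarrow> (\<exists>\<psi>. sol F 0 q \<psi> \<and> \<psi> 0 = 0 \<and> \<psi> q = v)"

lemma reachable_flip: "reachable F q v \<Longrightarrow> reachable (flip F) q (- v)"
  unfolding reachable_def using sol_flip by (metis minus_zero)

text \<open>The family with \<open>q = a\<close> and both bounds equal to \<open>v\<close> consists
  of the solutions through a single point, so \<open>family_global\<close> applies.\<close>

lemma alive_global_from:
  assumes F: "continuous_on UNIV F" and alive: "\<And>n::nat. \<exists>\<phi>. sol F a (a + n) \<phi> \<and> \<phi> a = v" and no: "\<not> explodes F a v"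
  shows "global_from F a v"
proof -
  have eqF: "constrained F a a (\<lambda>_. v) (\<lambda>_. v) s \<phi> \<longleftrightarrow> sol F a s \<phi> \<and> \<phi> a = v" for s \<phi>
    unfolding constrained_def by auto
  have "\<not> family_explodes F a a (\<lambda>_. v) (\<lambda>_. v) J T" for J T
  proof
    assume "family_explodes F a a (\<lambda>_. v) (\<lambda>_. v) J T"
    then have "explodes_by F a v (a + T)" unfolding family_explodes_def explodes_by_def eqF by metis
    then show False using no unfolding explodes_def by blast
  qed
  then have "\<exists>\<phi>. \<forall>n::nat. constrained F a a (\<lambda>_. v) (\<lambda>_. v) (a + n) \<phi>"
    using alive by (intro family_global[OF F order_refl, where H = v]) (auto simp: eqF)
  then show ?thesis unfolding eqF global_from_def by blast
qed

lemma alive_global_from_flip: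
  assumes F: "continuous_on UNIV F" and alive: "\<And>n::nat. \<exists>\<phi>. sol F a (a + n) \<phi> \<and> \<phi> a = v"
    and no: "\<not> explodes (flip F) a (- v)"
  shows "global_from F a v"
proof -
  have "global_from (flip F) a (- v)"
  proof (rule alive_global_from[OF continuous_flip[OF F] _ no])
    fix n :: nat
    obtain \<phi> where "sol F a (a + n) \<phi>" "\<phi> a = v" using alive by blast
    then show "\<exists>\<phi>. sol (flip F) a (a + n) \<phi> \<and> \<phi> a = - v"
      by (intro exI[of _ "\<lambda>t. - \<phi> t"]) (simp add: sol_flip)
  qed
  from global_from_flip[OF this] show ?thesis by simp
qed

text \<open>If all solutions from \<open>v\<close> are dead by time \<open>a + n\<close>, then for
  every large \<open>J\<close> one of them reaches \<open>J\<close> or \<open>- J\<close> before.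
  Without explosions both heights are out of reach for some \<open>J\<close>.\<close>

lemma explosion_trichotomy:
  assumes F: "continuous_on UNIV F"
  shows "global_from F a v \<or> explodes F a v \<or> explodes (flip F) a (- v)"
proof (rule ccontr)
  assume neg: "\<not> ?thesis"
  then obtain n :: nat where dead: "\<And>\<phi>. sol F a (a + n) \<phi> \<Longrightarrow> \<phi> a \<noteq> v" using alive_global_from[OF F] by blast
  have box: "\<exists>s \<phi>. a \<le> s \<and> s \<le> a + n \<and> sol F a s \<phi> \<and> \<phi> a = v \<and> (\<phi> s = real J \<or> \<phi> s = - real J)"
    if vJ: "\<bar>v\<bar> \<le> real J" for J :: nat
  proof -
    have "a \<le> a + real n" by simp
    then obtain s \<phi> where s: "a \<le> s" "s \<le> a + n" "sol F a s \<phi>" "\<phi> a = v" "s = a + n \<or> \<bar>\<phi> s\<bar> = J"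
      using sol_extend_box[OF F _ vJ] by metis
    then have "\<bar>\<phi> s\<bar> = J" using dead by blast
    then show ?thesis using s by (metis abs_if minus_minus)
  qed
  have "\<not> explodes_by F a v (a + n)" "\<not> explodes_by (flip F) a (- v) (a + n)" using neg unfolding explodes_def by blast+
  then obtain K1 K2 :: nat where K1: "\<And>s \<phi>. \<lbrakk>a \<le> s; s \<le> a + n; sol F a s \<phi>; \<phi> a = v\<rbrakk> \<Longrightarrow> \<not> real K1 \<le> \<phi> s"
    and K2: "\<And>s \<phi>. \<lbrakk>a \<le> s; s \<le> a + n; sol (flip F) a s \<phi>; \<phi> a = - v\<rbrakk> \<Longrightarrow> \<not> real K2 \<le> \<phi> s"
    unfolding explodes_by_def by blast
  define J where "J = max (nat \<lceil>\<bar>v\<bar>\<rceil>) (max K1 K2)"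
  have "\<bar>v\<bar> \<le> real J" unfolding J_def by linarith
  then obtain s \<phi> where s: "a \<le> s" "s \<le> a + n" "sol F a s \<phi>" "\<phi> a = v" "\<phi> s = real J \<or> \<phi> s = - real J"
    using box by blast
  have "real K1 \<le> real J" "real K2 \<le> real J" unfolding J_def by auto
  then show False
    using s(5) K1[OF s(1-4)] K2[OF s(1,2) sol_flip[OF s(3)]] s(4) by auto
qed

text \<open>Started above \<open>\<psi>\<close>, a solution stays above it until it leaves through a
  ceiling; with the ceiling at least \<open>K\<close> it reaches \<open>K\<close> either
  way.\<close>

lemma sol_push:
  assumes F: "continuous_on UNIV F" and as: "a \<le> s" and \<psi>: "sol F a s \<psi>" and w: "\<psi> a \<le> w" and K: "K \<le> \<psi> s"
  shows "\<exists>s' \<phi>. a \<le> s' \<and> s' \<le> s \<and> sol F a s' \<phi> \<and> \<phi> a = w \<and> K \<le> \<phi> s'"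
proof -
  obtain M where M: "\<And>t. t \<in> {a..s} \<Longrightarrow> \<bar>\<psi> t\<bar> \<le> M" using interval_bound[OF sol_continuous[OF \<psi>]] by blast
  have "\<psi> t \<le> max K (max M w)" if "t \<in> {a..s}" for t using M[OF that] by linarith
  then obtain s' \<phi> where s': "a \<le> s'" "s' \<le> s" "sol F a s' \<phi>" "\<phi> a = w"
    "\<And>t. t \<in> {a..s'} \<Longrightarrow> \<psi> t \<le> \<phi> t \<and> \<phi> t \<le> max K (max M w)" "s' = s \<or> \<phi> s' = max K (max M w)"
    using sol_extend_above[OF F as \<psi> _ w] by (metis max.cobounded2 max.coboundedI2)
  have "K \<le> \<phi> s'" using s'(5)[of s'] s'(1,6) K by auto
  then show ?thesis using s' by blast
qed

lemma explodes_mono: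
  assumes F: "continuous_on UNIV F" and "explodes F a v" "v \<le> w"
  shows "explodes F a w"
proof -
  obtain T where T: "explodes_by F a v T" using assms unfolding explodes_def by blast
  have "explodes_by F a w T"
    unfolding explodes_by_def
  proof
    fix K :: nat
    obtain s \<psi> where s: "a \<le> s" "s \<le> T" "sol F a s \<psi>" "\<psi> a = v" "real K \<le> \<psi> s"
      using T unfolding explodes_by_def by blast
    obtain s' \<phi> where s': "a \<le> s'" "s' \<le> s" "sol F a s' \<phi>" "\<phi> a = w" "real K \<le> \<phi> s'"
      using sol_push[OF F s(1,3) _ s(5)] s(4) assms(3) by blast
    then show "\<exists>s \<phi>. a \<le> s \<and> s \<le> T \<and> sol F a s \<phi> \<and> \<phi> a = w \<and> real K \<le> \<phi> s"
      using s(2) by (intro exI[of _ s'] exI[of _ \<phi>]) auto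
  qed
  then show ?thesis unfolding explodes_def by blast
qed

lemma explodes_back:
  assumes "sol F q t \<psi>" "q \<le> t" "explodes F t (\<psi> t)"
  shows "explodes F q (\<psi> q)"
proof -
  obtain T where T: "explodes_by F t (\<psi> t) T" using assms unfolding explodes_def by blast
  have "explodes_by F q (\<psi> q) T"
    unfolding explodes_by_def
  proof
    fix K :: nat
    obtain s \<phi> where s: "t \<le> s" "s \<le> T" "sol F t s \<phi>" "\<phi> t = \<psi> t" "real K \<le> \<phi> s"
      using T unfolding explodes_by_def by blast
    let ?g = "\<lambda>x. if x \<le> t then \<psi> x else \<phi> x"
    have "sol F q s ?g" by (rule sol_glue[OF assms(1) s(3) assms(2)]) (use s in auto)
    moreover have "real K \<le> ?g s" using s by auto
    ultimately show "\<exists>s \<phi>. q \<le> s \<and> s \<le> T \<and> sol F q s \<phi> \<and> \<phi> q = \<psi> q \<and> real K \<le> \<phi> s"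
      using s(1,2) assms(2) by (intro exI[of _ s] exI[of _ ?g]) auto
  qed
  then show ?thesis unfolding explodes_def by blast
qed

text \<open>Solutions from \<open>v\<close> climb to any bound of \<open>\<psi>\<close> before time
  \<open>T\<close>, so one of them meets \<open>\<psi>\<close> by the intermediate value theorem and
  can continue along it. Explosion thus becomes a means of survival.\<close>

lemma cross_follow:
  assumes up: "explodes_by F t0 v T" and \<psi>: "sol F t0 t1 \<psi>" "T \<le> t1" "v \<le> \<psi> t0"
  obtains \<phi> where "sol F t0 t1 \<phi>" "\<phi> t0 = v" "\<phi> t1 = \<psi> t1"
proof -
  obtain M where M: "M \<ge> 0" "\<And>t. t \<in> {t0..t1} \<Longrightarrow> \<bar>\<psi> t\<bar> \<le> M" using interval_bound[OF sol_continuous[OF \<psi>(1)]] by blast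
  obtain K :: nat where "M \<le> real K" using real_arch_simple by blast
  moreover obtain s \<xi> where s: "t0 \<le> s" "s \<le> T" "sol F t0 s \<xi>" "\<xi> t0 = v" "real K \<le> \<xi> s"
    using up unfolding explodes_by_def by blast
  ultimately have "\<psi> s - \<xi> s \<le> 0" using M(2)[of s] \<psi>(2) by auto
  moreover have "0 \<le> \<psi> t0 - \<xi> t0" using \<psi>(3) s(4) by simp
  moreover have "continuous_on {t0..s} (\<lambda>t. \<psi> t - \<xi> t)"
    using sol_continuous[OF s(3)] sol_continuous[OF sol_subset[OF \<psi>(1)], of t0 s] s \<psi>(2)
    by (intro continuous_on_diff) auto
  ultimately obtain c where c: "t0 \<le> c" "c \<le> s" "\<psi> c - \<xi> c = 0"
    using IVT2'[of "\<lambda>t. \<psi> t - \<xi> t" s 0 t0] s(1) by blast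
  have "sol F t0 t1 (\<lambda>t. if t \<le> c then \<xi> t else \<psi> t)"
    by (rule sol_glue) (use c s \<psi> in \<open>auto intro: sol_subset\<close>)
  then show ?thesis
  proof (rule that)
    have "t1 = c" if "t1 \<le> c" using that c(2) s(2) \<psi>(2) by linarith
    then show "(if t1 \<le> c then \<xi> t1 else \<psi> t1) = \<psi> t1" using c(3) by auto
  qed (use c(1) s(4) in auto)
qed

lemma cross_follow_flip:
  assumes up: "explodes_by (flip F) t0 (- v) T" and \<psi>: "sol F t0 t1 \<psi>" "T \<le> t1" "\<psi> t0 \<le> v"
  obtains \<phi> where "sol F t0 t1 \<phi>" "\<phi> t0 = v" "\<phi> t1 = \<psi> t1"
proof -
  obtain \<phi> where "sol (flip F) t0 t1 \<phi>" "\<phi> t0 = - v" "\<phi> t1 = - \<psi> t1"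
    using cross_follow[OF up sol_flip[OF \<psi>(1)] \<psi>(2)] \<psi>(3) by auto
  then show ?thesis using that[of "\<lambda>t. - \<phi> t"] sol_flip[of "flip F" t0 t1 \<phi>] by auto
qed

lemma reachable_global_from:
  assumes "0 \<le> q" "reachable F q v" "global_from F q v" shows "global_from F 0 0"
proof -
  obtain \<psi> where \<psi>: "sol F 0 q \<psi>" "\<psi> 0 = 0" "\<psi> q = v" using assms unfolding reachable_def by blast
  obtain \<phi> where \<phi>: "\<phi> q = v" "\<And>n::nat. sol F q (q + n) \<phi>" using assms unfolding global_from_def by blast
  have "sol F 0 (0 + real n) (\<lambda>t. if t \<le> q then \<psi> t else \<phi> t)" for n :: nat
  proof -
    have "sol F 0 (q + n) (\<lambda>t. if t \<le> q then \<psi> t else \<phi> t)"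
      by (rule sol_glue[OF \<psi>(1) \<phi>(2)]) (use assms \<psi> \<phi> in auto)
    then show ?thesis by (rule sol_subset) (use assms in auto)
  qed
  then show ?thesis unfolding global_from_def using \<psi>(2) assms(1)
    by (intro exI[of _ "\<lambda>t. if t \<le> q then \<psi> t else \<phi> t"]) auto
qed

text \<open>The one-dimensional case of Kneser's theorem: the minimum and the maximum of the two
  solutions enclose a strip, and a solution followed backwards inside it ends at the common initial
  value.\<close>

lemma reachable_convex:
  assumes F: "continuous_on UNIV F" and q: "0 \<le> q" and "reachable F q u" "reachable F q w" "u \<le> v" "v \<le> w"
  shows "reachable F q v"
proof -
  obtain \<psi>1 \<psi>2 where \<psi>: "sol F 0 q \<psi>1" "\<psi>1 0 = 0" "\<psi>1 q = u" "sol F 0 q \<psi>2" "\<psi>2 0 = 0" "\<psi>2 q = w"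
    using assms unfolding reachable_def by blast
  obtain \<phi> where \<phi>: "sol F 0 q \<phi>" "\<phi> q = v"
    "\<And>t. t \<in> {0..q} \<Longrightarrow> min (\<psi>1 t) (\<psi>2 t) \<le> \<phi> t \<and> \<phi> t \<le> max (\<psi>1 t) (\<psi>2 t)"
    by (rule sol_between_end[OF F q sol_min[OF \<psi>(1,4)] sol_max[OF \<psi>(1,4)], of v])
      (use \<psi> assms(5,6) in auto)
  have "\<phi> 0 = 0" using \<phi>(3)[of 0] \<psi>(2,5) q by auto
  then show ?thesis using \<phi> unfolding reachable_def by blast
qed

text \<open>The value \<open>0\<close> at time \<open>0\<close> encodes the initial condition.\<close>

definition lower0 :: "nat \<Rightarrow> real \<Rightarrow> real" where "lower0 L t = (if t = 0 then 0 else - real L)"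
definition upper0 :: "nat \<Rightarrow> real \<Rightarrow> real" where "upper0 L t = (if t = 0 then 0 else real L)"

definition explosive_after :: "(real \<times> real \<Rightarrow> real) \<Rightarrow> nat \<Rightarrow> bool" where
  "explosive_after F q \<longleftrightarrow> (\<exists>L J T. family_explodes F 0 q (lower0 L) (upper0 L) J T)"

lemma constrained_zero: "constrained F 0 (real q) (lower0 L) (upper0 L) s \<phi> \<Longrightarrow> \<phi> 0 = 0"
  unfolding constrained_def lower0_def upper0_def by force

text \<open>The bound \<open>L\<close> makes the members compact up to time \<open>q\<close>, so the
  supremum \<open>u\<close> of their values at \<open>q\<close> is attained. Whatever height is
  reached from a value below \<open>u\<close> is also reached from \<open>u\<close>, by
  pushing.\<close>

lemma explosive_after_reachable:
  assumes F: "continuous_on UNIV F" and V: "explosive_after F q"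
  shows "\<exists>v. reachable F q v \<and> explodes F q v"
proof -
  obtain L J T where U: "family_explodes F 0 q (lower0 L) (upper0 L) J T" using V unfolding explosive_after_def by blast
  define S where "S = {\<phi> (real q) | \<phi>. constrained F 0 q (lower0 L) (upper0 L) q \<phi>}"
  have hiL: "upper0 L t \<le> L" "- real L \<le> lower0 L t" for t unfolding upper0_def lower0_def by auto
  have Sne: "S \<noteq> {}"
  proof -
    obtain s \<phi> where "real q \<le> s" "constrained F 0 q (lower0 L) (upper0 L) s \<phi>" using U unfolding family_explodes_def by blast
    then show ?thesis using constrained_subset unfolding S_def by blast
  qed
  have Fb: "\<bar>\<phi> t\<bar> \<le> L" if "constrained F 0 q (lower0 L) (upper0 L) q \<phi>" "t \<in> {0..real q}" for \<phi> t
    using that hiL[of t] unfolding constrained_def abs_le_iff by fastforce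
  have Sb: "bdd_above S" unfolding S_def by (rule bdd_aboveI[of _ "real L"]) (use Fb in \<open>force simp: abs_le_iff\<close>)
  define u where "u = Sup S"
  have "\<exists>\<phi>. constrained F 0 q (lower0 L) (upper0 L) q \<phi> \<and> u - inverse (real (Suc i)) < \<phi> q" for i
  proof -
    have "u - inverse (real (Suc i)) < Sup S" unfolding u_def by simp
    then obtain x where "x \<in> S" "u - inverse (real (Suc i)) < x" using less_cSup_iff[OF Sne Sb] by blast
    then show ?thesis unfolding S_def by blast
  qed
  then obtain f where f: "\<And>i. constrained F 0 q (lower0 L) (upper0 L) q (f i)" "\<And>i. u - inverse (real (Suc i)) < f i q" by metis
  have fle: "f i q \<le> u" for i unfolding u_def by (rule cSup_upper[OF _ Sb]) (use f(1) in \<open>auto simp: S_def\<close>)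
  have flim: "(\<lambda>i. f i q) \<longlonglongrightarrow> u"
  proof (rule tendsto_sandwich[of "\<lambda>i. u - inverse (real (Suc i))" _ _ "\<lambda>_. u"])
    show "(\<lambda>i. u - inverse (real (Suc i))) \<longlonglongrightarrow> u"
      using tendsto_diff[OF tendsto_const LIMSEQ_inverse_real_of_nat, of u] by simp
  qed (use f(2) fle in \<open>auto intro!: always_eventually simp: less_imp_le\<close>)
  have "sol F 0 q (f i)" for i using f(1) unfolding constrained_def by blast
  then obtain r \<psi> where r: "strict_mono (r :: nat \<Rightarrow> nat)" "sol F 0 q \<psi>"
      "\<And>t. t \<in> {0..real q} \<Longrightarrow> (\<lambda>i. f (r i) t) \<longlonglongrightarrow> \<psi> t"
    using sol_limit_fixed[OF F F locally_uniform_const, of 0 "real q" f "real L"] Fb[OF f(1)] by auto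
  have "\<psi> 0 = 0" using r(3)[of 0] constrained_zero[OF f(1)] by (simp add: LIMSEQ_const_iff)
  moreover have "\<psi> q = u"
    using r(3)[of "real q"] LIMSEQ_subseq_LIMSEQ[OF flim r(1)] LIMSEQ_unique unfolding o_def by force
  ultimately have reachable: "reachable F q u" using r(2) unfolding reachable_def by blast
  have "explodes_by F q u (real q + real T)"
    unfolding explodes_by_def
  proof
    fix K :: nat
    obtain s \<psi> where s: "real q \<le> s" "s \<le> real q + real T" "constrained F 0 q (lower0 L) (upper0 L) s \<psi>" "real K \<le> \<psi> s"
      using U unfolding family_explodes_def by blast
    have "\<psi> q \<le> u" unfolding u_def
      by (rule cSup_upper[OF _ Sb]) (use constrained_subset[OF s(3,1)] in \<open>auto simp: S_def\<close>)
    have solq: "sol F q s \<psi>" using s(3) unfolding constrained_def by (auto intro: sol_subset)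
    obtain s' \<phi> where s': "real q \<le> s'" "s' \<le> s" "sol F q s' \<phi>" "\<phi> q = u" "real K \<le> \<phi> s'"
      using sol_push[OF F s(1) solq \<open>\<psi> q \<le> u\<close> s(4)] by blast
    then show "\<exists>s \<phi>. real q \<le> s \<and> s \<le> real q + real T \<and> sol F q s \<phi> \<and> \<phi> q = u \<and> real K \<le> \<phi> s"
      using s' s(2) by (intro exI[of _ s'] exI[of _ \<phi>]) auto
  qed
  then show ?thesis using reachable unfolding explodes_def by blast
qed

text \<open>All solutions from \<open>w\<close> are dead by time \<open>q + n\<close>, while those
  that climb to great heights do so before \<open>T\<close>. Take a reachable point beyond both
  times from which solutions explode upwards. The solution leading to it passes time
  \<open>q\<close> at \<open>w\<close> or above, by minimality. An exploding solution from
  \<open>w\<close> crosses it and, continuing along it, outlives \<open>q + n\<close>.\<close>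

lemma lowest_up_impossible:
  assumes F: "continuous_on UNIV F" and w: "explodes F (real q) w" "\<not> explodes (flip F) q (- w)" "\<not> global_from F q w"
    and least: "\<And>v. reachable F q v \<Longrightarrow> explodes F q v \<Longrightarrow> w \<le> v" and V: "\<And>q. explosive_after F q"
  shows False
proof -
  obtain n :: nat where dead: "\<And>\<phi>. sol F q (real q + real n) \<phi> \<Longrightarrow> \<phi> q \<noteq> w"
    using alive_global_from_flip[OF F _ w(2)] w(3) by blast
  obtain T where T: "explodes_by F q w T" using w(1) unfolding explodes_def by blast
  define t1 where "t1 = max (nat \<lceil>T\<rceil>) (q + n)"
  have t1: "T \<le> real t1" "real q + real n \<le> real t1" unfolding t1_def by linarith+
  obtain z where z: "reachable F t1 z" "explodes F t1 z" using explosive_after_reachable[OF F V] by blast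
  then obtain \<psi> where \<psi>: "sol F 0 t1 \<psi>" "\<psi> 0 = 0" "\<psi> t1 = z" unfolding reachable_def by blast
  have sq: "sol F q t1 \<psi>" using \<psi>(1) by (rule sol_subset) auto
  have "explodes F q (\<psi> q)" using explodes_back[OF sq] t1 z(2) \<psi>(3) by simp
  moreover have "reachable F q (\<psi> q)" unfolding reachable_def using \<psi> t1 by (intro exI[of _ \<psi>]) (auto intro: sol_subset)
  ultimately have "w \<le> \<psi> q" using least by blast
  then obtain \<phi> where "sol F q t1 \<phi>" "\<phi> q = w" using cross_follow[OF T sq t1(1)] by blast
  then show False using dead[of \<phi>] t1(2) sol_subset[of F q t1 \<phi> q "real q + real n"] by auto
qed

text \<open>If points from which solutions explode in both directions are reachable at arbitrarily late times,
  then solutions that are still alive at a later time must cross an exploding one, and a global solution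
  is pasted together from such points. Otherwise consider, at a late time, the supremum of the reachable
  values from which a solution explodes downwards. Solutions through it explode in one direction only, so
  they all do so before some time \<open>t1\<close>. But past \<open>t1\<close> there are still solutions that will explode
  upwards and ones that will explode downwards.\<close>

lemma both_explosions_global_from:
  assumes F: "continuous_on UNIV F" and V: "\<And>q. explosive_after F q" "\<And>q. explosive_after (flip F) q"
  shows "global_from F 0 0"
proof (rule ccontr)
  assume ng: "\<not> global_from F 0 0"
  define Inv where "Inv t v \<longleftrightarrow> 0 \<le> t \<and> reachable F t v \<and> explodes F t v \<and> explodes (flip F) t (- v)" for t v
  have Ff: "continuous_on UNIV (flip F)" using continuous_flip[OF F] .
  have "\<exists>N::nat. \<forall>t v. real N \<le> t \<longrightarrow> \<not> Inv t v"
  proof (rule ccontr)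
    assume "\<not> ?thesis"
    then have late: "\<And>N::nat. \<exists>t v. real N \<le> t \<and> Inv t v" by blast
    obtain t v where tv: "Inv t v" using late by blast
    have "global_from F t v"
    proof (rule global_from_chain[of Inv, OF tv])
      fix t v assume i: "Inv t v"
      then obtain T1 T2 where T: "explodes_by F t v T1" "explodes_by (flip F) t (- v) T2" unfolding Inv_def explodes_def by blast
      define N where "N = nat \<lceil>max (t + 1) (max T1 T2)\<rceil>"
      have "max (t + 1) (max T1 T2) \<le> real N" unfolding N_def by linarith
      then have N: "t + 1 \<le> real N" "T1 \<le> real N" "T2 \<le> real N" by auto
      obtain t' v' where t': "real N \<le> t'" "Inv t' v'" using late by blast
      then obtain \<psi> where \<psi>: "sol F 0 t' \<psi>" "\<psi> t' = v'" unfolding Inv_def reachable_def by blast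
      have s: "sol F t t' \<psi>" using \<psi>(1) by (rule sol_subset) (use i in \<open>auto simp: Inv_def\<close>)
      \<comment> \<open>The solution that arrives at \<open>v'\<close> passes time \<open>t\<close>
        above or below \<open>v\<close>; an explosion from \<open>v\<close> in that direction
        crosses it.\<close>
      have "\<exists>\<phi>. sol F t t' \<phi> \<and> \<phi> t = v \<and> \<phi> t' = \<psi> t'"
      proof (cases "v \<le> \<psi> t")
        case True
        show ?thesis by (rule cross_follow[OF T(1) s _ True]) (use t' N in auto)
      next
        case False
        show ?thesis by (rule cross_follow_flip[OF T(2) s]) (use t' N False in auto)
      qed
      then show "\<exists>t' \<phi>. t + 1 \<le> t' \<and> sol F t t' \<phi> \<and> \<phi> t = v \<and> Inv t' (\<phi> t')"
        using t' N \<psi>(2) by (metis order_trans)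
    qed
    then show False using reachable_global_from[of t F v] tv ng unfolding Inv_def by blast
  qed
  then obtain q :: nat where q: "\<And>t v. real q \<le> t \<Longrightarrow> \<not> Inv t v" by blast
  have ngq: "\<not> global_from F q v" if "reachable F q v" for v using reachable_global_from[of q F v] that ng by auto
  have either: "explodes F q v \<or> explodes (flip F) q (- v)" if "reachable F q v" for v
    using explosion_trichotomy[OF F, of q v] ngq[OF that] by blast
  have not_both: "\<not> (explodes F q v \<and> explodes (flip F) q (- v))" if "reachable F q v" for v
    using q[of q v] that unfolding Inv_def by simp
  define A where "A = {v. reachable F q v \<and> explodes (flip F) q (- v)}"
  obtain b where b: "reachable F q b" "explodes F q b" using explosive_after_reachable[OF F V(1)] by blast
  obtain a where a: "a \<in> A"
  proof -
    obtain v where "reachable (flip F) q v" "explodes (flip F) q v" using explosive_after_reachable[OF Ff V(2)] by blast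
    then show ?thesis using that[of "- v"] reachable_flip[of "flip F" q v] unfolding A_def by simp
  qed
  \<comment> \<open>Otherwise the upward explosion from \<open>y\<close> could be pushed up to
    \<open>x\<close>, which would then explode in both directions.\<close>
  have sep: "x < y" if "x \<in> A" "reachable F q y" "explodes F q y" for x y
  proof (rule ccontr)
    assume "\<not> x < y"
    then have "explodes F q x" using explodes_mono[OF F that(3)] by simp
    then show False using that(1) not_both unfolding A_def by blast
  qed
  define w where "w = Sup A"
  have bdd: "bdd_above A" using sep[OF _ b] by (intro bdd_aboveI[of _ b]) (simp add: less_imp_le)
  have aw: "x \<le> w" if "x \<in> A" for x unfolding w_def using that bdd by (rule cSup_upper)
  have wb: "w \<le> y" if "reachable F q y" "explodes F q y" for y
    unfolding w_def using a sep[OF _ that] by (intro cSup_least) (auto simp: less_imp_le)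
  have rw: "reachable F q w"
    by (rule reachable_convex[OF F _ _ b(1) aw[OF a] wb[OF b]]) (use a in \<open>auto simp: A_def\<close>)
  show False
  \<comment> \<open>Lying between reachable values, \<open>w\<close> is reachable and so explodes in
    exactly one direction. It is then the lowest value of the upward kind or, after reflection, the
    lowest of the reflected kind.\<close>
  proof (cases "explodes F q w")
    case True
    show False
      using lowest_up_impossible[OF F True _ ngq[OF rw] wb V(1)] not_both[OF rw] True by blast
  next
    case False
    then have dn: "explodes (flip F) q (- w)" using either[OF rw] by blast
    have ngf: "\<not> global_from (flip F) q (- w)" using global_from_flip[of "flip F" q "- w"] ngq[OF rw] by auto
    have least: "- w \<le> v" if "reachable (flip F) q v" "explodes (flip F) q v" for v
      using aw[of "- v"] that reachable_flip[of "flip F" q v] unfolding A_def by simp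
    show False
      by (rule lowest_up_impossible[OF Ff dn _ ngf least V(2)]) (use False in auto)
  qed
qed

text \<open>The bound \<open>K\<close> along the whole interval makes each instance a closed
  condition on \<open>F\<close>; the solutions for different \<open>n\<close> have to share only the
  bound \<open>L\<close> up to time \<open>q\<close>.\<close>

definition calm :: "(real \<times> real \<Rightarrow> real) \<Rightarrow> nat \<Rightarrow> nat \<Rightarrow> bool" where
  "calm F q L \<longleftrightarrow> (\<forall>J T. \<not> family_explodes F 0 q (lower0 L) (upper0 L) J T) \<and>
     (\<forall>n::nat. \<exists>K::nat. \<exists>\<phi>. constrained F 0 q (lower0 L) (upper0 L) (real q + real n) \<phi> \<and>
        (\<forall>t\<in>{0..real q + real n}. \<bar>\<phi> t\<bar> \<le> real K))"

lemma calm_global_from: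
  assumes F: "continuous_on UNIV F" and C: "calm F q L" shows "global_from F 0 0"
proof -
  have "\<exists>\<phi>. \<forall>n::nat. constrained F 0 q (lower0 L) (upper0 L) (real q + real n) \<phi>"
  proof (rule family_global[OF F, where H = "real L"])
    show "\<exists>\<psi>. constrained F 0 q (lower0 L) (upper0 L) (real q + real n) \<psi>" for n :: nat
      using C unfolding calm_def by blast
    show "\<not> family_explodes F 0 q (lower0 L) (upper0 L) J T" for J T using C unfolding calm_def by blast
  qed (auto simp: upper0_def)
  then obtain \<phi> where \<phi>: "\<And>n::nat. constrained F 0 q (lower0 L) (upper0 L) (real q + real n) \<phi>" by blast
  then have "\<phi> 0 = 0" using constrained_zero[of F q L "q + real 0" \<phi>] by blast
  moreover have "sol F 0 (0 + real n) \<phi>" for n :: nat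
    using \<phi>[of n] unfolding constrained_def by (auto intro: sol_subset)
  ultimately show ?thesis unfolding global_from_def by blast
qed

lemma global_from_calm:
  assumes "global_from F 0 0" "\<not> explosive_after F q" shows "\<exists>L. calm F q L"
proof -
  obtain \<phi> where \<phi>: "\<phi> 0 = 0" "\<And>n::nat. sol F 0 n \<phi>" using assms unfolding global_from_def by auto
  have bd: "\<exists>K::nat. \<forall>t\<in>{0..real n}. \<bar>\<phi> t\<bar> \<le> K" for n
  proof -
    obtain M where M: "\<And>t. t \<in> {0..real n} \<Longrightarrow> \<bar>\<phi> t\<bar> \<le> M" using interval_bound[OF sol_continuous[OF \<phi>(2)]] by blast
    obtain K :: nat where "M \<le> K" using real_arch_simple by blast
    then show ?thesis using M order_trans by blast
  qed
  obtain L :: nat where L: "\<forall>t\<in>{0..real q}. \<bar>\<phi> t\<bar> \<le> L" using bd by blast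
  have "calm F q L"
    unfolding calm_def
  proof (intro conjI allI)
    show "\<not> family_explodes F 0 q (lower0 L) (upper0 L) J T" for J T using assms(2) unfolding explosive_after_def by blast
    fix n :: nat
    obtain K :: nat where K: "\<forall>t\<in>{0..real (q + n)}. \<bar>\<phi> t\<bar> \<le> K" using bd by blast
    have "constrained F 0 q (lower0 L) (upper0 L) (real q + real n) \<phi>"
      using \<phi>(2)[of "q + n"] \<phi>(1) L unfolding constrained_def lower0_def upper0_def by (auto simp: abs_le_iff)
    then show "\<exists>K::nat. \<exists>\<phi>. constrained F 0 q (lower0 L) (upper0 L) (real q + real n) \<phi> \<and>
        (\<forall>t\<in>{0..real q + real n}. \<bar>\<phi> t\<bar> \<le> real K)"
      using K unfolding of_nat_add by blast
  qed
  then show ?thesis by blast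
qed

lemma global_from_iff:
  assumes F: "continuous_on UNIV F"
  shows "global_from F 0 0 \<longleftrightarrow> (\<forall>q. explosive_after F q \<and> explosive_after (flip F) q) \<or> (\<exists>q L. calm F q L) \<or> (\<exists>q L. calm (flip F) q L)"
proof
  assume g: "global_from F 0 0"
  show "(\<forall>q. explosive_after F q \<and> explosive_after (flip F) q) \<or> (\<exists>q L. calm F q L) \<or> (\<exists>q L. calm (flip F) q L)"
    using global_from_calm[OF g] global_from_calm[of "flip F"] global_from_flip[OF g] unfolding minus_zero by blast
next
  assume "(\<forall>q. explosive_after F q \<and> explosive_after (flip F) q) \<or> (\<exists>q L. calm F q L) \<or> (\<exists>q L. calm (flip F) q L)"
  then show "global_from F 0 0"
    using both_explosions_global_from[OF F] calm_global_from[OF F] calm_global_from[OF continuous_flip[OF F]] global_from_flip[of "flip F" 0 0]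
    by fastforce
qed

section \<open>The upper bound\<close>

abbreviation (input) "cfields \<equiv> {F :: real \<times> real \<Rightarrow> real. continuous_on UNIV F}"

lemma closedin_alive:
  "closedin C_plane {F \<in> cfields. \<exists>\<phi>. constrained F 0 (real q) (lower0 L) (upper0 L) (real q + real n) \<phi> \<and>
     (\<forall>t\<in>{0..real q + real n}. \<bar>\<phi> t\<bar> \<le> real K)}"
    (is "closedin _ ?S")
proof (rule closedin_C_plane_sequentially)
  fix F G
  assume "\<And>i. F i \<in> ?S" and G: "continuous_on UNIV G"
    and conv: "\<And>K e. compact K \<Longrightarrow> 0 < e \<Longrightarrow> \<forall>\<^sub>F n in sequentially. \<forall>p\<in>K. \<bar>F n p - G p\<bar> < e"
  then have *: "\<forall>i. continuous_on UNIV (F i) \<and> (\<exists>\<phi>. constrained (F i) 0 q (lower0 L) (upper0 L) (real q + real n) \<phi> \<and>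
      (\<forall>t\<in>{0..real q + real n}. \<bar>\<phi> t\<bar> \<le> real K))" by simp
  from * obtain f where f: "\<And>i. constrained (F i) 0 q (lower0 L) (upper0 L) (real q + real n) (f i)"
      "\<And>i t. t \<in> {0..real q + real n} \<Longrightarrow> \<bar>f i t\<bar> \<le> real K" by metis
  have "locally_uniform F G" unfolding locally_uniform_def using conv by blast
  moreover have "sol (F i) 0 (real q + real n) (f i)" for i using f(1) unfolding constrained_def by blast
  ultimately obtain r \<psi> where r: "strict_mono (r :: nat \<Rightarrow> nat)" "sol G 0 (real q + real n) \<psi>"
    "\<And>t. t \<in> {0..real q + real n} \<Longrightarrow> (\<lambda>i. f (r i) t) \<longlonglongrightarrow> \<psi> t"
    using sol_limit_fixed[OF G, of F 0 "real q + real n" f "real K"] * f(2) by auto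
  have "\<bar>\<psi> t\<bar> \<le> real K" if "t \<in> {0..real q + real n}" for t
    by (rule LIMSEQ_le_const2[OF tendsto_rabs[OF r(3)[OF that]]]) (use f(2)[OF that] in blast)
  moreover have "lower0 L t \<le> \<psi> t \<and> \<psi> t \<le> upper0 L t" if "t \<in> {0..real q}" for t
  proof -
    have "lower0 L t \<le> f (r i) t \<and> f (r i) t \<le> upper0 L t" for i using f(1) that unfolding constrained_def by blast
    moreover have "(\<lambda>i. f (r i) t) \<longlonglongrightarrow> \<psi> t" using r(3) that by simp
    ultimately show ?thesis using LIMSEQ_le_const LIMSEQ_le_const2 by metis
  qed
  ultimately show "G \<in> ?S"
    using r(2) G unfolding constrained_def by blast
qed blast

text \<open>An exact end value and bounds along the whole way survive limits and keep the solutions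
  in a compact set; a mere lower bound for the end value would admit unbounded families.\<close>

definition hits :: "(real \<times> real \<Rightarrow> real) \<Rightarrow> nat \<Rightarrow> nat \<Rightarrow> nat \<Rightarrow> nat \<Rightarrow> nat \<Rightarrow> bool" where
  "hits F q L J T K \<longleftrightarrow> (\<exists>s \<phi>. real q \<le> s \<and> s \<le> real q + real T \<and> constrained F 0 q (lower0 L) (upper0 L) s \<phi> \<and>
     (\<forall>t\<in>{0..s}. - real J \<le> \<phi> t \<and> \<phi> t \<le> real K) \<and> \<phi> s = real K)"

lemma closedin_hits: "closedin C_plane {F \<in> cfields. hits F q L J T K}"
    (is "closedin _ ?S")
proof (rule closedin_C_plane_sequentially)
  fix F G
  assume "\<And>i. F i \<in> ?S" and G: "continuous_on UNIV G"
    and conv: "\<And>K e. compact K \<Longrightarrow> 0 < e \<Longrightarrow> \<forall>\<^sub>F n in sequentially. \<forall>p\<in>K. \<bar>F n p - G p\<bar> < e"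
  then have *: "\<forall>i. continuous_on UNIV (F i) \<and> hits (F i) q L J T K" by simp
  from * obtain s f where f: "\<And>i. real q \<le> s i" "\<And>i. s i \<le> real q + real T"
      "\<And>i. constrained (F i) 0 q (lower0 L) (upper0 L) (s i) (f i)"
      "\<And>i t. t \<in> {0..s i} \<Longrightarrow> - real J \<le> f i t \<and> f i t \<le> real K" "\<And>i. f i (s i) = real K"
    unfolding hits_def by metis
  have conv: "locally_uniform F G" unfolding locally_uniform_def using conv by blast
  have sol: "sol (F i) 0 (s i) (f i)" for i using f(3) unfolding constrained_def by blast
  have bd: "\<bar>f i t\<bar> \<le> max (real J) (real K)" if "t \<in> {0..s i}" for i t
    using f(4)[OF that] by (auto simp: abs_le_iff)
  have s0: "0 \<le> s i" for i using f(1)[of i] by (meson of_nat_0_le_iff order_trans)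
  obtain r \<sigma> \<psi> where r: "strict_mono (r :: nat \<Rightarrow> nat)" "0 \<le> \<sigma>" "\<sigma> \<le> real q + real T" "(\<lambda>i. s (r i)) \<longlonglongrightarrow> \<sigma>"
    "sol G 0 \<sigma> \<psi>" "\<And>t. t \<in> {0..\<sigma>} \<Longrightarrow> (\<lambda>i. f (r i) (min t (s (r i)))) \<longlonglongrightarrow> \<psi> t"
    "(\<lambda>i. f (r i) (s (r i))) \<longlonglongrightarrow> \<psi> \<sigma>"
    by (rule sol_limit[OF G _ conv s0 f(2) sol bd]) (use * in auto)
  have q\<sigma>: "real q \<le> \<sigma>" using f(1) by (intro LIMSEQ_le_const[OF r(4)]) auto
  have "lower0 L t \<le> \<psi> t \<and> \<psi> t \<le> upper0 L t" if "t \<in> {0..real q}" for t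
  proof -
    have "min t (s (r i)) = t" for i using that f(1)[of "r i"] by simp
    then have "(\<lambda>i. f (r i) t) \<longlonglongrightarrow> \<psi> t" using r(6)[of t] that q\<sigma> by simp
    moreover have "lower0 L t \<le> f (r i) t \<and> f (r i) t \<le> upper0 L t" for i using f(3) that unfolding constrained_def by blast
    ultimately show ?thesis using LIMSEQ_le_const LIMSEQ_le_const2 by metis
  qed
  moreover have "- real J \<le> \<psi> t \<and> \<psi> t \<le> real K" if "t \<in> {0..\<sigma>}" for t
  proof -
    have "- real J \<le> f (r i) (min t (s (r i))) \<and> f (r i) (min t (s (r i))) \<le> real K" for i
      using that s0 by (intro f(4)) auto
    then show ?thesis using LIMSEQ_le_const[OF r(6)[OF that]] LIMSEQ_le_const2[OF r(6)[OF that]] by metis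
  qed
  moreover have "\<psi> \<sigma> = real K" using r(7) f(5) by (simp add: LIMSEQ_const_iff)
  ultimately have "hits G q L J T K"
    unfolding hits_def using q\<sigma> r(3,5) by (intro exI[of _ \<sigma>] exI[of _ \<psi>]) (auto simp: constrained_def)
  then show "G \<in> ?S" using G by simp
qed blast

text \<open>A solution is stopped at the first time it reaches \<open>K\<close>. For
  \<open>K \<ge> L\<close> the search may start at \<open>q\<close>, since up to then the constraint
  keeps the solution at or below \<open>L\<close>.\<close>

lemma family_explodes_iff_hits:
  "family_explodes F 0 (real q) (lower0 L) (upper0 L) J T \<longleftrightarrow> (\<forall>K\<ge>L. hits F q L J T K)"
proof
  assume U: "family_explodes F 0 (real q) (lower0 L) (upper0 L) J T"
  show "\<forall>K\<ge>L. hits F q L J T K"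
  proof (intro allI impI)
    fix K assume KL: "L \<le> K"
    obtain s \<phi> where s: "real q \<le> s" "s \<le> real q + real T" "constrained F 0 q (lower0 L) (upper0 L) s \<phi>"
      "\<forall>t\<in>{0..s}. - real J \<le> \<phi> t" "real K \<le> \<phi> s" using U unfolding family_explodes_def by blast
    have low: "\<phi> t \<le> real K" if "t \<in> {0..real q}" for t
    proof -
      have "\<phi> t \<le> upper0 L t" using s(3) that unfolding constrained_def by blast
      also have "\<dots> \<le> real K" using KL by (simp add: upper0_def)
      finally show ?thesis .
    qed
    have "sol F q s \<phi>" using s(3) unfolding constrained_def by (auto intro: sol_subset)
    then have "continuous_on {real q..s} \<phi>" by (rule sol_continuous)
    then obtain s' where s': "real q \<le> s'" "s' \<le> s" "\<And>t. t \<in> {real q..s'} \<Longrightarrow> \<phi> t \<le> real K" "s' = s \<or> \<phi> s' = real K"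
      by (rule first_hit[OF _ s(1)]) (use low[of "real q"] in auto)
    have "\<phi> s' = real K" using s'(1) s'(3)[of s'] s'(4) s(5) by auto
    moreover have "\<forall>t\<in>{0..s'}. - real J \<le> \<phi> t \<and> \<phi> t \<le> real K"
      using s'(2,3) s(4) low by (metis atLeastAtMost_iff linear order_trans)
    ultimately show "hits F q L J T K"
      unfolding hits_def using s s' constrained_subset[OF s(3) s'(2)] by (intro exI[of _ s'] exI[of _ \<phi>]) auto
  qed
next
  assume H: "\<forall>K\<ge>L. hits F q L J T K"
  show "family_explodes F 0 (real q) (lower0 L) (upper0 L) J T"
    unfolding family_explodes_def
  proof
    fix K :: nat
    have "hits F q L J T (max K L)" using H by simp
    then obtain s \<phi> where s: "real q \<le> s" "s \<le> real q + real T" "constrained F 0 q (lower0 L) (upper0 L) s \<phi>"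
      "\<forall>t\<in>{0..s}. - real J \<le> \<phi> t \<and> \<phi> t \<le> real (max K L)" "\<phi> s = real (max K L)"
      unfolding hits_def by blast
    then show "\<exists>s \<phi>. real q \<le> s \<and> s \<le> real q + real T \<and> constrained F 0 (real q) (lower0 L) (upper0 L) s \<phi> \<and>
        (\<forall>t\<in>{0..s}. - real J \<le> \<phi> t) \<and> real K \<le> \<phi> s"
      by (intro exI[of _ s] exI[of _ \<phi>]) auto
  qed
qed

lemma closedin_family_explodes: "closedin C_plane {F \<in> cfields. family_explodes F 0 (real q) (lower0 L) (upper0 L) J T}"
proof -
  have "{F \<in> cfields. family_explodes F 0 (real q) (lower0 L) (upper0 L) J T} = (\<Inter>K\<in>{L..}. {F \<in> cfields. hits F q L J T K})"
    unfolding family_explodes_iff_hits by auto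
  also have "closedin C_plane \<dots>" by (intro closedin_INT closedin_hits) auto
  finally show ?thesis .
qed

lemma Sigma0_explosive_after: "Sigma0 C_plane 2 {F \<in> cfields. explosive_after F q}"
proof -
  have "Sigma0 C_plane (Suc 1) (\<Union>L. \<Union>J. \<Union>T. {F \<in> cfields. family_explodes F 0 (real q) (lower0 L) (upper0 L) J T})"
    unfolding One_nat_def
    by (intro Sigma0_UN Sigma0_UN_Pi0 metrizable_C_plane Pi0_1_iff[THEN iffD2] closedin_family_explodes) simp_all
  also have "(\<Union>L. \<Union>J. \<Union>T. {F \<in> cfields. family_explodes F 0 (real q) (lower0 L) (upper0 L) J T}) = {F \<in> cfields. explosive_after F q}"
    unfolding explosive_after_def by blast
  finally show ?thesis by (simp add: numeral_2_eq_2)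
qed

text \<open>The absence of explosions is an intersection of open conditions, and survival up to a
  given time is a union of closed ones over \<open>K\<close>.\<close>

lemma Pi0_calm: "Pi0 C_plane 3 {F \<in> cfields. calm F q L}"
proof -
  note mz = metrizable_C_plane
  let ?A = "\<lambda>J T. {F \<in> cfields. family_explodes F 0 (real q) (lower0 L) (upper0 L) J T}"
  let ?B = "\<lambda>n K. {F \<in> cfields. \<exists>\<phi>. constrained F 0 (real q) (lower0 L) (upper0 L) (real q + real n) \<phi> \<and>
     (\<forall>t\<in>{0..real q + real n}. \<bar>\<phi> t\<bar> \<le> real K)}"
  have "openin C_plane (topspace C_plane - ?A J T)" for J T using closedin_family_explodes by blast
  then have 1: "Pi0 C_plane 3 (topspace C_plane - ?A J T)" for J T
    using Pi0_mono[OF mz Sigma0_imp_Pi0_Suc[OF Sigma0_openin], of _ 3] by simp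
  have B: "Sigma0 C_plane (Suc 1) (\<Union>K. ?B n K)" for n
    unfolding One_nat_def by (intro Sigma0_UN_Pi0 Pi0_1_iff[THEN iffD2] closedin_alive) simp
  have 2: "Pi0 C_plane 3 (\<Union>K. ?B n K)" for n
    using Sigma0_imp_Pi0_Suc[OF B[of n]] by (simp only: numeral_3_eq_3 One_nat_def)
  have "Pi0 C_plane 3 ((\<Inter>J. \<Inter>T. topspace C_plane - ?A J T) \<inter> (\<Inter>n. \<Union>K. ?B n K))"
    by (intro Pi0_Int Pi0_INT mz 1 2) auto
  also have "(\<Inter>J. \<Inter>T. topspace C_plane - ?A J T) \<inter> (\<Inter>n. \<Union>K. ?B n K) = {F \<in> cfields. calm F q L}"
  proof (rule set_eqI)
    fix F
    show "F \<in> (\<Inter>J. \<Inter>T. topspace C_plane - ?A J T) \<inter> (\<Inter>n. \<Union>K. ?B n K) \<longleftrightarrow> F \<in> {F \<in> cfields. calm F q L}"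
      by (cases "continuous_on UNIV F") (simp_all add: calm_def topspace_C_plane)
  qed
  finally show ?thesis .
qed

lemma continuous_map_flip: "continuous_map C_plane C_plane flip"
proof (rule continuous_map_into_C_plane)
  show "continuous_on UNIV (flip F)" if "F \<in> topspace C_plane" for F
    using that continuous_flip by (simp add: topspace_C_plane)
  fix F :: "real \<times> real \<Rightarrow> real" and K :: "(real \<times> real) set" and e :: real
  assume F: "F \<in> topspace C_plane" and K: "compact K" "e > 0"
  then have Fc: "continuous_on UNIV F" by (simp add: topspace_C_plane)
  have cK: "compact ((\<lambda>p. (fst p, - snd p)) ` K)"
    by (intro compact_continuous_image continuous_intros K)
  obtain U where U: "openin C_plane U" "F \<in> U"
    "\<And>G p. G \<in> U \<Longrightarrow> p \<in> (\<lambda>p. (fst p, - snd p)) ` K \<Longrightarrow> \<bar>G p - F p\<bar> < e"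
    by (rule C_plane_nbhd[OF Fc cK K(2)]) blast
  have "\<bar>flip G p - flip F p\<bar> < e" if "G \<in> U" "p \<in> K" for G p
    using U(3)[OF that(1) imageI[OF that(2)]] by (simp add: flip_def case_prod_beta)
  then show "\<exists>U. openin C_plane U \<and> F \<in> U \<and> (\<forall>G\<in>U. \<forall>p\<in>K. \<bar>flip G p - flip F p\<bar> < e)"
    using U(1,2) by blast
qed

lemma Sigma0_global_from: "Sigma0 C_plane 4 {F \<in> cfields. global_from F 0 0}"
proof -
  note mz = metrizable_C_plane
  have flip_set: "{F \<in> topspace C_plane. flip F \<in> {F \<in> cfields. P F}} = {F \<in> cfields. P (flip F)}" for P
    unfolding topspace_C_plane using continuous_flip by blast
  have S2: "Sigma0 C_plane 2 {F \<in> cfields. explosive_after (flip F) q}" for q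
    using Sigma0_vimage[OF Sigma0_explosive_after continuous_map_flip] unfolding flip_set .
  have P3: "Sigma0 C_plane 4 {F \<in> cfields. calm F q L}" for q L
    using Pi0_imp_Sigma0_Suc[OF Pi0_calm] by simp
  have P3': "Sigma0 C_plane 4 {F \<in> cfields. calm (flip F) q L}" for q L
    using Sigma0_vimage[OF P3 continuous_map_flip] unfolding flip_set .
  have "Pi0 C_plane 3 ({F \<in> cfields. explosive_after F q} \<inter> {F \<in> cfields. explosive_after (flip F) q})" for q
    using Sigma0_imp_Pi0_Suc[OF Sigma0_Int[OF mz Sigma0_explosive_after S2]] by (simp add: numeral_3_eq_3 numeral_2_eq_2)
  then have "Pi0 C_plane 3 (\<Inter>q. {F \<in> cfields. explosive_after F q} \<inter> {F \<in> cfields. explosive_after (flip F) q})"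
    by (intro Pi0_INT mz) auto
  then have "Sigma0 C_plane 4 (\<Inter>q. {F \<in> cfields. explosive_after F q} \<inter> {F \<in> cfields. explosive_after (flip F) q})"
    using Pi0_imp_Sigma0_Suc by fastforce
  then have "Sigma0 C_plane 4 ((\<Inter>q. {F \<in> cfields. explosive_after F q} \<inter> {F \<in> cfields. explosive_after (flip F) q}) \<union>
      ((\<Union>q. \<Union>L. {F \<in> cfields. calm F q L}) \<union> (\<Union>q. \<Union>L. {F \<in> cfields. calm (flip F) q L})))"
    by (intro Sigma0_Un Sigma0_UN mz P3 P3') auto
  also have "(\<Inter>q. {F \<in> cfields. explosive_after F q} \<inter> {F \<in> cfields. explosive_after (flip F) q}) \<union>
      ((\<Union>q. \<Union>L. {F \<in> cfields. calm F q L}) \<union> (\<Union>q. \<Union>L. {F \<in> cfields. calm (flip F) q L})) = {F \<in> cfields. global_from F 0 0}"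
  proof (rule set_eqI)
    fix F
    show "F \<in> (\<Inter>q. {F \<in> cfields. explosive_after F q} \<inter> {F \<in> cfields. explosive_after (flip F) q}) \<union>
      ((\<Union>q. \<Union>L. {F \<in> cfields. calm F q L}) \<union> (\<Union>q. \<Union>L. {F \<in> cfields. calm (flip F) q L}))
      \<longleftrightarrow> F \<in> {F \<in> cfields. global_from F 0 0}"
      by (cases "continuous_on UNIV F") (simp_all add: global_from_iff)
  qed
  finally show ?thesis .
qed

section \<open>From the two-sided problem to two forward problems\<close>

lemma sol_shift:
  assumes "sol (\<lambda>(s, z). F (x + s, y + z)) a b \<psi>"
  shows "sol F (x + a) (x + b) (\<lambda>t. y + \<psi> (t - x))"
  unfolding sol_def
proof
  fix t assume t: "t \<in> {x + a..x + b}"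
  have im: "(\<lambda>t. t - x) ` {x + a..x + b} = {a..b}"
    by (auto intro!: image_eqI[of _ _ "_ + x"])
  have "(\<psi> has_real_derivative F (t, y + \<psi> (t - x))) (at (t - x) within (\<lambda>t. t - x) ` {x + a..x + b})"
  proof -
    have "t - x \<in> {a..b}" using t by auto
    from bspec[OF assms[unfolded sol_def] this] show ?thesis unfolding im by simp
  qed
  then have "((\<psi> \<circ> (\<lambda>t. t - x)) has_real_derivative F (t, y + \<psi> (t - x)) * 1) (at t within {x + a..x + b})"
    by (rule DERIV_image_chain) (auto intro!: derivative_eq_intros)
  then have "((\<lambda>t. y + \<psi> (t - x)) has_real_derivative 0 + F (t, y + \<psi> (t - x))) (at t within {x + a..x + b})"
    by (intro DERIV_add DERIV_const) (simp add: o_def)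
  then show "((\<lambda>t. y + \<psi> (t - x)) has_real_derivative F (t, y + \<psi> (t - x))) (at t within {x + a..x + b})"
    by simp
qed

definition ahead :: "(real \<times> real \<Rightarrow> real) \<times> real \<times> real \<Rightarrow> real \<times> real \<Rightarrow> real" where
  "ahead = (\<lambda>(F, x, y) (s, z). F (x + s, y + z))"

definition behind :: "(real \<times> real \<Rightarrow> real) \<times> real \<times> real \<Rightarrow> real \<times> real \<Rightarrow> real" where
  "behind = (\<lambda>(F, x, y) (s, z). - F (x - s, y + z))"

lemma global_solution_iff:
  assumes F: "continuous_on UNIV F"
  shows "(\<exists>\<phi>. global_solution F x y \<phi>) \<longleftrightarrow> global_from (ahead (F, x, y)) 0 0 \<and> global_from (behind (F, x, y)) 0 0"
proof
  assume "\<exists>\<phi>. global_solution F x y \<phi>"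
  then obtain \<phi> where \<phi>: "\<And>t. (\<phi> has_real_derivative F (t, \<phi> t)) (at t)" "\<phi> x = y"
    unfolding global_solution_def by blast
  have "((\<lambda>s. \<phi> (x + s) - y) has_real_derivative F (x + s, \<phi> (x + s)) * (0 + 1) - 0) (at s within S)" for s S
    by (intro DERIV_diff DERIV_const has_field_derivative_at_within[OF DERIV_chain2[OF \<phi>(1)]] DERIV_add DERIV_ident)
  then have "sol (ahead (F, x, y)) 0 (0 + real n) (\<lambda>s. \<phi> (x + s) - y)" for n
    unfolding sol_def ahead_def by simp
  then have 1: "global_from (ahead (F, x, y)) 0 0" unfolding global_from_def using \<phi>(2) by (intro exI[of _ "\<lambda>s. \<phi> (x + s) - y"]) auto
  have "((\<lambda>s. \<phi> (x - s) - y) has_real_derivative F (x - s, \<phi> (x - s)) * (0 - 1) - 0) (at s within S)" for s S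
    by (intro DERIV_diff DERIV_const has_field_derivative_at_within[OF DERIV_chain2[OF \<phi>(1)]] DERIV_ident)
  then have "sol (behind (F, x, y)) 0 (0 + real n) (\<lambda>s. \<phi> (x - s) - y)" for n
    unfolding sol_def behind_def by simp
  then have 2: "global_from (behind (F, x, y)) 0 0" unfolding global_from_def using \<phi>(2) by (intro exI[of _ "\<lambda>s. \<phi> (x - s) - y"]) auto
  show "global_from (ahead (F, x, y)) 0 0 \<and> global_from (behind (F, x, y)) 0 0" using 1 2 by blast
next
  assume "global_from (ahead (F, x, y)) 0 0 \<and> global_from (behind (F, x, y)) 0 0"
  then obtain \<alpha> \<beta> where \<alpha>: "\<alpha> 0 = 0" "\<And>n::nat. sol (ahead (F, x, y)) 0 n \<alpha>"
    and \<beta>: "\<beta> 0 = 0" "\<And>n::nat. sol (behind (F, x, y)) 0 n \<beta>"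
    unfolding global_from_def by auto
  have fwd: "sol F x (x + real n) (\<lambda>t. y + \<alpha> (t - x))" for n :: nat
    using sol_shift[of F x y 0 "real n" \<alpha>] \<alpha>(2)[of n] unfolding ahead_def by simp
  have bwd: "sol F (x - real n) x (\<lambda>t. y + \<beta> (x - t))" for n :: nat
  proof -
    have "sol (\<lambda>(s, z). F (x + s, y + z)) (- real n) 0 (\<lambda>t. \<beta> (- t))"
      using sol_reflect[OF \<beta>(2)[of n]] unfolding behind_def by simp
    from sol_shift[OF this] show ?thesis by simp
  qed
  define \<phi> where "\<phi> t = (if t \<le> x then y + \<beta> (x - t) else y + \<alpha> (t - x))" for t
  have all: "sol F (x - real n) (x + real n) \<phi>" for n
    unfolding \<phi>_def by (rule sol_glue[OF bwd fwd]) (use \<alpha>(1) \<beta>(1) in auto)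
  have der: "(\<phi> has_real_derivative F (t, \<phi> t)) (at t)" for t
  proof -
    obtain n :: nat where n: "\<bar>t - x\<bar> < real n" using reals_Archimedean2 by blast
    then have "t \<in> {x - real n<..<x + real n}" by (auto simp: abs_less_iff)
    then have t: "t \<in> interior {x - real n..x + real n}" by simp
    then have "(\<phi> has_real_derivative F (t, \<phi> t)) (at t within {x - real n..x + real n})"
      using all[of n] interior_subset unfolding sol_def by blast
    then show ?thesis using at_within_interior[OF t] by simp
  qed
  \<comment> \<open>Since \<open>F\<close> is continuous, so is the derivative, and
    differentiability everywhere already gives a \<open>C1\<close> function.\<close>
  have "continuous_on UNIV \<phi>" using der by (auto intro!: DERIV_isCont continuous_at_imp_continuous_on)
  then have "continuous_on UNIV (\<lambda>t. F (t, \<phi> t))" by (rule continuous_on_graph[OF F])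
  moreover have "\<forall>t\<in>UNIV. (\<phi> has_vector_derivative F (t, \<phi> t)) (at t)"
    using der by (simp add: has_real_derivative_iff_has_vector_derivative)
  ultimately have "\<phi> C1_differentiable_on UNIV"
    unfolding C1_differentiable_on_def by (intro exI[of _ "\<lambda>t. F (t, \<phi> t)"] conjI)
  moreover have "\<phi> x = y" unfolding \<phi>_def using \<beta>(1) by simp
  ultimately show "\<exists>\<phi>. global_solution F x y \<phi>" unfolding global_solution_def using der by blast
qed

lemma continuous_map_affine:
  fixes c :: real
  assumes c: "\<bar>c\<bar> = 1"
  shows "continuous_map (prod_topology C_plane euclidean) C_plane (\<lambda>(F, x, y) (s, z). c * F (x + c * s, y + z))"
    (is "continuous_map ?X _ ?f")
proof (rule continuous_map_into_C_plane)
  fix P assume "P \<in> topspace ?X"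
  then obtain F x y where P: "P = (F, x, y)" "continuous_on UNIV F"
    by (cases P) (auto simp: topspace_C_plane)
  show "continuous_on UNIV (?f P)"
    unfolding P(1) case_prod_beta fst_conv snd_conv
    by (intro continuous_intros continuous_on_compose2[OF P(2)]) auto
  fix K :: "(real \<times> real) set" and e :: real
  assume K: "compact K" "e > 0"
  define h where "h = (\<lambda>p :: real \<times> real. (c * fst p, snd p))"
  have hK: "compact (h ` K)" unfolding h_def by (intro compact_continuous_image continuous_intros K)
  \<comment> \<open>This contains all points at which the shifted fields are evaluated for base
    points within distance 1 of \<open>(x, y)\<close>. On it \<open>F\<close> is uniformly
    continuous and \<open>G\<close> is close to \<open>F\<close>.\<close>
  define K' where "K' = {u + v | u v. u \<in> h ` K \<and> v \<in> cball (x, y) 1}"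
  have K': "compact K'" unfolding K'_def by (rule compact_sums[OF hK compact_cball])
  have "uniformly_continuous_on K' F"
    by (rule compact_uniformly_continuous[OF continuous_on_subset[OF P(2)] K']) simp
  then obtain d where d: "d > 0" "\<And>p q. p \<in> K' \<Longrightarrow> q \<in> K' \<Longrightarrow> dist q p < d \<Longrightarrow> dist (F q) (F p) < e / 2"
    unfolding uniformly_continuous_on_def using K(2) by (meson half_gt_zero)
  obtain U where U: "openin C_plane U" "F \<in> U" "\<And>G p. G \<in> U \<Longrightarrow> p \<in> K' \<Longrightarrow> \<bar>G p - F p\<bar> < e / 2"
    using C_plane_nbhd[OF P(2) K' half_gt_zero[OF K(2)]] by metis
  define V where "V = U \<times> ball (x, y) (min d 1)"
  have "openin ?X V" unfolding V_def using U(1) by (simp add: openin_prod_Times_iff)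
  moreover have "P \<in> V" unfolding V_def P(1) using U(2) d(1) by simp
  moreover have "\<bar>?f Q p - ?f P p\<bar> < e" if Q: "Q \<in> V" and p: "p \<in> K" for Q p
  proof -
    obtain G x' y' where G: "Q = (G, x', y')" "G \<in> U" "dist (x, y) (x', y') < min d 1"
      using Q unfolding V_def by (cases Q) auto
    have hp: "h p \<in> h ` K" using p by simp
    have 1: "h p + (x, y) \<in> K'" "h p + (x', y') \<in> K'"
      unfolding K'_def using hp G(3) by (fastforce simp: less_imp_le)+
    have "\<bar>G (h p + (x', y')) - F (h p + (x', y'))\<bar> < e / 2" using U(3)[OF G(2) 1(2)] .
    moreover have "\<bar>F (h p + (x', y')) - F (h p + (x, y))\<bar> < e / 2"
      using d(2)[OF 1] G(3) by (simp add: dist_commute dist_real_def)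
    ultimately have "\<bar>G (h p + (x', y')) - F (h p + (x, y))\<bar> < e" by linarith
    then have "\<bar>c\<bar> * \<bar>G (h p + (x', y')) - F (h p + (x, y))\<bar> < e" using c by simp
    then have "\<bar>c * G (h p + (x', y')) - c * F (h p + (x, y))\<bar> < e"
      unfolding abs_mult[symmetric] right_diff_distrib .
    then show ?thesis unfolding P(1) G(1) h_def by (simp add: case_prod_beta add.commute)
  qed
  ultimately show "\<exists>U. openin ?X U \<and> P \<in> U \<and> (\<forall>Q\<in>U. \<forall>p\<in>K. \<bar>?f Q p - ?f P p\<bar> < e)" by blast
qed

lemma Sigma0_globally_solvable:
  "Sigma0 (prod_topology C_plane (euclidean :: (real \<times> real) topology)) 4 globally_solvable"
    (is "Sigma0 ?X _ _")
proof -
  have mz: "metrizable_space ?X"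
    using Polish_problems completely_metrizable_imp_metrizable_space unfolding Polish_space_def by blast
  have a: "continuous_map ?X C_plane ahead"
    using continuous_map_affine[of 1] unfolding ahead_def by simp
  have b: "continuous_map ?X C_plane behind"
    using continuous_map_affine[of "- 1"] unfolding behind_def by simp
  have "Sigma0 ?X 4 ({p \<in> topspace ?X. ahead p \<in> {F \<in> cfields. global_from F 0 0}} \<inter>
      {p \<in> topspace ?X. behind p \<in> {F \<in> cfields. global_from F 0 0}})"
    by (intro Sigma0_Int mz Sigma0_vimage[OF Sigma0_global_from] a b)
  also have "{p \<in> topspace ?X. ahead p \<in> {F \<in> cfields. global_from F 0 0}} \<inter>
      {p \<in> topspace ?X. behind p \<in> {F \<in> cfields. global_from F 0 0}} = globally_solvable"
  proof -
    have "ahead p \<in> cfields" "behind p \<in> cfields" if "p \<in> topspace ?X" for p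
      using a b that unfolding continuous_map_def topspace_C_plane by blast+
    moreover have "p \<in> globally_solvable \<longleftrightarrow> p \<in> topspace ?X \<and> global_from (ahead p) 0 0 \<and> global_from (behind p) 0 0" for p
      unfolding globally_solvable_def
      by (cases p, cases "continuous_on UNIV (fst p)") (simp_all add: global_solution_iff topspace_C_plane)
    ultimately show ?thesis by blast
  qed
  finally show ?thesis .
qed

section \<open>Hardness\<close>

text \<open>The fields of the reduction. Until time \<open>1\<close>, \<open>fan\<close> lets the solutions leave \<open>0\<close> at any time, so
  that they reach all negative values. Stage \<open>s \<ge> 1\<close> starts at time \<open>s\<close>. In its first half \<open>push\<close> drives every
  solution upwards so fast that it explodes, unless it meets an integer \<open>i\<close> with coefficient \<open>0\<close>, where the
  field vanishes; a positive coefficient, via \<open>spike\<close>, forces solutions to pass \<open>i\<close>. In the second half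
  \<open>fall\<close> brings all survivors, from whatever height, down below \<open>1\<close>.\<close>

definition fan :: "real \<times> real \<Rightarrow> real" where
  "fan = (\<lambda>(t, v). - (max 0 (4 * (1 - t)) * (2 * sqrt \<bar>v\<bar> * (1 + \<bar>v\<bar>))))"

definition push :: "real \<times> real \<Rightarrow> real" where
  "push = (\<lambda>(t, v). 64 * max 0 (sin (2 * pi * max t 1)) * 2 powr (t + v) * sqrt (infdist v \<int>))"

definition fall :: "real \<times> real \<Rightarrow> real" where
  "fall = (\<lambda>(t, v). 4 * max 0 (- sin (2 * pi * max t 1)) * (max 0 v)\<^sup>2)"

definition spike :: "nat \<times> int \<Rightarrow> real \<times> real \<Rightarrow> real" where
  "spike = (\<lambda>(s, i) (t, v). max 0 (1 / 4 - \<bar>t - real s - 1 / 4\<bar>) * max 0 (1 - \<bar>v - real_of_int i\<bar>))"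

text \<open>Only finitely many spikes are nonzero at a point. The index set is restricted to them
  because a sum over an infinite set is 0 by convention.\<close>

definition stage_field :: "(nat \<times> int \<Rightarrow> real) \<Rightarrow> real \<times> real \<Rightarrow> real" where
  "stage_field c p = fan p + push p - fall p + (\<Sum>n | spike n p \<noteq> 0. c n * spike n p)"

section \<open>Continuity of the fields in position and coefficients\<close>

lemma spike_nonzero:
  "spike (s, i) (t, v) \<noteq> 0 \<longleftrightarrow> real s < t \<and> t < real s + 1 / 2 \<and> \<bar>v - real_of_int i\<bar> < 1"
  unfolding spike_def by (auto simp: max_def abs_if split: if_splits)

lemma spike_bounds: "0 \<le> spike n p" "spike n p \<le> 1"
proof -
  obtain s i t v where e: "n = (s, i)" "p = (t, v)" by (cases n, cases p)
  show "0 \<le> spike n p" unfolding e spike_def by simp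
  have "max 0 (1 / 4 - \<bar>t - real s - 1 / 4\<bar>) * max 0 (1 - \<bar>v - real_of_int i\<bar>) \<le> 1 * 1"
    by (intro mult_mono) auto
  then show "spike n p \<le> 1" unfolding e spike_def by simp
qed

definition ibox :: "nat \<Rightarrow> (nat \<times> int) set" where
  "ibox N = {..N} \<times> {- int N - 1..int N + 1}"

lemma finite_ibox: "finite (ibox N)" unfolding ibox_def by simp

lemma spike_support:
  assumes "\<bar>fst p\<bar> \<le> real N" "\<bar>snd p\<bar> \<le> real N" shows "{n. spike n p \<noteq> 0} \<subseteq> ibox N"
proof
  fix n assume n: "n \<in> {n. spike n p \<noteq> 0}"
  obtain s i t v where e: "n = (s, i)" "p = (t, v)" by (cases n, cases p)
  have *: "real s < t" "\<bar>v - real_of_int i\<bar> < 1" using n unfolding e by (auto simp: spike_nonzero)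
  have "real s < real N" "real_of_int i < real N + 1" "- real N - 1 < real_of_int i" using * assms unfolding e by auto
  then show "n \<in> ibox N" unfolding e ibox_def by auto
qed

lemma stage_field_eq:
  assumes "\<bar>fst p\<bar> \<le> real N" "\<bar>snd p\<bar> \<le> real N"
  shows "stage_field c p = fan p + push p - fall p + (\<Sum>n\<in>ibox N. c n * spike n p)"
proof -
  have "(\<Sum>n | spike n p \<noteq> 0. c n * spike n p) = (\<Sum>n\<in>ibox N. c n * spike n p)"
    by (rule sum.mono_neutral_left) (use finite_ibox spike_support[OF assms] in auto)
  then show ?thesis unfolding stage_field_def by simp
qed

lemma continuous_stage_field_parts:
  "continuous_on S fan" "continuous_on S push" "continuous_on S fall" "continuous_on S (spike n)"
proof -
  show "continuous_on S fan" unfolding fan_def case_prod_beta by (intro continuous_intros)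
  show "continuous_on S push" unfolding push_def case_prod_beta
    by (intro continuous_intros) auto
  show "continuous_on S fall" unfolding fall_def case_prod_beta by (intro continuous_intros)
  show "continuous_on S (spike n)" unfolding spike_def case_prod_beta by (intro continuous_intros)
qed

lemma continuous_stage_field: "continuous_on UNIV (stage_field c)"
proof (rule continuous_at_imp_continuous_on, rule ballI)
  fix p :: "real \<times> real"
  obtain N :: nat where N: "max \<bar>fst p\<bar> \<bar>snd p\<bar> < real N" using reals_Archimedean2 by blast
  define S where "S = {p :: real \<times> real. \<bar>fst p\<bar> < real N} \<inter> {p. \<bar>snd p\<bar> < real N}"
  have "open S" unfolding S_def
    by (intro open_Int open_Collect_less continuous_intros)
  moreover have "p \<in> S" using N unfolding S_def by simp
  moreover have "continuous_on S (stage_field c)"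
  proof (subst continuous_on_cong[OF refl, of _ _ "\<lambda>p. fan p + push p - fall p + (\<Sum>n\<in>ibox N. c n * spike n p)"])
    show "stage_field c q = fan q + push q - fall q + (\<Sum>n\<in>ibox N. c n * spike n q)" if "q \<in> S" for q
      by (rule stage_field_eq) (use that in \<open>auto simp: S_def\<close>)
  qed (intro continuous_intros continuous_stage_field_parts)
  ultimately show "isCont (stage_field c) p" by (simp add: continuous_on_eq_continuous_at)
qed

lemma continuous_map_stage_field:
  assumes c: "\<And>n. continuous_map Y euclideanreal (\<lambda>y. c y n)"
  shows "continuous_map Y C_plane (\<lambda>y. stage_field (c y))"
proof (rule continuous_map_into_C_plane)
  show "continuous_on UNIV (stage_field (c y))" for y by (rule continuous_stage_field)
  fix y and K :: "(real \<times> real) set" and e :: real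
  assume y: "y \<in> topspace Y" and K: "compact K" and e: "e > 0"
  obtain R where R: "\<And>p. p \<in> K \<Longrightarrow> norm p \<le> R" using compact_imp_bounded[OF K] bounded_iff by metis
  obtain N :: nat where N: "R \<le> real N" using real_arch_simple by blast
  define h where "h y' = (\<Sum>n\<in>ibox N. \<bar>c y' n - c y n\<bar>)" for y'
  have "continuous_map Y euclideanreal h" unfolding h_def
    by (intro continuous_map_sum finite_ibox continuous_map_real_abs continuous_map_diff c) auto
  then have "openin Y {y' \<in> topspace Y. h y' \<in> {..<e}}" by (intro openin_continuous_map_preimage) auto
  moreover have "y \<in> {y' \<in> topspace Y. h y' \<in> {..<e}}" using y e unfolding h_def by simp
  moreover have "\<bar>stage_field (c y') p - stage_field (c y) p\<bar> < e" if y': "y' \<in> {y' \<in> topspace Y. h y' \<in> {..<e}}" and p: "p \<in> K" for y' p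
  proof -
    have "\<bar>fst p\<bar> \<le> real N" "\<bar>snd p\<bar> \<le> real N"
      using R[OF p] N norm_fst_le[of "fst p" "snd p"] norm_snd_le[of "snd p" "fst p"] by auto
    then have "stage_field (c y') p - stage_field (c y) p = (\<Sum>n\<in>ibox N. (c y' n - c y n) * spike n p)"
      by (simp add: stage_field_eq sum_subtractf left_diff_distrib)
    also have "\<bar>\<dots>\<bar> \<le> (\<Sum>n\<in>ibox N. \<bar>(c y' n - c y n) * spike n p\<bar>)" by (rule sum_abs)
    also have "\<dots> \<le> h y'"
      unfolding h_def
    proof (rule sum_mono)
      fix n
      have "\<bar>c y' n - c y n\<bar> * spike n p \<le> \<bar>c y' n - c y n\<bar> * 1"
        using spike_bounds by (intro mult_left_mono) auto
      then show "\<bar>(c y' n - c y n) * spike n p\<bar> \<le> \<bar>c y' n - c y n\<bar>"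
        using spike_bounds(1)[of n p] by (simp add: abs_mult)
    qed
    finally show ?thesis using y' by simp
  qed
  ultimately show "\<exists>U. openin Y U \<and> y \<in> U \<and> (\<forall>y'\<in>U. \<forall>p\<in>K. \<bar>stage_field (c y') p - stage_field (c y) p\<bar> < e)" by blast
qed

text \<open>A solution can wait at height \<open>- k\<close> until stage \<open>k\<close> starts, and from then on takes part in every
  stage.\<close>

definition coef :: "(nat \<Rightarrow> nat \<Rightarrow> real) \<Rightarrow> nat \<times> int \<Rightarrow> real" where
  "coef z = (\<lambda>(s, i). if s = 0 \<or> i < - int s then 0 else if i \<le> 0 then 1 else z s (nat i))"

lemma coef_nonneg: "\<forall>s m. 0 \<le> z s m \<Longrightarrow> 0 \<le> coef z n"
  unfolding coef_def by (auto split: prod.split)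

section \<open>The field in the phases of a stage\<close>

lemma sin_cos_stage:
  "sin (2 * pi * t) = sin (2 * pi * (t - real s))" "cos (2 * pi * t) = cos (2 * pi * (t - real s))"
proof -
  have "2 * pi * t = 2 * pi * (t - real s) + 2 * real s * pi" by (simp add: algebra_simps)
  then show "sin (2 * pi * t) = sin (2 * pi * (t - real s))" "cos (2 * pi * t) = cos (2 * pi * (t - real s))"
    by (simp_all only: sin_add cos_add sin_2npi cos_2npi mult_0_right mult_1_right add_0_right diff_0_right)
qed

lemma sin_push: "real s \<le> t \<Longrightarrow> t \<le> real s + 1 / 2 \<Longrightarrow> 0 \<le> sin (2 * pi * t)"
proof -
  assume t: "real s \<le> t" "t \<le> real s + 1 / 2"
  have "2 * pi * (t - real s) \<le> 2 * pi * (1 / 2)" using t by (intro mult_left_mono) auto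
  moreover have "0 \<le> 2 * pi * (t - real s)" using t by simp
  ultimately show ?thesis by (subst sin_cos_stage(1)[of t s]) (intro sin_ge_zero, auto)
qed

lemma sin_fall: "real s + 1 / 2 \<le> t \<Longrightarrow> t \<le> real s + 1 \<Longrightarrow> sin (2 * pi * t) \<le> 0"
proof -
  assume t: "real s + 1 / 2 \<le> t" "t \<le> real s + 1"
  have "sin (2 * pi * t) = - sin (2 * pi * (t - 1 / 2))"
    using sin_periodic_pi[of "2 * pi * (t - 1 / 2)"] by (simp add: algebra_simps)
  then show ?thesis using sin_push[of s "t - 1 / 2"] t by simp
qed

lemma stage_field_start:
  assumes "t \<le> 1" shows "stage_field (coef z) (t, v) = fan (t, v)"
proof -
  have "(\<Sum>n | spike n (t, v) \<noteq> 0. coef z n * spike n (t, v)) = 0"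
  proof (rule sum.neutral, rule ballI)
    fix n assume "n \<in> {n. spike n (t, v) \<noteq> 0}"
    \<comment> \<open>Only the spikes of stage 0 reach times up to 1, and their coefficients are
      0.\<close>
    then have "fst n = 0" using assms by (cases n) (auto simp: spike_nonzero)
    then show "coef z n * spike n (t, v) = 0" by (cases n) (simp add: coef_def)
  qed
  moreover have "push (t, v) = 0" "fall (t, v) = 0" using assms unfolding push_def fall_def by (auto simp: max_absorb2)
  ultimately show ?thesis unfolding stage_field_def by simp
qed

lemma stage_field_push_phase:
  assumes s: "1 \<le> s" and t: "real s \<le> t" "t \<le> real s + 1 / 2" and z: "\<forall>s m. 0 \<le> z s m"
  shows "0 \<le> push (t, v)" "push (t, v) \<le> stage_field (coef z) (t, v)"
    "stage_field (coef z) (t, real_of_int i) = coef z (s, i) * spike (s, i) (t, real_of_int i)"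
proof -
  have t1: "1 \<le> t" using s t by simp
  then have m: "max t 1 = t" by simp
  have fan: "fan (t, w) = 0" for w using t1 unfolding fan_def by simp
  have fall: "fall (t, w) = 0" for w using sin_push[OF t] by (simp add: fall_def m max_absorb1)
  show "0 \<le> push (t, v)" unfolding push_def by (simp add: infdist_nonneg)
  have "0 \<le> (\<Sum>n | spike n (t, v) \<noteq> 0. coef z n * spike n (t, v))"
    by (intro sum_nonneg mult_nonneg_nonneg coef_nonneg z spike_bounds)
  then show "push (t, v) \<le> stage_field (coef z) (t, v)" unfolding stage_field_def fan fall by simp
  have "push (t, real_of_int i) = 0" unfolding push_def by simp
  \<comment> \<open>At an integer height \<open>push\<close> vanishes and the spikes of the
    neighbouring integers have just dropped to 0, so a single coefficient decides about the
    field.\<close>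
  moreover have "(\<Sum>n | spike n (t, real_of_int i) \<noteq> 0. coef z n * spike n (t, real_of_int i)) =
      (\<Sum>n\<in>{(s, i)}. coef z n * spike n (t, real_of_int i))"
  proof (rule sum.mono_neutral_left)
    show "{n. spike n (t, real_of_int i) \<noteq> 0} \<subseteq> {(s, i)}"
    proof
      fix n assume n: "n \<in> {n. spike n (t, real_of_int i) \<noteq> 0}"
      obtain s' i' where e: "n = (s', i')" by (cases n)
      have "real s' < t" "t < real s' + 1 / 2" "\<bar>real_of_int i - real_of_int i'\<bar> < 1"
        using n unfolding e by (auto simp: spike_nonzero)
      then have "real s' < real s + 1" "real s < real s' + 1" "i = i'" using t by linarith+
      then show "n \<in> {(s, i)}" unfolding e by auto
    qed
  qed auto
  ultimately show "stage_field (coef z) (t, real_of_int i) = coef z (s, i) * spike (s, i) (t, real_of_int i)"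
    unfolding stage_field_def fan fall by simp
qed

lemma stage_field_fall_phase:
  assumes s: "1 \<le> s" and t: "real s + 1 / 2 \<le> t" "t \<le> real s + 1"
  shows "stage_field c (t, v) = 4 * sin (2 * pi * t) * (max 0 v)\<^sup>2"
proof -
  have t1: "1 \<le> t" using s t by simp
  then have m: "max t 1 = t" by simp
  have none: "{n. spike n (t, v) \<noteq> 0} = {}"
  proof (rule equals0I)
    fix n assume n: "n \<in> {n. spike n (t, v) \<noteq> 0}"
    obtain s' i' where e: "n = (s', i')" by (cases n)
    have "real s' < t" "t < real s' + 1 / 2" using n unfolding e by (auto simp: spike_nonzero)
    then have "real s' < real s + 1" "real s < real s'" using t by linarith+
    then show False by simp
  qed
  have "fan (t, v) = 0" using t1 unfolding fan_def by simp
  moreover have "push (t, v) = 0" using sin_fall[OF t] by (simp add: push_def m max_absorb1)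
  moreover have "fall (t, v) = - 4 * sin (2 * pi * t) * (max 0 v)\<^sup>2"
    using sin_fall[OF t] by (simp add: fall_def m max_absorb2)
  ultimately show ?thesis unfolding stage_field_def none by simp
qed

lemma stage_cases:
  assumes "1 \<le> t"
  obtains s where "1 \<le> s" "real s \<le> t" "t \<le> real s + 1 / 2" | s where "1 \<le> s" "real s + 1 / 2 \<le> t" "t < real s + 1"
proof -
  define s where "s = nat \<lfloor>t\<rfloor>"
  have "1 \<le> s" "real s \<le> t" "t < real s + 1" using assms unfolding s_def by linarith+
  then show ?thesis using that(1)[of s] that(2)[of s] by (cases "t \<le> real s + 1 / 2") auto
qed

section \<open>Explosion in a stage with positive coefficients\<close>

lemma sol_DERIV:
  assumes "sol F a b \<phi>" "a < t" "t < b" shows "DERIV \<phi> t :> F (t, \<phi> t)"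
proof -
  have "(\<phi> has_real_derivative F (t, \<phi> t)) (at t within {a..b})" using assms unfolding sol_def by simp
  then show ?thesis unfolding at_within_Icc_at[OF assms(2,3)] .
qed

lemma sol_nondecreasing:
  assumes "sol F a b \<phi>" "\<And>t. a \<le> t \<Longrightarrow> t \<le> b \<Longrightarrow> 0 \<le> F (t, \<phi> t)" "a \<le> t" "t \<le> u" "u \<le> b"
  shows "\<phi> t \<le> \<phi> u"
proof (rule DERIV_nonneg_imp_increasing_open[OF assms(4)])
  show "\<exists>y. DERIV \<phi> x :> y \<and> 0 \<le> y" if "t < x" "x < u" for x
    using sol_DERIV[OF assms(1), of x] assms(2)[of x] that assms(3,5) by auto
  show "continuous_on {t..u} \<phi>" using sol_continuous[OF assms(1)] by (rule continuous_on_subset) (use assms in auto)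
qed

text \<open>The product \<open>r * (1 - r)\<close> is at most \<open>r\<close> and at most
  \<open>1 - r\<close>. It replaces the distance because the resulting comparison equation is solved
  explicitly.\<close>

lemma infdist_Ints_ge:
  assumes "real_of_int m \<le> v" "v \<le> real_of_int m + 1"
  shows "(v - real_of_int m) * (1 - (v - real_of_int m)) \<le> infdist v \<int>"
proof -
  define r where "r = v - real_of_int m"
  have r: "0 \<le> r" "r \<le> 1" using assms unfolding r_def by auto
  have "r * (1 - r) \<le> dist v k" if k: "k \<in> \<int>" for k
  proof -
    obtain i where i: "k = real_of_int i" using k by (auto elim: Ints_cases)
    have 1: "r * (1 - r) \<le> r" "r * (1 - r) \<le> 1 - r" using r by (auto intro: mult_left_le mult_left_le_one_le)
    show ?thesis
    proof (cases "i \<le> m")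
      case True
      then have "r \<le> v - k" unfolding r_def i by simp
      moreover have "v - k \<le> dist v k" by (simp add: dist_real_def)
      ultimately show ?thesis using 1(1) by (meson order_trans)
    next
      case False
      then have "real_of_int m + 1 \<le> k" unfolding i by linarith
      then have "1 - r \<le> k - v" unfolding r_def by simp
      moreover have "k - v \<le> dist v k" by (simp add: dist_real_def)
      ultimately show ?thesis using 1(2) by (meson order_trans)
    qed
  qed
  then show ?thesis
    unfolding infdist_def r_def[symmetric] using Ints_0 by (auto intro!: cINF_greatest)
qed

text \<open>On this middle part of the first half the sine is at least 1/2, and
  \<open>2 powr (t + v)\<close> is at least \<open>2 ^ j\<close>. The factor 64 makes up for the 1/2
  and for \<open>pi < 4\<close>, and the rate obtained means a crossing time of
  \<open>1 / (8 * 2 ^ j)\<close> for the unit interval.\<close>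

lemma push_lower:
  assumes s: "1 \<le> s" and t: "real s + 1 / 8 \<le> t" "t \<le> real s + 3 / 8"
    and v: "real_of_int m \<le> v" "v \<le> real_of_int m + 1" and m: "m + int s = int j"
  shows "8 * pi * 2 ^ j * sqrt ((v - real_of_int m) * (1 - (v - real_of_int m))) \<le> push (t, v)"
proof -
  define \<tau> where "\<tau> = 2 * pi * (t - real s)"
  have \<tau>: "pi / 4 \<le> \<tau>" "\<tau> \<le> 3 * pi / 4"
    using mult_left_mono[of "1 / 8" "t - real s" "2 * pi"] mult_left_mono[of "t - real s" "3 / 8" "2 * pi"] t
    unfolding \<tau>_def by auto
  have "sin (pi / 6) \<le> sin \<tau>"
  proof (cases "\<tau> \<le> pi / 2")
    case True
    then show ?thesis using \<tau> pi_gt_zero by (intro sin_monotone_2pi_le) auto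
  next
    case False
    have "sin (pi / 6) \<le> sin (pi - \<tau>)" using \<tau> False pi_gt_zero by (intro sin_monotone_2pi_le) auto
    then show ?thesis by simp
  qed
  then have sn: "1 / 2 \<le> sin (2 * pi * t)" unfolding \<tau>_def by (subst sin_cos_stage(1)[of t s]) (simp add: sin_30)
  have "real_of_int m + real s = real j" using m by (metis of_int_add of_int_of_nat_eq)
  then have "2 powr real j \<le> 2 powr (t + v)" using t v by (intro powr_mono) auto
  then have pw: "2 ^ j \<le> 2 powr (t + v)" by (simp add: powr_realpow)
  have "8 * pi * 2 ^ j \<le> 64 * (1 / 2) * 2 ^ j" using pi_less_4 by simp
  also have "\<dots> \<le> 64 * max 0 (sin (2 * pi * max t 1)) * 2 powr (t + v)"
    using s t sn pw by (intro mult_mono) (auto simp: max_def)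
  finally have 1: "8 * pi * 2 ^ j \<le> 64 * max 0 (sin (2 * pi * max t 1)) * 2 powr (t + v)" .
  have "8 * pi * 2 ^ j * sqrt ((v - real_of_int m) * (1 - (v - real_of_int m))) \<le>
      64 * max 0 (sin (2 * pi * max t 1)) * 2 powr (t + v) * sqrt (infdist v \<int>)"
    by (rule mult_mono[OF 1 real_sqrt_le_mono[OF infdist_Ints_ge[OF v]]]) (use v in auto)
  then show ?thesis unfolding push_def by simp
qed

text \<open>The equation with right-hand side \<open>A \<surd>(r (1 - r))\<close> is solved by arcs of cosine, which need time
  \<open>\<pi> / A\<close> to get from \<open>0\<close> to \<open>1\<close>; in terms of \<open>arcsin (2 r - 1)\<close> the growth is linear.\<close>

lemma cross_unit:
  assumes s: "1 \<le> s" and z: "\<forall>s m. 0 \<le> z s m" and pos: "\<And>i. 1 \<le> i \<Longrightarrow> 0 < z s i"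
    and ab: "real s + 1 / 8 \<le> a" "b \<le> real s + 3 / 8" "b - a = 1 / (8 * 2 ^ j)"
    and m: "m + int s = int j" and \<phi>: "sol (stage_field (coef z)) a b \<phi>" and am: "real_of_int m \<le> \<phi> a"
  shows "real_of_int m + 1 \<le> \<phi> b"
proof (rule ccontr)
  let ?F = "stage_field (coef z)"
  assume neg: "\<not> ?thesis"
  have "0 < b - a" unfolding ab(3) by simp
  then have lt: "a < b" by simp
  have nn: "0 \<le> ?F (t, v)" if "a \<le> t" "t \<le> b" for t v
    using stage_field_push_phase(1,2)[OF s _ _ z, of t v] that ab by force
  have mono: "\<phi> t \<le> \<phi> u" if "a \<le> t" "t \<le> u" "u \<le> b" for t u
    by (rule sol_nondecreasing[OF \<phi> _ that]) (use nn in auto)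
  \<comment> \<open>Strict positivity rules out waiting. At integers it comes from a positive
    coefficient, as \<open>m\<close> is at least \<open>- s\<close>, and elsewhere from
    \<open>push\<close>.\<close>
  have Fpos: "0 < ?F (t, v)" if t: "a \<le> t" "t \<le> b" and v: "real_of_int m \<le> v" for t v
  proof (cases "v \<in> \<int>")
    case True
    then obtain i where i: "v = real_of_int i" by (auto elim: Ints_cases)
    then have "- int s \<le> i" using v m by simp
    then have "0 < coef z (s, i)" using s pos[of "nat i"] unfolding coef_def by auto
    moreover have "0 < spike (s, i) (t, real_of_int i)"
      using spike_bounds(1)[of "(s, i)" "(t, real_of_int i)"] spike_nonzero[of s i t "real_of_int i"] t ab by fastforce
    ultimately show ?thesis using stage_field_push_phase(3)[OF s _ _ z, of t i] t ab unfolding i by simp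
  next
    case False
    then have "infdist v \<int> \<noteq> 0" using in_closed_iff_infdist_zero[OF closed_Ints, of v] Ints_0 by auto
    then have "0 < sqrt (infdist v \<int>)" using infdist_nonneg[of v \<int>] by simp
    moreover have "0 < sin (2 * pi * max t 1)"
    proof -
      have "0 < 2 * pi * (t - real s)" "2 * pi * (t - real s) < 2 * pi * (1 / 2)"
        using t ab by (auto intro!: mult_strict_left_mono)
      then have "0 < sin (2 * pi * (t - real s))" by (intro sin_gt_zero) auto
      moreover have "max t 1 = t" using s t ab by simp
      ultimately show ?thesis using sin_cos_stage(1)[of t s] by simp
    qed
    ultimately have "0 < push (t, v)" unfolding push_def by simp
    then show ?thesis using stage_field_push_phase(2)[OF s _ _ z, of t v] t ab by force
  qed
  \<comment> \<open>Strictly inside the unit interval \<open>arcsin\<close> is differentiable at the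
    values that occur.\<close>
  have inner: "real_of_int m < \<phi> t \<and> \<phi> t < real_of_int m + 1" if t: "a < t" "t < b" for t
  proof -
    have "\<phi> a < \<phi> t"
    proof (rule DERIV_pos_imp_increasing_open[OF t(1)])
      show "\<exists>y. DERIV \<phi> x :> y \<and> 0 < y" if "a < x" "x < t" for x
        using sol_DERIV[OF \<phi>, of x] Fpos[of x "\<phi> x"] mono[of a x] am that t by force
      show "continuous_on {a..t} \<phi>" using sol_continuous[OF \<phi>] by (rule continuous_on_subset) (use t in auto)
    qed
    then show ?thesis using am mono[of t b] t neg by auto
  qed
  define A where "A = 8 * pi * 2 ^ j"
  define u where "u t = arcsin (2 * (\<phi> t - real_of_int m) - 1) - A * t" for t
  have range: "- 1 \<le> 2 * (\<phi> t - real_of_int m) - 1 \<and> 2 * (\<phi> t - real_of_int m) - 1 \<le> 1" if "t \<in> {a..b}" for t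
    using mono[of a t] mono[of t b] am neg that by auto
  have "u a \<le> u b"
  proof (rule DERIV_nonneg_imp_increasing_open[OF less_imp_le[OF lt]])
    show "continuous_on {a..b} u"
      unfolding u_def by (intro continuous_intros sol_continuous[OF \<phi>]) (use range in auto)
    fix t assume t: "a < t" "t < b"
    define r where "r = \<phi> t - real_of_int m"
    have r: "0 < r" "r < 1" using inner[OF t] unfolding r_def by auto
    have rr: "0 < r * (1 - r)" using r by simp
    have sq: "sqrt (1 - (2 * r - 1)\<^sup>2) = 2 * sqrt (r * (1 - r))"
    proof -
      have "1 - (2 * r - 1)\<^sup>2 = 2\<^sup>2 * (r * (1 - r))" by (simp add: power2_eq_square algebra_simps)
      then show ?thesis by (simp add: real_sqrt_mult)
    qed
    have "DERIV (\<lambda>t. 2 * (\<phi> t - real_of_int m) - 1) t :> 2 * ?F (t, \<phi> t)"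
      using sol_DERIV[OF \<phi> t] by (auto intro!: derivative_eq_intros)
    moreover have "DERIV arcsin (2 * (\<phi> t - real_of_int m) - 1) :> inverse (sqrt (1 - (2 * r - 1)\<^sup>2))"
      unfolding r_def[symmetric] by (rule DERIV_arcsin) (use r in auto)
    ultimately have "DERIV (\<lambda>t. arcsin (2 * (\<phi> t - real_of_int m) - 1)) t :> inverse (sqrt (1 - (2 * r - 1)\<^sup>2)) * (2 * ?F (t, \<phi> t))"
      by (rule DERIV_chain2[rotated])
    then have "DERIV u t :> inverse (sqrt (1 - (2 * r - 1)\<^sup>2)) * (2 * ?F (t, \<phi> t)) - A * 1"
      unfolding u_def[abs_def] by (intro DERIV_diff DERIV_cmult DERIV_ident)
    moreover have "A \<le> inverse (sqrt (1 - (2 * r - 1)\<^sup>2)) * (2 * ?F (t, \<phi> t))"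
    proof -
      have "A * sqrt (r * (1 - r)) \<le> push (t, \<phi> t)"
        unfolding A_def r_def by (rule push_lower[OF s _ _ _ _ m]) (use t ab inner[OF t] in auto)
      also have "\<dots> \<le> ?F (t, \<phi> t)" using stage_field_push_phase(2)[OF s _ _ z, of t "\<phi> t"] t ab by force
      finally show ?thesis using rr unfolding sq by (simp add: field_simps)
    qed
    ultimately show "\<exists>y. DERIV u t :> y \<and> 0 \<le> y" by auto
  qed
  \<comment> \<open>So \<open>arcsin\<close> has to grow by its full range from
    \<open>- pi / 2\<close> to \<open>pi / 2\<close>, which it reaches only at
    \<open>m + 1\<close>.\<close>
  moreover have "A * (b - a) = pi" unfolding A_def ab(3) by simp
  moreover have "- (pi / 2) \<le> arcsin (2 * (\<phi> a - real_of_int m) - 1)" using range[of a] lt by (intro arcsin_lbound) auto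
  ultimately have "pi / 2 \<le> arcsin (2 * (\<phi> b - real_of_int m) - 1)"
    unfolding u_def by (simp add: algebra_simps)
  moreover have "arcsin (2 * (\<phi> b - real_of_int m) - 1) < pi / 2"
  proof -
    have "arcsin (2 * (\<phi> b - real_of_int m) - 1) < arcsin 1"
      using range[of b] lt neg by (intro arcsin_less_arcsin) auto
    then show ?thesis by simp
  qed
  ultimately show False by simp
qed

text \<open>The crossing times \<open>1 / (8 * 2 ^ j)\<close> add up to 1/4, the distance from
  \<open>s + 1 / 8\<close> to \<open>s + 3 / 8\<close>. A solution that starts at height
  \<open>- s\<close> or above would pass every integer by then.\<close>

lemma dead_stage:
  assumes s: "1 \<le> s" and z: "\<forall>s m. 0 \<le> z s m" and pos: "\<And>i. 1 \<le> i \<Longrightarrow> 0 < z s i"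
    and \<phi>: "sol (stage_field (coef z)) (real s) (real s + 1) \<phi>" and start: "- real s \<le> \<phi> (real s)"
  shows False
proof -
  have nn: "0 \<le> stage_field (coef z) (t, v)" if "real s \<le> t" "t \<le> real s + 1 / 2" for t v
    using stage_field_push_phase(1,2)[OF s that z, of v] by simp
  have \<phi>h: "sol (stage_field (coef z)) (real s) (real s + 1 / 2) \<phi>" using \<phi> by (rule sol_subset) auto
  have mono: "\<phi> t \<le> \<phi> u" if "real s \<le> t" "t \<le> u" "u \<le> real s + 1 / 2" for t u
    by (rule sol_nondecreasing[OF \<phi>h _ that]) (use nn in auto)
  define a :: "nat \<Rightarrow> real" where "a j = real s + 3 / 8 - 1 / (4 * 2 ^ j)" for j
  have a: "real s + 1 / 8 \<le> a j" "a j \<le> real s + 3 / 8" for j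
  proof -
    have "(1::real) \<le> 2 ^ j" by simp
    then have "1 / 2 ^ j \<le> 1 / (1::real)" by (intro divide_left_mono) auto
    moreover have "1 / (4 * 2 ^ j) = 1 / 2 ^ j / (4::real)" by simp
    ultimately have "real s + 1 / 8 + 1 / (4 * 2 ^ j) \<le> real s + 3 / 8" by linarith
    then show "real s + 1 / 8 \<le> a j" unfolding a_def by linarith
    show "a j \<le> real s + 3 / 8" unfolding a_def by simp
  qed
  have low: "real j - real s \<le> \<phi> (a j)" for j
  proof (induction j)
    case 0
    then show ?case using mono[of "real s" "a 0"] start a[of 0] by simp
  next
    case (Suc j)
    have diff: "a (Suc j) - a j = 1 / (8 * 2 ^ j)" unfolding a_def by (simp add: field_simps)
    have "real_of_int (int j - int s) + 1 \<le> \<phi> (a (Suc j))"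
    proof (rule cross_unit[OF s z pos a(1)[of j] a(2)[of "Suc j"] diff])
      show "sol (stage_field (coef z)) (a j) (a (Suc j)) \<phi>"
        using \<phi> by (rule sol_subset) (use a[of j] a[of "Suc j"] in linarith)+
    qed (use Suc in auto)
    then show ?case by simp
  qed
  obtain j :: nat where j: "\<phi> (real s + 3 / 8) + real s < real j" using reals_Archimedean2 by blast
  have "\<phi> (a j) \<le> \<phi> (real s + 3 / 8)" using a[of j] by (intro mono) auto
  then show False using low[of j] j by simp
qed

lemma stage_field_nonneg_low:
  assumes "1 \<le> t" "v \<le> 0" "\<forall>s m. 0 \<le> z s m" shows "0 \<le> stage_field (coef z) (t, v)"
  using assms(1)
proof (cases rule: stage_cases)
  case (1 s)
  then show ?thesis using stage_field_push_phase(1,2)[OF 1 assms(3), of v] by simp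
next
  case (2 s)
  then show ?thesis using stage_field_fall_phase[of s t "coef z" v] assms(2) by simp
qed

text \<open>From time 1 on the field is nonnegative at heights up to 0, so a solution cannot sink
  after the last time at which it is at least \<open>- g\<close>.\<close>

lemma stays_above:
  assumes z: "\<forall>s m. 0 \<le> z s m" and \<phi>: "sol (stage_field (coef z)) 1 u \<phi>" and g: "- real g \<le> \<phi> 1" and u: "1 \<le> u"
  shows "- real g \<le> \<phi> u"
proof (rule ccontr)
  assume neg: "\<not> ?thesis"
  define S where "S = {1..u} \<inter> \<phi> -` {- real g..}"
  have "closed S" unfolding S_def
    by (rule continuous_closed_preimage[OF sol_continuous[OF \<phi>]]) auto
  moreover have "bounded S" unfolding S_def by (rule bounded_subset[OF bounded_closed_interval[of 1 u]]) auto
  ultimately have "compact S" by (simp add: compact_eq_bounded_closed)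
  moreover have "S \<noteq> {}" using g u unfolding S_def by auto
  ultimately obtain t0 where t0: "t0 \<in> S" "\<And>t. t \<in> S \<Longrightarrow> t \<le> t0" using compact_attains_sup[of S] by metis
  have below: "\<phi> t < - real g" if "t0 < t" "t \<le> u" for t
  proof (rule ccontr)
    assume "\<not> \<phi> t < - real g"
    then have "t \<in> S" using t0(1) that unfolding S_def by auto
    then show False using t0(2) that by force
  qed
  have "\<phi> t0 \<le> \<phi> u"
  proof (rule DERIV_nonneg_imp_increasing_open[of t0 u \<phi>])
    show "t0 \<le> u" using t0(1) unfolding S_def by simp
    show "continuous_on {t0..u} \<phi>" using sol_continuous[OF \<phi>] by (rule continuous_on_subset) (use t0(1) in \<open>auto simp: S_def\<close>)
    fix t assume t: "t0 < t" "t < u"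
    then have "1 < t" using t0(1) unfolding S_def by auto
    moreover have "\<phi> t \<le> 0" using below[of t] t by simp
    ultimately show "\<exists>y. DERIV \<phi> t :> y \<and> 0 \<le> y"
      using sol_DERIV[OF \<phi>, of t] stage_field_nonneg_low[of t "\<phi> t" z] z t by auto
  qed
  then show False using t0(1) neg unfolding S_def by simp
qed

text \<open>A global solution stays at or above \<open>- g\<close>, with \<open>g\<close> determined
  by its value at time 1. So it takes part in every stage \<open>s \<ge> g\<close> and survives it
  only if some coefficient is 0.\<close>

lemma global_from_imp_eventually:
  assumes z: "\<forall>s m. 0 \<le> z s m" and "global_from (stage_field (coef z)) 0 0"
  shows "\<exists>g. \<forall>s\<ge>g. \<exists>m\<ge>1. z s m = 0"
proof -
  obtain \<phi> where \<phi>: "\<And>n::nat. sol (stage_field (coef z)) 0 n \<phi>" using assms(2) unfolding global_from_def by auto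
  obtain g :: nat where g: "- \<phi> 1 \<le> real g" using real_arch_simple by blast
  have "\<exists>m\<ge>1. z s m = 0" if s: "max 1 g \<le> s" for s
  proof (rule ccontr)
    assume neg: "\<not> ?thesis"
    have "- real g \<le> \<phi> (real s)"
      by (rule stays_above[OF z sol_subset[OF \<phi>[of s]]]) (use s g in auto)
    then have "- real s \<le> \<phi> (real s)" using s by simp
    moreover have "sol (stage_field (coef z)) (real s) (real s + 1) \<phi>"
      using \<phi>[of "Suc s"] by (rule sol_subset) auto
    moreover have "0 < z s i" if "1 \<le> i" for i using neg z[rule_format, of s i] that by (metis less_eq_real_def)
    ultimately show False using dead_stage[of s z \<phi>] z s by simp
  qed
  then show ?thesis by blast
qed

section \<open>Survival of stages with a zero coefficient\<close>

lemma sol_const: "(\<And>t. a \<le> t \<Longrightarrow> t \<le> b \<Longrightarrow> F (t, k) = 0) \<Longrightarrow> sol F a b (\<lambda>_. k)"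
  unfolding sol_def by simp

text \<open>For \<open>v = - (u * u)\<close> with \<open>u \<ge> 0\<close> the equation lets
  \<open>arctan u\<close> grow with speed \<open>4 * (1 - t)\<close>, hence by
  \<open>2 * (\<rho> * \<rho>)\<close> if 0 is left at time \<open>1 - \<rho>\<close>. Every value
  of \<open>arctan\<close> is below \<open>pi / 2\<close>, so some \<open>\<rho> \<le> 1\<close>
  suffices.\<close>

lemma sol_fan:
  "\<exists>\<phi>. sol (stage_field (coef z)) 0 1 \<phi> \<and> \<phi> 0 = 0 \<and> \<phi> 1 = - real k"
proof -
  let ?F = "stage_field (coef z)"
  define \<rho> where "\<rho> = sqrt (arctan (sqrt (real k)) / 2)"
  have at: "0 \<le> arctan (sqrt (real k))" "arctan (sqrt (real k)) < pi / 2" using arctan_ubound by auto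
  have "arctan (sqrt (real k)) / 2 \<le> 1" using at pi_less_4 by simp
  then have \<rho>: "0 \<le> \<rho>" "\<rho> \<le> 1" "2 * \<rho>\<^sup>2 = arctan (sqrt (real k))" using at unfolding \<rho>_def by auto
  define \<theta> where "\<theta> t = 2 * (\<rho>\<^sup>2 - (1 - t)\<^sup>2)" for t
  have \<theta>: "0 \<le> \<theta> t" "\<theta> t < pi / 2" if "1 - \<rho> \<le> t" "t \<le> 1" for t
  proof -
    have "(1 - t)\<^sup>2 \<le> \<rho>\<^sup>2" using that by (intro power_mono) auto
    then show "0 \<le> \<theta> t" unfolding \<theta>_def by simp
    have "\<theta> t \<le> 2 * \<rho>\<^sup>2" unfolding \<theta>_def by simp
    then show "\<theta> t < pi / 2" using \<rho>(3) at(2) by simp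
  qed
  have "sol ?F 0 (1 - \<rho>) (\<lambda>_. 0)"
    by (rule sol_const) (use \<rho> in \<open>simp add: stage_field_start fan_def\<close>)
  moreover have "sol ?F (1 - \<rho>) 1 (\<lambda>t. - (tan (\<theta> t))\<^sup>2)"
    unfolding sol_def
  proof
    fix t assume t: "t \<in> {1 - \<rho>..1}"
    have c: "cos (\<theta> t) \<noteq> 0" using \<theta>[of t] t by (intro less_imp_neq[THEN not_sym] cos_gt_zero_pi) auto
    have tn: "0 \<le> tan (\<theta> t)" using \<theta>[of t] t by (intro tan_pos_pi2_le) auto
    have "(\<theta> has_real_derivative 4 * (1 - t)) (at t within {1 - \<rho>..1})"
      unfolding \<theta>_def by (auto intro!: derivative_eq_intros simp: algebra_simps)
    then have "((\<lambda>t. tan (\<theta> t)) has_real_derivative inverse ((cos (\<theta> t))\<^sup>2) * (4 * (1 - t))) (at t within {1 - \<rho>..1})"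
      by (rule DERIV_chain2[where f = tan and g = \<theta>, OF DERIV_tan[OF c]])
    from DERIV_minus[OF DERIV_power[OF this, of 2]]
    have "((\<lambda>t. - (tan (\<theta> t))\<^sup>2) has_real_derivative - (2 * tan (\<theta> t) * (inverse ((cos (\<theta> t))\<^sup>2) * (4 * (1 - t))))) (at t within {1 - \<rho>..1})"
      by (simp add: mult_ac)
    moreover have "?F (t, - (tan (\<theta> t))\<^sup>2) = - (2 * tan (\<theta> t) * (inverse ((cos (\<theta> t))\<^sup>2) * (4 * (1 - t))))"
    proof -
      have "?F (t, - (tan (\<theta> t))\<^sup>2) = - (4 * (1 - t) * (2 * tan (\<theta> t) * (1 + (tan (\<theta> t))\<^sup>2)))"
        using t tn by (simp add: stage_field_start fan_def)
      also have "1 + (tan (\<theta> t))\<^sup>2 = inverse ((cos (\<theta> t))\<^sup>2)" using tan_sec[OF c] by (simp add: power_inverse)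
      finally show ?thesis by (simp add: algebra_simps)
    qed
    ultimately show "((\<lambda>t. - (tan (\<theta> t))\<^sup>2) has_real_derivative ?F (t, - (tan (\<theta> t))\<^sup>2)) (at t within {1 - \<rho>..1})"
      by simp
  qed
  ultimately have "sol ?F 0 1 (\<lambda>t. if t \<le> 1 - \<rho> then 0 else - (tan (\<theta> t))\<^sup>2)"
    by (rule sol_glue) (use \<rho> in \<open>auto simp: \<theta>_def\<close>)
  moreover have "- (tan (\<theta> 1))\<^sup>2 = - real k" using \<rho>(3) unfolding \<theta>_def by (simp add: tan_arctan)
  ultimately show ?thesis
    using \<rho> by (intro exI[of _ "\<lambda>t. if t \<le> 1 - \<rho> then 0 else - (tan (\<theta> t))\<^sup>2"]) (auto simp: \<rho>_def split: if_splits)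
qed

lemma reachable_waiting:
  assumes z: "\<forall>s m. 0 \<le> z s m" and k: "1 \<le> k"
  shows "reachable (stage_field (coef z)) (real k) (- real k)"
proof -
  let ?F = "stage_field (coef z)"
  obtain \<phi> where \<phi>: "sol ?F 0 1 \<phi>" "\<phi> 0 = 0" "\<phi> 1 = - real k" using sol_fan by blast
  have "sol ?F 1 (real k) (\<lambda>_. - real k)"
  proof (rule sol_const)
    fix t assume t: "1 \<le> t" "t \<le> real k"
    from t(1) show "?F (t, - real k) = 0"
    proof (cases rule: stage_cases)
      case (1 s)
      have "?F (t, real_of_int (- int k)) = coef z (s, - int k) * spike (s, - int k) (t, real_of_int (- int k))"
        by (rule stage_field_push_phase(3)[OF 1 z])
      moreover have "coef z (s, - int k) = 0 \<or> spike (s, - int k) (t, real_of_int (- int k)) = 0"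
      \<comment> \<open>Before stage \<open>k\<close> the height \<open>- k\<close> lies below
        \<open>- s\<close> and has coefficient 0. Stage \<open>k\<close> is met only at its starting
        moment, when its spikes are still 0.\<close>
      proof (cases "s < k")
        case False
        then have "t \<le> real s" using t(2) by simp
        then show ?thesis using spike_nonzero by (metis not_less)
      qed (simp add: coef_def)
      ultimately show ?thesis by auto
    next
      case (2 s)
      then show ?thesis using stage_field_fall_phase[of s t "coef z" "- real k"] by simp
    qed
  qed
  from sol_glue[OF \<phi>(1) this] \<phi>(2,3) k
  have "sol ?F 0 (real k) (\<lambda>t. if t \<le> 1 then \<phi> t else - real k)" by simp
  then show ?thesis
    unfolding reachable_def using \<phi> k
    by (intro exI[of _ "\<lambda>t. if t \<le> 1 then \<phi> t else - real k"]) auto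
qed

text \<open>While \<open>v\<close> is positive, \<open>1 / v\<close> grows with speed
  \<open>- 4 * sin (2 * pi * t)\<close>, altogether by \<open>4 / pi\<close>. So every height ends
  below \<open>pi / 4\<close>, wherever it began, and nonpositive heights do not move.\<close>

lemma sol_fall:
  assumes s: "1 \<le> s" and v: "- real s - 1 \<le> v"
  shows "\<exists>\<psi>. sol (stage_field c) (real s + 1 / 2) (real s + 1) \<psi> \<and> \<psi> (real s + 1 / 2) = v \<and>
    - real s - 1 \<le> \<psi> (real s + 1) \<and> \<psi> (real s + 1) \<le> 1"
proof (cases "v \<le> 0")
  case True
  have "sol (stage_field c) (real s + 1 / 2) (real s + 1) (\<lambda>_. v)"
    by (rule sol_const) (use True s in \<open>simp add: stage_field_fall_phase\<close>)
  then show ?thesis using True v by (intro exI[of _ "\<lambda>_. v"]) auto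
next
  case False
  define b where "b t = 2 / pi * (1 + cos (2 * pi * t))" for t
  have b0: "0 \<le> b t" for t
  proof -
    have "0 \<le> 1 + cos (2 * pi * t)" using cos_ge_minus_one[of "2 * pi * t"] by linarith
    then show ?thesis unfolding b_def by (intro mult_nonneg_nonneg) auto
  qed
  have den: "0 < 1 + v * b t" for t using False b0[of t] by (simp add: add_pos_nonneg)
  have "sol (stage_field c) (real s + 1 / 2) (real s + 1) (\<lambda>t. v / (1 + v * b t))"
    unfolding sol_def
  proof
    fix t assume t: "t \<in> {real s + 1 / 2..real s + 1}"
    have "(b has_real_derivative - 4 * sin (2 * pi * t)) (at t within {real s + 1 / 2..real s + 1})"
      unfolding b_def by (auto intro!: derivative_eq_intros simp: field_simps)
    then have "((\<lambda>t. v / (1 + v * b t)) has_real_derivative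
        (0 * (1 + v * b t) - v * (0 + v * (- 4 * sin (2 * pi * t)))) / ((1 + v * b t) * (1 + v * b t)))
        (at t within {real s + 1 / 2..real s + 1})"
      using den[of t] by (intro DERIV_divide DERIV_const DERIV_add DERIV_cmult) auto
    moreover have "stage_field c (t, v / (1 + v * b t)) = 4 * sin (2 * pi * t) * (v / (1 + v * b t))\<^sup>2"
      using stage_field_fall_phase[OF s, of t c] t den[of t] False by (simp add: max_def)
    moreover have "(0 * (1 + v * b t) - v * (0 + v * (- 4 * sin (2 * pi * t)))) / ((1 + v * b t) * (1 + v * b t)) =
        4 * sin (2 * pi * t) * (v / (1 + v * b t))\<^sup>2"
      by (simp add: power2_eq_square)
    ultimately show "((\<lambda>t. v / (1 + v * b t)) has_real_derivative stage_field c (t, v / (1 + v * b t)))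
        (at t within {real s + 1 / 2..real s + 1})" by simp
  qed
  moreover have "b (real s + 1 / 2) = 0"
    unfolding b_def by (subst sin_cos_stage(2)[of _ s]) simp
  moreover have "b (real s + 1) = 4 / pi"
    unfolding b_def by (subst sin_cos_stage(2)[of _ "Suc s"]) simp
  moreover have "v / (1 + v * (4 / pi)) \<le> 1" "- real s - 1 \<le> v / (1 + v * (4 / pi))"
  proof -
    have p: "1 \<le> 4 / pi" using pi_less_4 pi_gt_zero by simp
    then have d: "v * 1 \<le> v * (4 / pi)" using False by (intro mult_left_mono) auto
    then show "v / (1 + v * (4 / pi)) \<le> 1" using False by (subst divide_le_eq_1) auto
    have "0 \<le> v / (1 + v * (4 / pi))" using False d by simp
    then show "- real s - 1 \<le> v / (1 + v * (4 / pi))" by linarith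
  qed
  ultimately show ?thesis by (intro exI[of _ "\<lambda>t. v / (1 + v * b t)"]) auto
qed

lemma eventually_imp_global_from:
  assumes z: "\<forall>s m. 0 \<le> z s m" and g: "\<And>s. g \<le> s \<Longrightarrow> \<exists>m\<ge>1. z s m = 0"
  shows "global_from (stage_field (coef z)) 0 0"
proof -
  let ?F = "stage_field (coef z)"
  define h where "h = max 1 g"
  \<comment> \<open>In stage \<open>s\<close> the highest nonpositive integer with coefficient 0 is
    \<open>- s - 1\<close>, and 1 is at most any trap \<open>m\<close>.\<close>
  define Inv where "Inv t v \<longleftrightarrow> (\<exists>s. t = real s \<and> h \<le> s \<and> - real s - 1 \<le> v \<and> v \<le> 1)" for t v
  have "global_from ?F (real h) (- real h)"
  proof (rule global_from_chain[of Inv])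
    show "Inv (real h) (- real h)" unfolding Inv_def by (intro exI[of _ h]) auto
    fix t v assume "Inv t v"
    then obtain s where s: "t = real s" "h \<le> s" "- real s - 1 \<le> v" "v \<le> 1" unfolding Inv_def by blast
    then have s1: "1 \<le> s" unfolding h_def by simp
    obtain m where m: "m \<ge> 1" "z s m = 0" using g[of s] s(2) unfolding h_def by auto
    have A: "sol ?F (real s) (real s + 1 / 2) (\<lambda>_. real_of_int (int m))"
      by (rule sol_const) (use m s1 stage_field_push_phase(3)[OF s1 _ _ z, of _ "int m"] in \<open>simp add: coef_def\<close>)
    have B: "sol ?F (real s) (real s + 1 / 2) (\<lambda>_. real_of_int (- int s - 1))"
      by (rule sol_const) (use stage_field_push_phase(3)[OF s1 _ _ z, of _ "- int s - 1"] in \<open>simp add: coef_def\<close>)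
    \<comment> \<open>The constants at \<open>m\<close> and at \<open>- s - 1\<close> are barriers,
      and a solution through \<open>v\<close> between them survives the first half of the
      stage.\<close>
    obtain \<phi> where \<phi>: "sol ?F (real s) (real s + 1 / 2) \<phi>" "\<phi> (real s) = v"
      "\<And>t. t \<in> {real s..real s + 1 / 2} \<Longrightarrow> real_of_int (- int s - 1) \<le> \<phi> t \<and> \<phi> t \<le> real_of_int (int m)"
      using sol_between[OF continuous_stage_field _ B A, where v = v] s m by auto
    have "- real s - 1 \<le> \<phi> (real s + 1 / 2)" using \<phi>(3)[of "real s + 1 / 2"] by simp
    then obtain \<psi> where \<psi>: "sol ?F (real s + 1 / 2) (real s + 1) \<psi>" "\<psi> (real s + 1 / 2) = \<phi> (real s + 1 / 2)"
      "- real s - 1 \<le> \<psi> (real s + 1)" "\<psi> (real s + 1) \<le> 1" using sol_fall[OF s1] by blast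
    let ?g = "\<lambda>t. if t \<le> real s + 1 / 2 then \<phi> t else \<psi> t"
    have "sol ?F t (real (Suc s)) ?g"
      using sol_glue[OF \<phi>(1) \<psi>(1)] \<psi>(2) s(1) by (simp add: add.commute)
    moreover have "Inv (real (Suc s)) (?g (real (Suc s)))"
      unfolding Inv_def using s(2) \<psi>(3,4) by (intro exI[of _ "Suc s"]) (auto simp: add.commute)
    moreover have "?g t = v" using s(1) \<phi>(2) by simp
    ultimately show "\<exists>t' \<phi>. t + 1 \<le> t' \<and> sol ?F t t' \<phi> \<and> \<phi> t = v \<and> Inv t' (\<phi> t')"
      using s(1) by (intro exI[of _ "real (Suc s)"] exI[of _ ?g]) auto
  qed
  then show ?thesis
    by (rule reachable_global_from[rotated 2]) (use reachable_waiting[OF z, of h] in \<open>auto simp: h_def\<close>)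
qed

lemma stage_field_globally_solvable:
  assumes z: "\<forall>s m. 0 \<le> z s m"
  shows "(stage_field (coef z), 0, 0) \<in> globally_solvable \<longleftrightarrow> (\<exists>g. \<forall>s\<ge>g. \<exists>m\<ge>1. z s m = 0)"
proof -
  let ?F = "stage_field (coef z)"
  have "ahead (?F, 0, 0) = ?F" unfolding ahead_def by (simp add: fun_eq_iff)
  \<comment> \<open>Up to time 1 only \<open>fan\<close> acts, and it vanishes at height 0, so
    backwards in time the constant 0 is a solution.\<close>
  moreover have "global_from (behind (?F, 0, 0)) 0 0"
    unfolding global_from_def behind_def
    by (intro exI[of _ "\<lambda>_. 0"] conjI allI sol_const) (auto simp: stage_field_start fan_def)
  ultimately have "(?F, 0, 0) \<in> globally_solvable \<longleftrightarrow> global_from ?F 0 0"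
    unfolding globally_solvable_def using continuous_stage_field global_solution_iff[OF continuous_stage_field] by simp
  then show ?thesis
    using global_from_imp_eventually[OF z] eventually_imp_global_from[OF z] by blast
qed

theorem theorem5p21:
  shows "Sigma0_complete TYPE('b) (prod_topology C_plane (euclidean :: (real \<times> real) topology)) 4
           globally_solvable"
  unfolding Sigma0_complete_def
proof (intro conjI allI impI)
  show "Polish_space (prod_topology C_plane (euclidean :: (real \<times> real) topology))"
    by (rule Polish_problems)
  show "Sigma0 (prod_topology C_plane (euclidean :: (real \<times> real) topology)) 4 globally_solvable"
    by (rule Sigma0_globally_solvable)
  fix Y :: "'b topology" and B
  assume YB: "Polish_space Y \<and> Y dim_le 0 \<and> Sigma0 Y 4 B"
  then have Y: "metrizable_space Y"
    unfolding Polish_space_def using completely_metrizable_imp_metrizable_space by blast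
  have "Sigma0 Y 4 B" using YB by blast
  from eventually_Sigma0_2[OF Y this] obtain T where
    "(\<forall>s. Sigma0 Y 2 (T s)) \<and> (\<forall>y\<in>topspace Y. y \<in> B \<longleftrightarrow> (\<exists>g::nat. \<forall>s\<ge>g. y \<in> T s))" ..
  then have T: "\<And>s. Sigma0 Y 2 (T s)"
    "\<And>y. y \<in> topspace Y \<Longrightarrow> y \<in> B \<longleftrightarrow> (\<exists>g. \<forall>s\<ge>g. y \<in> T s)"
    by simp_all
  have "\<exists>c. \<forall>m::nat. continuous_map Y euclideanreal (c m) \<and> (\<forall>y. 0 \<le> c m y) \<and>
      (\<forall>y\<in>topspace Y. y \<in> T s \<longleftrightarrow> (\<exists>m. c m y = 0))" for s
  proof -
    obtain C where C: "\<And>m::nat. Pi0 Y (Suc 0) (C m)" "T s = (\<Union>m. C m)"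
      using Sigma0_SucE[OF Y, of "Suc 0" "T s"] T(1)[of s] by (auto simp: numeral_2_eq_2)
    have "\<exists>c. continuous_map Y euclideanreal c \<and> (\<forall>y. 0 \<le> c y) \<and> (\<forall>y\<in>topspace Y. c y = 0 \<longleftrightarrow> y \<in> C m)" for m
      using closedin_zero_set[OF Y C(1)[of m, unfolded Pi0_1_iff]] by metis
    then obtain c where "\<And>m. continuous_map Y euclideanreal (c m) \<and> (\<forall>y. 0 \<le> c m y) \<and>
        (\<forall>y\<in>topspace Y. c m y = 0 \<longleftrightarrow> y \<in> C m)" by metis
    then show ?thesis using C(2) by (intro exI[of _ c]) auto
  qed
  then have "\<forall>s. \<exists>c. \<forall>m::nat. continuous_map Y euclideanreal (c m) \<and> (\<forall>y. 0 \<le> c m y) \<and>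
      (\<forall>y\<in>topspace Y. y \<in> T s \<longleftrightarrow> (\<exists>m. c m y = 0))" by blast
  from choice[OF this] obtain c where c: "\<forall>s. \<forall>m::nat. continuous_map Y euclideanreal (c s m) \<and> (\<forall>y. 0 \<le> c s m y) \<and>
      (\<forall>y\<in>topspace Y. y \<in> T s \<longleftrightarrow> (\<exists>m. c s m y = 0))" ..
  \<comment> \<open>Traps have heights \<open>m \<ge> 1\<close>, while the closed sets are numbered
    from 0.\<close>
  define z where "z y s m = c s (m - 1) y" for y s m
  have zc: "(\<exists>m\<ge>1. z y s m = 0) \<longleftrightarrow> (\<exists>m. c s m y = 0)" for y s
    unfolding z_def by (metis diff_Suc_1 le_add1 plus_1_eq_Suc)
  define f where "f y = (stage_field (coef (z y)), 0 :: real, 0 :: real)" for y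
  have "continuous_map Y C_plane (\<lambda>y. stage_field (coef (z y)))"
  proof (rule continuous_map_stage_field)
    fix n :: "nat \<times> int"
    obtain s i where n: "n = (s, i)" by (cases n)
    show "continuous_map Y euclideanreal (\<lambda>y. coef (z y) n)"
      unfolding n coef_def z_def using c by simp
  qed
  then have "continuous_map Y (prod_topology C_plane euclidean) f"
    unfolding f_def by (intro continuous_map_pairedI) auto
  moreover have "B = {y \<in> topspace Y. f y \<in> globally_solvable}"
  proof -
    have "f y \<in> globally_solvable \<longleftrightarrow> y \<in> B" if y: "y \<in> topspace Y" for y
    proof -
      have "f y \<in> globally_solvable \<longleftrightarrow> (\<exists>g. \<forall>s\<ge>g. \<exists>m\<ge>1. z y s m = 0)"
        unfolding f_def by (rule stage_field_globally_solvable) (use c in \<open>simp add: z_def\<close>)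
      also have "\<dots> \<longleftrightarrow> (\<exists>g. \<forall>s\<ge>g. y \<in> T s)" using c y unfolding zc by blast
      also have "\<dots> \<longleftrightarrow> y \<in> B" using T(2)[OF y] by simp
      finally show ?thesis .
    qed
    moreover have "B \<subseteq> topspace Y" using YB Sigma0_subset_topspace by blast
    ultimately show ?thesis by blast
  qed
  ultimately show "\<exists>f. continuous_map Y (prod_topology C_plane euclidean) f \<and> B = {y \<in> topspace Y. f y \<in> globally_solvable}"
    by blast
qed

end
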